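(* Let $\vec B=(B_{kl},i_k,j_k)$ be a $\mathbb{C}$-stable solution of the complex ADHM equations and let $\mathcal{E}=\ker\beta/\mathrm{Im}\,\alpha$ be the cohomology sheaf on $\mathbb{P}^3$ of the associated monad. Then $\mathcal{E}$ is locally-free if and only if $\vec B$ is $\mathbb{C}$-regular.
   Context: Let $V,W$ be complex vector spaces with $\dim V=c\ge 1$, $\dim W=r\ge1$. A tuple $(B_1,B_2,i,j)$ with $B_1,B_2\in\mathrm{End}(V)$, $i\in\mathrm{Hom}(W,V)$, $j\in\mathrm{Hom}(V,W)$ is: stable if there is no proper subspace $S\subsetneq V$ with $B_k(S)\subset S$ ($k=1,2$) and $i(W)\subset S$; costable if there is no nonzero subspace $S\subset V$ with $B_k(S)\subset S$ ($k=1,2$) and $S\subset\ker j$; regular if it is both stable and costable. A complex ADHM datum is $\vec B=(B_{kl},i_k,j_k)_{k,l=1,2}$ with $B_{kl}\in\mathrm{End}(V)$, $i_k\in\mathrm{Hom}(W,V)$, $j_k\in\mathrm{Hom}(V,W)$. For $p=[z:w]\in\mathbb{P}^1$ put $\vec B_p=(zB_{11}+wB_{21},\,zB_{12}+wB_{22},\,zi_1+wi_2,\,zj_1+wj_2)$ (well defined up to a nonzero scalar). $\vec B$ is $\mathbb{C}$-stable (resp. $\mathbb{C}$-regular) if $\vec B_p$ is stable (resp. regular) for all $p\in\mathbb{P}^1$. The complex ADHM equations are $$[B_{11},B_{12}]+i_1j_1=0,\quad [B_{21},B_{22}]+i_2j_2=0,\quad [B_{11},B_{22}]+[B_{21},B_{12}]+i_1j_2+i_2j_1=0.$$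 The associated monad on $\mathbb{P}^3$ (homogeneous coordinates $[x:y:z:w]$) is $$V\otimes\mathcal{O}_{\mathbb{P}^3}(-1)\xrightarrow{\ \alpha\ }(V\oplus V\oplus W)\otimes\mathcal{O}_{\mathbb{P}^3}\xrightarrow{\ \beta\ }V\otimes\mathcal{O}_{\mathbb{P}^3}(1),$$ $$\alpha=\begin{pmatrix} zB_{11}+wB_{21}+x\\ zB_{12}+wB_{22}+y\\ zj_1+wj_2\end{pmatrix},\quad \beta=\begin{pmatrix}-zB_{12}-wB_{22}-y & zB_{11}+wB_{21}+x & zi_1+wi_2\end{pmatrix},$$ where $x,y$ stand for $x\cdot\mathrm{id}_V$, $y\cdot\mathrm{id}_V$; the complex ADHM equations give $\beta\alpha=0$. *)

theory Defs
  imports "HOL-Analysis.Analysis" "HOL-Algebra.AbelCoset" "HOL-Algebra.Module"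
begin

text \<open>
  A presheaf on a topological space assigns to an open set \<open>U\<close> a structure \<open>sects F U\<close> (a ring
  record or a module record), and \<open>rstr F U V\<close> is the restriction map from \<open>U\<close> to \<open>V \<subseteq> U\<close>.
  In module records the fields \<open>mult\<close> and \<open>one\<close>, which are inherited from ring records,
  are irrelevant.
\<close>

record ('p, 's, 'a) presheaf =
  sects :: "'p set \<Rightarrow> 's"
  rstr :: "'p set \<Rightarrow> 'p set \<Rightarrow> 'a \<Rightarrow> 'a"

type_synonym ('p, 'r) ring_presheaf = "('p, 'r ring, 'r) presheaf"
type_synonym ('p, 'r, 'm) mod_presheaf = "('p, ('r, 'm) module, 'm) presheaf"

text \<open>The germ at \<open>P\<close> of a section \<open>s\<close> over \<open>U\<close>, as an equivalence class of pairs.\<close>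

definition germ :: "'p topology \<Rightarrow> ('p, 'r, 'm) mod_presheaf \<Rightarrow> 'p \<Rightarrow> 'p set \<Rightarrow> 'm
    \<Rightarrow> ('p set \<times> 'm) set" where
  "germ X F P U s = {(V, t). openin X V \<and> P \<in> V \<and> t \<in> carrier (sects F V) \<and>
     (\<exists>W. openin X W \<and> P \<in> W \<and> W \<subseteq> U \<inter> V \<and> rstr F U W s = rstr F V W t)}"

definition germ_add :: "'p topology \<Rightarrow> ('p, 'r, 'm) mod_presheaf \<Rightarrow> 'p
    \<Rightarrow> ('p set \<times> 'm) set \<Rightarrow> ('p set \<times> 'm) set \<Rightarrow> ('p set \<times> 'm) set" where
  "germ_add X F P a b = (\<Union>(U, s)\<in>a. \<Union>(V, t)\<in>b.
     germ X F P (U \<inter> V)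
       (add (sects F (U \<inter> V)) (rstr F U (U \<inter> V) s) (rstr F V (U \<inter> V) t)))"

definition germ_smult :: "'p topology \<Rightarrow> ('p, 'r) ring_presheaf \<Rightarrow> ('p, 'r, 'm) mod_presheaf
    \<Rightarrow> 'p \<Rightarrow> 'p set \<Rightarrow> 'r \<Rightarrow> ('p set \<times> 'm) set \<Rightarrow> ('p set \<times> 'm) set" where
  "germ_smult X R F P U f a = (\<Union>(V, t)\<in>a.
     germ X F P (U \<inter> V)
       (smult (sects F (U \<inter> V)) (rstr R U (U \<inter> V) f) (rstr F V (U \<inter> V) t)))"

text \<open>
  The sheaf associated with a presheaf: its sections over \<open>U\<close> are the families of germs that are
  locally induced by sections of the presheaf.
\<close>

definition sheafify :: "'p topology \<Rightarrow> ('p, 'r) ring_presheaf \<Rightarrow> ('p, 'r, 'm) mod_presheaf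
    \<Rightarrow> ('p, 'r, 'p \<Rightarrow> ('p set \<times> 'm) set) mod_presheaf" where
  "sheafify X R F = \<lparr>
     sects = (\<lambda>U. \<lparr>
       carrier = {\<sigma> \<in> extensional U. \<forall>P\<in>U. \<exists>V t. openin X V \<and> P \<in> V \<and> V \<subseteq> U \<and>
                    t \<in> carrier (sects F V) \<and> (\<forall>Q\<in>V. \<sigma> Q = germ X F Q V t)},
       mult = undefined, one = undefined,
       zero = (\<lambda>P\<in>U. germ X F P U (zero (sects F U))),
       add = (\<lambda>\<sigma> \<tau>. \<lambda>P\<in>U. germ_add X F P (\<sigma> P) (\<tau> P)),
       smult = (\<lambda>f \<sigma>. \<lambda>P\<in>U. germ_smult X R F P U f (\<sigma> P)) \<rparr>),
     rstr = (\<lambda>U V \<sigma>. restrict \<sigma> V) \<rparr>"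

text \<open>
  A morphism of presheaves is given by its components \<open>\<phi> U\<close>. Both the kernel and the image are
  returned as subsheaves; the image is the sheaf image, i.e. membership is tested locally.
\<close>

definition kernel_sheaf :: "('p, 'r, 'm) mod_presheaf \<Rightarrow> ('p, 'r, 'l) mod_presheaf
    \<Rightarrow> ('p set \<Rightarrow> 'm \<Rightarrow> 'l) \<Rightarrow> ('p, 'r, 'm) mod_presheaf" where
  "kernel_sheaf F G \<phi> = \<lparr>
     sects = (\<lambda>U. (sects F U)
       \<lparr>carrier := {s \<in> carrier (sects F U). \<phi> U s = zero (sects G U)}\<rparr>),
     rstr = rstr F \<rparr>"

definition image_sheaf :: "'p topology \<Rightarrow> ('p, 'r, 'm) mod_presheaf
    \<Rightarrow> ('p, 'r, 'l) mod_presheaf \<Rightarrow> ('p set \<Rightarrow> 'm \<Rightarrow> 'l) \<Rightarrow> ('p, 'r, 'l) mod_presheaf" where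
  "image_sheaf X F G \<phi> = \<lparr>
     sects = (\<lambda>U. (sects G U)
       \<lparr>carrier := {t \<in> carrier (sects G U). \<forall>P\<in>U. \<exists>V. openin X V \<and> P \<in> V \<and> V \<subseteq> U \<and>
                      rstr G U V t \<in> \<phi> V ` carrier (sects F V)}\<rparr>),
     rstr = rstr G \<rparr>"

text \<open>For a subsheaf \<open>N\<close> of \<open>K\<close>: the presheaf of the quotients \<open>K(U) / N(U)\<close>.\<close>

definition quotient_presheaf :: "('p, 'r, 'm) mod_presheaf \<Rightarrow> ('p, 'r, 'm) mod_presheaf
    \<Rightarrow> ('p, 'r, 'm set) mod_presheaf" where
  "quotient_presheaf K N = \<lparr>
     sects = (\<lambda>U. \<lparr>
       carrier = A_RCOSETS (sects K U) (carrier (sects N U)),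
       mult = undefined, one = undefined,
       zero = carrier (sects N U),
       add = set_add (sects K U),
       smult = (\<lambda>f C. \<Union>s\<in>C.
         a_r_coset (sects K U) (carrier (sects N U)) (smult (sects K U) f s)) \<rparr>),
     rstr = (\<lambda>U V C. \<Union>s\<in>C. a_r_coset (sects K V) (carrier (sects N V)) (rstr K U V s)) \<rparr>"

definition quotient_sheaf :: "'p topology \<Rightarrow> ('p, 'r) ring_presheaf \<Rightarrow> ('p, 'r, 'm) mod_presheaf
    \<Rightarrow> ('p, 'r, 'm) mod_presheaf \<Rightarrow> ('p, 'r, 'p \<Rightarrow> ('p set \<times> 'm set) set) mod_presheaf" where
  "quotient_sheaf X R K N = sheafify X R (quotient_presheaf K N)"

definition free_sheaf :: "('p, 'r) ring_presheaf \<Rightarrow> nat \<Rightarrow> ('p, 'r, nat \<Rightarrow> 'r) mod_presheaf" where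
  "free_sheaf R n = \<lparr>
     sects = (\<lambda>U. \<lparr>
       carrier = {..<n} \<rightarrow>\<^sub>E carrier (sects R U),
       mult = undefined, one = undefined,
       zero = (\<lambda>k\<in>{..<n}. zero (sects R U)),
       add = (\<lambda>s t. \<lambda>k\<in>{..<n}. add (sects R U) (s k) (t k)),
       smult = (\<lambda>f s. \<lambda>k\<in>{..<n}. mult (sects R U) f (s k)) \<rparr>),
     rstr = (\<lambda>U V s. \<lambda>k\<in>{..<n}. rstr R U V (s k)) \<rparr>"

definition linear_map :: "'r ring \<Rightarrow> ('r, 'm) module \<Rightarrow> ('r, 'l) module \<Rightarrow> ('m \<Rightarrow> 'l) \<Rightarrow> bool" where
  "linear_map A M N h \<longleftrightarrow>
     h \<in> carrier M \<rightarrow> carrier N \<and>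
     (\<forall>s\<in>carrier M. \<forall>t\<in>carrier M. h (add M s t) = add N (h s) (h t)) \<and>
     (\<forall>f\<in>carrier A. \<forall>s\<in>carrier M. h (smult M f s) = smult N f (h s))"

definition iso_on :: "'p topology \<Rightarrow> ('p, 'r) ring_presheaf \<Rightarrow> 'p set
    \<Rightarrow> ('p, 'r, 'm) mod_presheaf \<Rightarrow> ('p, 'r, 'l) mod_presheaf \<Rightarrow> bool" where
  "iso_on X R U F G \<longleftrightarrow> (\<exists>\<phi>.
     (\<forall>V. openin X V \<and> V \<subseteq> U \<longrightarrow>
        linear_map (sects R V) (sects F V) (sects G V) (\<phi> V) \<and>
        bij_betw (\<phi> V) (carrier (sects F V)) (carrier (sects G V))) \<and>
     (\<forall>V W. openin X V \<and> openin X W \<and> W \<subseteq> V \<and> V \<subseteq> U \<longrightarrow>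
        (\<forall>s\<in>carrier (sects F V). rstr G V W (\<phi> V s) = \<phi> W (rstr F V W s))))"

text \<open>
  Local freeness is meant in the sense of finite (possibly varying) local rank, as is appropriate
  for coherent sheaves.
\<close>

definition locally_free :: "'p topology \<Rightarrow> ('p, 'r) ring_presheaf
    \<Rightarrow> ('p, 'r, 'm) mod_presheaf \<Rightarrow> bool" where
  "locally_free X R F \<longleftrightarrow>
     (\<forall>P\<in>topspace X. \<exists>U n. openin X U \<and> P \<in> U \<and> iso_on X R U F (free_sheaf R n))"

text \<open>
  Projective space is the classical variety of closed points with its Zariski topology; it has the
  same lattice of open sets, hence the same sheaves, as the scheme.
  A point of projective space is the set of its homogeneous coordinate vectors, so that for a
  set \<open>U\<close> of points \<open>\<Union>U\<close> is the (punctured) affine cone over \<open>U\<close>.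
\<close>

definition proj_point :: "complex ^ 'n \<Rightarrow> (complex ^ 'n) set" where
  "proj_point v = {c *s v | c. c \<noteq> 0}"

definition proj_space :: "(complex ^ 'n) set set" where
  "proj_space = proj_point ` (UNIV - {0})"

inductive homog_poly :: "nat \<Rightarrow> (complex ^ 'n \<Rightarrow> complex) \<Rightarrow> bool" where
  const: "homog_poly 0 (\<lambda>v. c)"
| coord: "homog_poly 1 (\<lambda>v. v $ k)"
| add: "homog_poly d f \<Longrightarrow> homog_poly d g \<Longrightarrow> homog_poly d (\<lambda>v. f v + g v)"
| mult: "homog_poly d f \<Longrightarrow> homog_poly e g \<Longrightarrow> homog_poly (d + e) (\<lambda>v. f v * g v)"

definition zariski :: "(complex ^ 'n) set topology" where
  "zariski = topology_generated_by
     {{P \<in> proj_space. \<forall>v\<in>P. f v \<noteq> 0} | f. \<exists>d. homog_poly d f}"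

text \<open>
  The sections of \<open>O(d)\<close> over \<open>U\<close> are the functions on the cone over \<open>U\<close> that are locally
  quotients \<open>g / h\<close> of homogeneous polynomials with \<open>deg g - deg h = d\<close>.
\<close>

definition twist_sections :: "int \<Rightarrow> (complex ^ 'n) set set \<Rightarrow> (complex ^ 'n \<Rightarrow> complex) set" where
  "twist_sections d U = {f \<in> extensional (\<Union>U). \<forall>P\<in>U. \<exists>V. openin zariski V \<and> P \<in> V \<and> V \<subseteq> U \<and>
     (\<exists>m n g h. homog_poly m g \<and> homog_poly n h \<and> int m - int n = d \<and>
        (\<forall>v\<in>\<Union>V. h v \<noteq> 0 \<and> f v = g v / h v))}"

definition structure_sheaf :: "((complex ^ 'n) set, complex ^ 'n \<Rightarrow> complex) ring_presheaf" where
  "structure_sheaf = \<lparr>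
     sects = (\<lambda>U. \<lparr>
       carrier = twist_sections 0 U,
       mult = (\<lambda>f g. \<lambda>v\<in>\<Union>U. f v * g v),
       one = (\<lambda>v\<in>\<Union>U. 1),
       zero = (\<lambda>v\<in>\<Union>U. 0),
       add = (\<lambda>f g. \<lambda>v\<in>\<Union>U. f v + g v) \<rparr>),
     rstr = (\<lambda>U V f. restrict f (\<Union>V)) \<rparr>"

text \<open>
  The sheaf \<open>E \<otimes> O(d)\<close> for a finite-dimensional complex vector space \<open>E\<close> with scalar
  multiplication \<open>sc\<close>. The tensor \<open>b \<otimes> f\<close> is the function \<open>v \<mapsto> f(v) b\<close> with values in \<open>E\<close>.
\<close>

definition tensor_twist :: "(complex \<Rightarrow> 'e \<Rightarrow> 'e) \<Rightarrow> int
    \<Rightarrow> ((complex ^ 'n) set, complex ^ 'n \<Rightarrow> complex, complex ^ 'n \<Rightarrow> 'e::ab_group_add) mod_presheaf" where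
  "tensor_twist sc d = \<lparr>
     sects = (\<lambda>U. \<lparr>
       carrier = {(\<lambda>v\<in>\<Union>U. \<Sum>k<m. sc (f k v) (b k)) | (m::nat) f b.
                    \<forall>k<m. f k \<in> twist_sections d U},
       mult = undefined, one = undefined,
       zero = (\<lambda>v\<in>\<Union>U. 0),
       add = (\<lambda>s t. \<lambda>v\<in>\<Union>U. s v + t v),
       smult = (\<lambda>f s. \<lambda>v\<in>\<Union>U. sc (f v) (s v)) \<rparr>),
     rstr = (\<lambda>U V s. restrict s (\<Union>V)) \<rparr>"

text \<open>The map of sheaves given by a matrix \<open>L\<close> of linear forms in the homogeneous coordinates.\<close>

definition sheaf_map :: "(complex ^ 'n \<Rightarrow> 'e \<Rightarrow> 'e') \<Rightarrow> (complex ^ 'n) set set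
    \<Rightarrow> (complex ^ 'n \<Rightarrow> 'e) \<Rightarrow> (complex ^ 'n \<Rightarrow> 'e')" where
  "sheaf_map L U s = (\<lambda>v\<in>\<Union>U. L v (s v))"

text \<open>
  The complex vector spaces are types \<open>'v\<close>, \<open>'w\<close> with scalar multiplications \<open>sV\<close>, \<open>sW\<close>.
\<close>

record ('v, 'w) adhm =
  aB1 :: "'v \<Rightarrow> 'v"
  aB2 :: "'v \<Rightarrow> 'v"
  ai :: "'w \<Rightarrow> 'v"
  aj :: "'v \<Rightarrow> 'w"

definition stable :: "(complex \<Rightarrow> 'v::ab_group_add \<Rightarrow> 'v) \<Rightarrow> ('v, 'w) adhm \<Rightarrow> bool" where
  "stable sV A \<longleftrightarrow> (\<nexists>S. Modules.module.subspace sV S \<and> S \<noteq> UNIV \<and>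
     aB1 A ` S \<subseteq> S \<and> aB2 A ` S \<subseteq> S \<and> range (ai A) \<subseteq> S)"

definition costable :: "(complex \<Rightarrow> 'v::ab_group_add \<Rightarrow> 'v) \<Rightarrow> ('v, 'w::zero) adhm \<Rightarrow> bool" where
  "costable sV A \<longleftrightarrow> (\<nexists>S. Modules.module.subspace sV S \<and> S \<noteq> {0} \<and>
     aB1 A ` S \<subseteq> S \<and> aB2 A ` S \<subseteq> S \<and> S \<subseteq> {v. aj A v = 0})"

definition regular :: "(complex \<Rightarrow> 'v::ab_group_add \<Rightarrow> 'v) \<Rightarrow> ('v, 'w::zero) adhm \<Rightarrow> bool" where
  "regular sV A \<longleftrightarrow> stable sV A \<and> costable sV A"

record ('v, 'w) complex_adhm =
  B11 :: "'v \<Rightarrow> 'v"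
  B12 :: "'v \<Rightarrow> 'v"
  B21 :: "'v \<Rightarrow> 'v"
  B22 :: "'v \<Rightarrow> 'v"
  i1 :: "'w \<Rightarrow> 'v"
  i2 :: "'w \<Rightarrow> 'v"
  j1 :: "'v \<Rightarrow> 'w"
  j2 :: "'v \<Rightarrow> 'w"

definition complex_adhm_datum :: "(complex \<Rightarrow> 'v::ab_group_add \<Rightarrow> 'v)
    \<Rightarrow> (complex \<Rightarrow> 'w::ab_group_add \<Rightarrow> 'w) \<Rightarrow> ('v, 'w) complex_adhm \<Rightarrow> bool" where
  "complex_adhm_datum sV sW D \<longleftrightarrow>
     Vector_Spaces.linear sV sV (B11 D) \<and> Vector_Spaces.linear sV sV (B12 D) \<and>
     Vector_Spaces.linear sV sV (B21 D) \<and> Vector_Spaces.linear sV sV (B22 D) \<and>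
     Vector_Spaces.linear sW sV (i1 D) \<and> Vector_Spaces.linear sW sV (i2 D) \<and>
     Vector_Spaces.linear sV sW (j1 D) \<and> Vector_Spaces.linear sV sW (j2 D)"

definition adhm_at :: "(complex \<Rightarrow> 'v::ab_group_add \<Rightarrow> 'v) \<Rightarrow> (complex \<Rightarrow> 'w::ab_group_add \<Rightarrow> 'w)
    \<Rightarrow> ('v, 'w) complex_adhm \<Rightarrow> complex \<Rightarrow> complex \<Rightarrow> ('v, 'w) adhm" where
  "adhm_at sV sW D z w = \<lparr>
     aB1 = (\<lambda>v. sV z (B11 D v) + sV w (B21 D v)),
     aB2 = (\<lambda>v. sV z (B12 D v) + sV w (B22 D v)),
     ai = (\<lambda>u. sV z (i1 D u) + sV w (i2 D u)),
     aj = (\<lambda>v. sW z (j1 D v) + sW w (j2 D v)) \<rparr>"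

definition C_stable :: "(complex \<Rightarrow> 'v::ab_group_add \<Rightarrow> 'v) \<Rightarrow> (complex \<Rightarrow> 'w::ab_group_add \<Rightarrow> 'w)
    \<Rightarrow> ('v, 'w) complex_adhm \<Rightarrow> bool" where
  "C_stable sV sW D \<longleftrightarrow> (\<forall>z w. (z, w) \<noteq> (0, 0) \<longrightarrow> stable sV (adhm_at sV sW D z w))"

definition C_regular :: "(complex \<Rightarrow> 'v::ab_group_add \<Rightarrow> 'v) \<Rightarrow> (complex \<Rightarrow> 'w::ab_group_add \<Rightarrow> 'w)
    \<Rightarrow> ('v, 'w) complex_adhm \<Rightarrow> bool" where
  "C_regular sV sW D \<longleftrightarrow> (\<forall>z w. (z, w) \<noteq> (0, 0) \<longrightarrow> regular sV (adhm_at sV sW D z w))"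

definition complex_adhm_equations :: "('v::ab_group_add, 'w) complex_adhm \<Rightarrow> bool" where
  "complex_adhm_equations D \<longleftrightarrow>
     (\<forall>v. B11 D (B12 D v) - B12 D (B11 D v) + i1 D (j1 D v) = 0) \<and>
     (\<forall>v. B21 D (B22 D v) - B22 D (B21 D v) + i2 D (j2 D v) = 0) \<and>
     (\<forall>v. (B11 D (B22 D v) - B22 D (B11 D v)) + (B21 D (B12 D v) - B12 D (B21 D v))
          + i1 D (j2 D v) + i2 D (j1 D v) = 0)"

definition sum_scale :: "(complex \<Rightarrow> 'v \<Rightarrow> 'v) \<Rightarrow> (complex \<Rightarrow> 'w \<Rightarrow> 'w)
    \<Rightarrow> complex \<Rightarrow> 'v \<times> 'v \<times> 'w \<Rightarrow> 'v \<times> 'v \<times> 'w" where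
  "sum_scale sV sW c = (\<lambda>(a, b, u). (sV c a, sV c b, sW c u))"

text \<open>The components of \<open>p :: complex ^ 4\<close> are the homogeneous coordinates \<open>x, y, z, w\<close>.\<close>

definition monad_alpha :: "(complex \<Rightarrow> 'v::ab_group_add \<Rightarrow> 'v) \<Rightarrow> (complex \<Rightarrow> 'w::ab_group_add \<Rightarrow> 'w)
    \<Rightarrow> ('v, 'w) complex_adhm \<Rightarrow> complex ^ 4 \<Rightarrow> 'v \<Rightarrow> 'v \<times> 'v \<times> 'w" where
  "monad_alpha sV sW D p a =
     (let x = p $ 1; y = p $ 2; z = p $ 3; w = p $ 4 in
      (sV z (B11 D a) + sV w (B21 D a) + sV x a,
       sV z (B12 D a) + sV w (B22 D a) + sV y a,
       sW z (j1 D a) + sW w (j2 D a)))"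

definition monad_beta :: "(complex \<Rightarrow> 'v::ab_group_add \<Rightarrow> 'v)
    \<Rightarrow> ('v, 'w) complex_adhm \<Rightarrow> complex ^ 4 \<Rightarrow> 'v \<times> 'v \<times> 'w \<Rightarrow> 'v" where
  "monad_beta sV D p = (\<lambda>(a, b, u).
     (let x = p $ 1; y = p $ 2; z = p $ 3; w = p $ 4 in
      (- sV z (B12 D a) - sV w (B22 D a) - sV y a)
      + (sV z (B11 D b) + sV w (B21 D b) + sV x b)
      + (sV z (i1 D u) + sV w (i2 D u))))"

definition monad_cohomology :: "(complex \<Rightarrow> 'v::ab_group_add \<Rightarrow> 'v)
    \<Rightarrow> (complex \<Rightarrow> 'w::ab_group_add \<Rightarrow> 'w) \<Rightarrow> ('v, 'w) complex_adhm
    \<Rightarrow> ((complex ^ 4) set, complex ^ 4 \<Rightarrow> complex,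
        (complex ^ 4) set \<Rightarrow> ((complex ^ 4) set set \<times> (complex ^ 4 \<Rightarrow> 'v \<times> 'v \<times> 'w) set) set)
       mod_presheaf" where
  "monad_cohomology sV sW D =
     (let M0 = tensor_twist sV (- 1);
          M1 = tensor_twist (sum_scale sV sW) 0;
          M2 = tensor_twist sV 1
      in quotient_sheaf zariski structure_sheaf
           (kernel_sheaf M1 M2 (sheaf_map (monad_beta sV D)))
           (image_sheaf zariski M0 M1 (sheaf_map (monad_alpha sV sW D))))"

end

theory Submission
  imports Defs "HOL-Computational_Algebra.Fundamental_Theorem_Algebra" "Jordan_Normal_Form.Determinant"
begin

text \<open>
  Stability makes \<open>\<beta>\<close> surjective on every fibre, because \<open>im \<beta>\<^sub>p\<close> is an invariant subspace
  containing \<open>im i\<close>.  Dually, costability at all points is equivalent to injectivity of \<open>\<alpha>\<close> on every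
  fibre: \<open>ker \<alpha>\<^sub>p\<close> is an invariant subspace of \<open>ker j\<close>, and conversely the ADHM equation makes \<open>B\<^sub>1\<close> and
  \<open>B\<^sub>2\<close> commute on a destabilising subspace, so that a joint eigenvector there lies in some \<open>ker \<alpha>\<^sub>p\<close>.

  If \<open>\<alpha>\<close> is fibrewise injective, local splittings of \<open>\<alpha>\<close> and \<open>\<beta>\<close> yield a family of projections
  \<open>\<pi>\<^sub>v\<close> whose images represent the cohomology, and the image of a regular family of projections is
  locally free.  If the cohomology is locally free and \<open>\<alpha>\<^sub>p a = 0\<close>, then near \<open>p\<close> a Nakayama
  argument writes the section \<open>\<alpha> a\<close>, which vanishes at \<open>p\<close>, as \<open>\<alpha> q\<close> with \<open>q\<close> vanishing at \<open>p\<close>.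
  Since \<open>\<alpha>\<close> is injective on a dense set of fibres, \<open>a = q\<close> and so \<open>a = 0\<close>.
\<close>

section \<open>The sheaf associated with a presheaf\<close>

text \<open>Sections of the cohomology sheaf are families of germs of cosets, which come from
  \<open>K = ker \<beta>\<close> only locally. Both directions therefore trade a trivialisation over
  \<open>U\<close> for a homomorphism \<open>\<Phi>\<close> from \<open>K\<close> to
  \<open>O^n\<close> whose kernel is exactly \<open>N = im \<alpha>\<close>
  (\<open>kernel_hom\<close>). Local freeness yields such a \<open>\<Phi>\<close> along which
  sections of \<open>O^n\<close> lift locally; conversely a \<open>\<Phi>\<close> that is surjective
  on sections yields an isomorphism. The Nakayama argument is in essence the vanishing of Tor for a
  free module. Modulo \<open>N\<close> each generator of \<open>K\<close> is a combination of lifts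
  of the standard basis of \<open>O^n\<close>, and these lifts satisfy no relation. Generators with
  which a section vanishing at \<open>p\<close> has coefficients vanishing at \<open>p\<close> exist
  because \<open>ker \<beta>\<close> is locally a direct summand of a trivial bundle; this is what
  stability provides. Matrix inversion is carried out in degree 0, so twists are removed by dividing
  by a coordinate that has no zero near the point. Density is settled in the Euclidean topology: an
  operator has finitely many eigenvalues, while a nonempty open subset of the complex line is
  infinite.\<close>

lemma restrict_eq_restrict_iff: "restrict f A = restrict g A \<longleftrightarrow> (\<forall>x\<in>A. f x = g x)"
  by (metis restrict_apply' restrict_ext)

abbreviation sections :: "('p, ('a, 'b) partial_object_scheme, 'm) presheaf \<Rightarrow> 'p set \<Rightarrow> 'a set"
  where "sections F U \<equiv> carrier (sects F U)"

text \<open>The axioms say that restriction is transitive and respects the operations, which is what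
  makes operations on germs independent of representatives. Group laws enter only with
  \<open>sheaf_quotient\<close> and \<open>module_sheaf\<close>, so the quotient presheaf can be an
  instance before any module law is checked for it.\<close>

locale module_presheaf =
  fixes X :: "'p topology" and R :: "('p, 'r) ring_presheaf" and F :: "('p, 'r, 'm) mod_presheaf"
  assumes R_rstr: "\<lbrakk>openin X U; openin X V; V \<subseteq> U; f \<in> sections R U\<rbrakk>
      \<Longrightarrow> rstr R U V f \<in> sections R V"
    and add_closed: "\<lbrakk>openin X U; s \<in> sections F U; t \<in> sections F U\<rbrakk>
      \<Longrightarrow> add (sects F U) s t \<in> sections F U"
    and smult_closed: "\<lbrakk>openin X U; f \<in> sections R U; s \<in> sections F U\<rbrakk>
      \<Longrightarrow> smult (sects F U) f s \<in> sections F U"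
    and rstr_closed: "\<lbrakk>openin X U; openin X V; V \<subseteq> U; s \<in> sections F U\<rbrakk>
      \<Longrightarrow> rstr F U V s \<in> sections F V"
    and rstr_add: "\<lbrakk>openin X U; openin X V; V \<subseteq> U; s \<in> sections F U;
        t \<in> sections F U\<rbrakk>
      \<Longrightarrow> rstr F U V (add (sects F U) s t) = add (sects F V) (rstr F U V s) (rstr F U V t)"
    and rstr_smult: "\<lbrakk>openin X U; openin X V; V \<subseteq> U; f \<in> sections R U;
        s \<in> sections F U\<rbrakk>
      \<Longrightarrow> rstr F U V (smult (sects F U) f s) = smult (sects F V) (rstr R U V f) (rstr F U V s)"
    and rstr_rstr: "\<lbrakk>openin X U; openin X V; openin X W; W \<subseteq> V; V \<subseteq> U;
        s \<in> sections F U\<rbrakk>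
      \<Longrightarrow> rstr F V W (rstr F U V s) = rstr F U W s"
    and R_rstr_rstr: "\<lbrakk>openin X U; openin X V; openin X W; W \<subseteq> V; V \<subseteq> U;
        f \<in> sections R U\<rbrakk>
      \<Longrightarrow> rstr R V W (rstr R U V f) = rstr R U W f"
begin

section \<open>Germs and their operations\<close>

lemma germ_self:
  assumes "openin X U" "P \<in> U" "s \<in> sections F U"
  shows "(U, s) \<in> germ X F P U s"
  using assms by (auto simp: germ_def)

text \<open>Agreement near \<open>P\<close> is transitive, because two neighbourhoods of agreement
  can be intersected. \<open>germ_eq_iff\<close> obtains equality from this inclusion by
  symmetry.\<close>

lemma germ_subset:
  assumes U: "openin X U" "s \<in> sections F U" and V: "openin X V" "t \<in> sections F V"
    and W: "openin X W" "P \<in> W" "W \<subseteq> U \<inter> V" "rstr F U W s = rstr F V W t"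
  shows "germ X F P U s \<subseteq> germ X F P V t"
proof (clarsimp simp: germ_def)
  fix A a W' assume A: "openin X A" "P \<in> A" "a \<in> sections F A" and
    W': "openin X W'" "P \<in> W'" "W' \<subseteq> U" "W' \<subseteq> A" "rstr F U W' s = rstr F A W' a"
  let ?W = "W \<inter> W'"
  have o: "openin X ?W" using W W' by auto
  have "rstr F V ?W t = rstr F W ?W (rstr F V W t)"
    using rstr_rstr[of V W ?W t] o V W by auto
  also have "\<dots> = rstr F U ?W s" using rstr_rstr[of U W ?W s] o U W by auto
  also have "\<dots> = rstr F W' ?W (rstr F U W' s)" using rstr_rstr[of U W' ?W s] o U W' by auto
  also have "\<dots> = rstr F A ?W a" using rstr_rstr[of A W' ?W a] o A W' by auto
  finally show "\<exists>W. openin X W \<and> P \<in> W \<and> W \<subseteq> V \<and> W \<subseteq> A \<and> rstr F V W t = rstr F A W a"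
    using o W W' by (intro exI[of _ ?W]) auto
qed

lemma germ_eq_iff:
  assumes "openin X U" "P \<in> U" "s \<in> sections F U"
    and "openin X V" "P \<in> V" "t \<in> sections F V"
  shows "germ X F P U s = germ X F P V t \<longleftrightarrow>
    (\<exists>W. openin X W \<and> P \<in> W \<and> W \<subseteq> U \<inter> V \<and> rstr F U W s = rstr F V W t)" (is "?L \<longleftrightarrow> ?R")
proof
  assume ?L
  then have "(V, t) \<in> germ X F P U s" using germ_self[of V P t] assms by simp
  then show ?R by (auto simp: germ_def)
next
  assume ?R
  then obtain W where W: "openin X W" "P \<in> W" "W \<subseteq> U \<inter> V" "rstr F U W s = rstr F V W t" by blast
  then have W': "W \<subseteq> V \<inter> U" "rstr F V W t = rstr F U W s" by auto
  show ?L
    using germ_subset[OF assms(1,3,4,6) W] germ_subset[OF assms(4,6,1,3) W(1,2) W'] by blast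
qed

lemma add_rstr:
  assumes "openin X U" "openin X V" "openin X W" "W \<subseteq> U \<inter> V"
    and "s \<in> sections F U" "t \<in> sections F V"
  shows "rstr F (U \<inter> V) W (add (sects F (U \<inter> V)) (rstr F U (U \<inter> V) s) (rstr F V (U \<inter> V) t)) =
      add (sects F W) (rstr F U W s) (rstr F V W t)"
    and "add (sects F (U \<inter> V)) (rstr F U (U \<inter> V) s) (rstr F V (U \<inter> V) t) \<in> carrier (sects F (U \<inter>
      V))"
proof -
  have o: "openin X (U \<inter> V)" using assms by auto
  have c: "rstr F U (U \<inter> V) s \<in> carrier (sects F (U \<inter> V))" "rstr F V (U \<inter> V) t \<in> carrier (sects F (U
    \<inter> V))"
    using assms o by (auto intro: rstr_closed)
  then show "add (sects F (U \<inter> V)) (rstr F U (U \<inter> V) s) (rstr F V (U \<inter> V) t) \<in> carrier (sects F (U \<inter>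
    V))"
    using o add_closed by blast
  show "rstr F (U \<inter> V) W (add (sects F (U \<inter> V)) (rstr F U (U \<inter> V) s) (rstr F V (U \<inter> V) t)) =
      add (sects F W) (rstr F U W s) (rstr F V W t)"
    by (simp only: rstr_add[OF o assms(3,4) c] rstr_rstr[OF assms(1) o assms(3,4) Int_lower1
      assms(5)]
        rstr_rstr[OF assms(2) o assms(3,4) Int_lower2 assms(6)])
qed

lemma smult_rstr:
  assumes "openin X U" "openin X V" "openin X W" "W \<subseteq> U \<inter> V"
    and "f \<in> sections R U" "t \<in> sections F V"
  shows "rstr F (U \<inter> V) W (smult (sects F (U \<inter> V)) (rstr R U (U \<inter> V) f) (rstr F V (U \<inter> V) t)) =
      smult (sects F W) (rstr R U W f) (rstr F V W t)"
    and "smult (sects F (U \<inter> V)) (rstr R U (U \<inter> V) f) (rstr F V (U \<inter> V) t) \<in> carrier (sects F (U \<inter>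
      V))"
proof -
  have o: "openin X (U \<inter> V)" using assms by auto
  have c: "rstr R U (U \<inter> V) f \<in> carrier (sects R (U \<inter> V))" "rstr F V (U \<inter> V) t \<in> carrier (sects F (U
    \<inter> V))"
    using assms o by (auto intro: rstr_closed R_rstr)
  then show "smult (sects F (U \<inter> V)) (rstr R U (U \<inter> V) f) (rstr F V (U \<inter> V) t) \<in> carrier (sects F (U
    \<inter> V))"
    using o smult_closed by blast
  show "rstr F (U \<inter> V) W (smult (sects F (U \<inter> V)) (rstr R U (U \<inter> V) f) (rstr F V (U \<inter> V) t)) =
      smult (sects F W) (rstr R U W f) (rstr F V W t)"
    by (simp only: rstr_smult[OF o assms(3,4) c] R_rstr_rstr[OF assms(1) o assms(3,4) Int_lower1
      assms(5)]
        rstr_rstr[OF assms(2) o assms(3,4) Int_lower2 assms(6)])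
qed

lemma germ_eqI:
  assumes "openin X U" "s \<in> sections F U" "openin X V" "t \<in> sections F V"
    and "openin X W" "P \<in> W" "W \<subseteq> U" "W \<subseteq> V" "rstr F U W s = rstr F V W t"
  shows "germ X F P U s = germ X F P V t"
  using assms by (subst germ_eq_iff) blast+

lemma germ_rstr:
  assumes "openin X U" "s \<in> sections F U" "openin X V" "V \<subseteq> U" "P \<in> V"
  shows "germ X F P V (rstr F U V s) = germ X F P U s"
  using assms by (subst germ_eq_iff) (auto intro!: exI[of _ V] simp: rstr_closed rstr_rstr)

lemma germ_repE:
  assumes "(A, a) \<in> germ X F P U s" "openin X U" "P \<in> U" "s \<in> sections F U"
  shows "openin X A" "P \<in> A" "a \<in> sections F A" "germ X F P A a = germ X F P U s"
proof -
  show *: "openin X A" "P \<in> A" "a \<in> sections F A" using assms(1) by (auto simp: germ_def)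
  show "germ X F P A a = germ X F P U s"
  proof -
    obtain W where "openin X W" "P \<in> W" "W \<subseteq> U \<inter> A" "rstr F U W s = rstr F A W a"
      using assms(1) unfolding germ_def by blast
    then have "germ X F P U s = germ X F P A a"
      using germ_eq_iff[OF assms(2-4) *] by blast
    then show ?thesis by simp
  qed
qed

text \<open>\<open>germ_add\<close> is a union over all pairs of representatives. Any other pair
  agrees with the given one on a smaller neighbourhood, so all members of the union coincide and it
  collapses to one of them.\<close>

lemma germ_add_eq:
  assumes U: "openin X U" "P \<in> U" "s \<in> sections F U"
    and V: "openin X V" "P \<in> V" "t \<in> sections F V"
  shows "germ_add X F P (germ X F P U s) (germ X F P V t) =
    germ X F P (U \<inter> V) (add (sects F (U \<inter> V)) (rstr F U (U \<inter> V) s) (rstr F V (U \<inter> V) t))"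
    (is "_ = ?g U s V t")
proof -
  have eq: "?g A a B b = ?g U s V t"
    if a: "(A, a) \<in> germ X F P U s" and b: "(B, b) \<in> germ X F P V t" for A a B b
  proof -
    note A = germ_repE[OF a U] and B = germ_repE[OF b V]
    obtain W1 where W1: "openin X W1" "P \<in> W1" "W1 \<subseteq> A \<inter> U" "rstr F A W1 a = rstr F U W1 s"
      using A U germ_eq_iff[of A P a U s] by auto
    obtain W2 where W2: "openin X W2" "P \<in> W2" "W2 \<subseteq> B \<inter> V" "rstr F B W2 b = rstr F V W2 t"
      using B V germ_eq_iff[of B P b V t] by auto
    let ?W = "W1 \<inter> W2"
    have oW: "openin X ?W" using W1 W2 by auto
    have e1: "rstr F A ?W a = rstr F U ?W s"
      using rstr_rstr[of A W1 ?W a] rstr_rstr[of U W1 ?W s] oW W1 A U by auto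
    have e2: "rstr F B ?W b = rstr F V ?W t"
      using rstr_rstr[of B W2 ?W b] rstr_rstr[of V W2 ?W t] oW W2 B V by auto
    have sub: "?W \<subseteq> A \<inter> B" "?W \<subseteq> U \<inter> V" using W1 W2 by auto
    have o: "openin X (A \<inter> B)" "openin X (U \<inter> V)" using A B U V by auto
    show ?thesis
      using add_rstr[OF A(1) B(1) oW sub(1) A(3) B(3)] add_rstr[OF U(1) V(1) oW sub(2) U(3) V(3)] e1
        e2
        o oW sub W1(2) W2(2) by (intro germ_eqI[of _ _ _ _ ?W]) auto
  qed
  have ne: "(U, s) \<in> germ X F P U s" "(V, t) \<in> germ X F P V t" using germ_self U V by auto
  show ?thesis unfolding germ_add_def
  proof (intro equalityI subsetI)
    fix x assume "x \<in> ?g U s V t"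
    then show "x \<in> (\<Union>(U, s)\<in>germ X F P U s. \<Union>(V, t)\<in>germ X F P V t. ?g U s V t)"
      using ne by blast
  qed (use eq in blast)
qed

lemma germ_smult_eq:
  assumes U: "openin X U" "P \<in> U" "f \<in> sections R U"
    and V: "openin X V" "P \<in> V" "t \<in> sections F V"
  shows "germ_smult X R F P U f (germ X F P V t) =
    germ X F P (U \<inter> V) (smult (sects F (U \<inter> V)) (rstr R U (U \<inter> V) f) (rstr F V (U \<inter> V) t))"
    (is "_ = ?g V t")
proof -
  have eq: "?g B b = ?g V t" if b: "(B, b) \<in> germ X F P V t" for B b
  proof -
    note B = germ_repE[OF b V]
    obtain W2 where W2: "openin X W2" "P \<in> W2" "W2 \<subseteq> B \<inter> V" "rstr F B W2 b = rstr F V W2 t"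
      using B V germ_eq_iff[of B P b V t] by auto
    let ?W = "U \<inter> W2"
    have oW: "openin X ?W" using W2 U by auto
    have e2: "rstr F B ?W b = rstr F V ?W t"
      using rstr_rstr[of B W2 ?W b] rstr_rstr[of V W2 ?W t] oW W2 B V by auto
    have sub: "?W \<subseteq> U \<inter> B" "?W \<subseteq> U \<inter> V" using W2 by auto
    have o: "openin X (U \<inter> B)" "openin X (U \<inter> V)" using B U V by auto
    show ?thesis
      using smult_rstr[OF U(1) B(1) oW sub(1) U(3) B(3)] smult_rstr[OF U(1) V(1) oW sub(2) U(3)
        V(3)] e2
        o oW sub U(2) W2(2) by (intro germ_eqI[of _ _ _ _ ?W]) auto
  qed
  have ne: "(V, t) \<in> germ X F P V t" using germ_self V by auto
  show ?thesis unfolding germ_smult_def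
  proof (intro equalityI subsetI)
    fix x assume "x \<in> ?g V t"
    then show "x \<in> (\<Union>(V, t)\<in>germ X F P V t. ?g V t)" using ne by blast
  qed (use eq in blast)
qed

section \<open>Sections of the associated sheaf\<close>

definition induced :: "'p set \<Rightarrow> 'm \<Rightarrow> 'p \<Rightarrow> ('p set \<times> 'm) set" where
  "induced U s = (\<lambda>P\<in>U. germ X F P U s)"

text \<open>Local representability is phrased as an equality of functions, so that passing to a
  smaller open set becomes rewriting with \<open>restrict_induced\<close>.\<close>

lemma sheafify_carrier_iff:
  "\<sigma> \<in> carrier (sects (sheafify X R F) U) \<longleftrightarrow> \<sigma> \<in> extensional U \<and>
    (\<forall>P\<in>U. \<exists>V t. openin X V \<and> P \<in> V \<and> V \<subseteq> U \<and> t \<in> sections F V \<and>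
      restrict \<sigma> V = induced V t)"
proof -
  have "(\<forall>Q\<in>V. \<sigma> Q = germ X F Q V t) \<longleftrightarrow> restrict \<sigma> V = induced V t" for V t
    unfolding induced_def by (rule restrict_eq_restrict_iff[symmetric])
  then show ?thesis by (simp add: sheafify_def)
qed

lemma restrict_induced:
  assumes "openin X U" "openin X V" "V \<subseteq> U" "s \<in> sections F U"
  shows "restrict (induced U s) V = induced V (rstr F U V s)"
  using assms by (auto simp: induced_def restrict_def germ_rstr fun_eq_iff)

lemma induced_closed:
  assumes "openin X U" "s \<in> sections F U"
  shows "induced U s \<in> carrier (sects (sheafify X R F) U)"
  unfolding sheafify_carrier_iff
proof (intro conjI ballI exI)
  show "induced U s \<in> extensional U" by (simp add: induced_def)
  then show "restrict (induced U s) U = induced U s" by (rule extensional_restrict)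
qed (use assms in auto)

lemma induced_eq_iff:
  assumes "openin X U" "s \<in> sections F U" "t \<in> sections F U"
  shows "induced U s = induced U t \<longleftrightarrow>
    (\<forall>P\<in>U. \<exists>V. openin X V \<and> P \<in> V \<and> V \<subseteq> U \<and> rstr F U V s = rstr F U V t)"
proof -
  have "induced U s = induced U t \<longleftrightarrow> (\<forall>P\<in>U. germ X F P U s = germ X F P U t)"
    unfolding induced_def by (simp add: restrict_eq_restrict_iff)
  then show ?thesis using assms by (simp add: germ_eq_iff)
qed

lemma induced_add:
  assumes "openin X U" "s \<in> sections F U" "t \<in> sections F U"
  shows "add (sects (sheafify X R F) U) (induced U s) (induced U t) = induced U (add (sects F U) s
    t)"
proof -
  have "germ_add X F P (germ X F P U s) (germ X F P U t) = germ X F P U (add (sects F U) s t)"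
    if "P \<in> U" for P
    using that assms rstr_add[of U U s t] germ_rstr[of U "add (sects F U) s t" U P]
    by (simp add: germ_add_eq add_closed)
  then show ?thesis by (auto simp: sheafify_def induced_def fun_eq_iff restrict_def)
qed

lemma induced_smult:
  assumes "openin X U" "f \<in> sections R U" "s \<in> sections F U"
  shows "smult (sects (sheafify X R F) U) f (induced U s) = induced U (smult (sects F U) f s)"
proof -
  have "germ_smult X R F P U f (germ X F P U s) = germ X F P U (smult (sects F U) f s)"
    if "P \<in> U" for P
    using that assms rstr_smult[of U U f s] germ_rstr[of U "smult (sects F U) f s" U P]
    by (simp add: germ_smult_eq smult_closed)
  then show ?thesis by (auto simp: sheafify_def induced_def fun_eq_iff restrict_def)
qed

lemma sheafify_rstr: "rstr (sheafify X R F) U V \<sigma> = restrict \<sigma> V"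
  by (simp add: sheafify_def)

lemma sheafify_add_restrict:
  assumes "V \<subseteq> U"
  shows "restrict (add (sects (sheafify X R F) U) \<sigma> \<tau>) V =
    add (sects (sheafify X R F) V) (restrict \<sigma> V) (restrict \<tau> V)"
  using assms by (auto simp: sheafify_def fun_eq_iff restrict_def)

text \<open>Addition of families of germs does not mention the open set, but scalar multiplication
  does, through the scalar. The germs formed with \<open>f\<close> over \<open>U\<close> and with
  its restriction over \<open>V\<close> are compared by a local representative \<open>t\<close> of
  \<sigma>, over \<open>V \<inter> W\<close>.\<close>

lemma sheafify_smult_restrict:
  assumes V: "openin X U" "openin X V" "V \<subseteq> U" and f: "f \<in> sections R U"
    and \<sigma>: "\<sigma> \<in> carrier (sects (sheafify X R F) U)"
  shows "restrict (smult (sects (sheafify X R F) U) f \<sigma>) V =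
    smult (sects (sheafify X R F) V) (rstr R U V f) (restrict \<sigma> V)"
proof -
  have "germ_smult X R F P U f (\<sigma> P) = germ_smult X R F P V (rstr R U V f) (\<sigma> P)" if P: "P \<in> V"
    for P
  proof -
    obtain W t where W: "openin X W" "P \<in> W" "W \<subseteq> U" "t \<in> sections F W"
      and "restrict \<sigma> W = induced W t"
      using \<sigma> P V(3) unfolding sheafify_carrier_iff by (meson subsetD)
    then have e: "\<sigma> P = germ X F P W t" by (metis induced_def restrict_apply')
    have o: "openin X (U \<inter> W)" "openin X (V \<inter> W)" using V W by auto
    have Rf: "rstr R U V f \<in> sections R V" using V f R_rstr by blast
    have "germ X F P (U \<inter> W) (smult (sects F (U \<inter> W)) (rstr R U (U \<inter> W) f) (rstr F W (U \<inter> W) t))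
       = germ X F P (V \<inter> W) (smult (sects F (V \<inter> W)) (rstr R V (V \<inter> W) (rstr R U V f)) (rstr F W (V
         \<inter> W) t))"
    proof (rule germ_eqI[where W = "V \<inter> W"])
      show "rstr F (U \<inter> W) (V \<inter> W) (smult (sects F (U \<inter> W)) (rstr R U (U \<inter> W) f) (rstr F W (U \<inter> W)
        t)) =
        rstr F (V \<inter> W) (V \<inter> W) (smult (sects F (V \<inter> W)) (rstr R V (V \<inter> W) (rstr R U V f)) (rstr F W
          (V \<inter> W) t))"
        using V smult_rstr(1)[OF V(1) W(1) o(2) _ f W(4)] smult_rstr(1)[OF V(2) W(1) o(2) _ Rf W(4)]
          R_rstr_rstr[OF V(1,2) o(2) _ V(3) f] by auto
    qed (use smult_rstr(2)[OF V(1) W(1) o(2) _ f W(4)] smult_rstr(2)[OF V(2) W(1) o(2) _ Rf W(4)] o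
      P W V in auto)
    then show ?thesis
      using V W P f Rf by (simp add: e germ_smult_eq subset_iff)
  qed
  then show ?thesis using V by (auto simp: sheafify_def fun_eq_iff restrict_def)
qed

end

section \<open>Quotients of sheaves of modules\<close>

lemma UN_constant_eq: "(\<And>x. x \<in> A \<Longrightarrow> f x = c) \<Longrightarrow> a \<in> A \<Longrightarrow> (\<Union>x\<in>A. f x) = c"
  by blast

text \<open>\<open>N_local\<close> says that \<open>N\<close> is a subsheaf and not merely a
  subpresheaf. It makes the quotient presheaf separated, so that sections with the same class in the
  sheaf quotient differ by a section of \<open>N\<close> over the whole open set.\<close>

locale sheaf_quotient = module_presheaf X R K
  for X :: "'p topology" and R :: "('p, 'r) ring_presheaf" and K :: "('p, 'r, 'm) mod_presheaf" +
  fixes N :: "('p, 'r, 'm) mod_presheaf"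
  assumes subgroup: "openin X U \<Longrightarrow> abelian_subgroup (sections N U) (sects K U)"
    and smult_add: "\<lbrakk>openin X U; f \<in> sections R U; s \<in> sections K U; t \<in> sections K U\<rbrakk>
      \<Longrightarrow> smult (sects K U) f (add (sects K U) s t) =
          add (sects K U) (smult (sects K U) f s) (smult (sects K U) f t)"
    and N_smult: "\<lbrakk>openin X U; f \<in> sections R U; s \<in> sections N U\<rbrakk>
      \<Longrightarrow> smult (sects K U) f s \<in> sections N U"
    and N_rstr: "\<lbrakk>openin X U; openin X V; V \<subseteq> U; s \<in> sections N U\<rbrakk>
      \<Longrightarrow> rstr K U V s \<in> sections N V"
    and N_local: "\<lbrakk>openin X U; s \<in> sections K U;
        \<And>P. P \<in> U \<Longrightarrow> \<exists>V. openin X V \<and> P \<in> V \<and> V \<subseteq> U \<and> rstr K U V s \<in> sections N V\<rbrakk>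
      \<Longrightarrow> s \<in> sections N U"
begin

definition qclass :: "'p set \<Rightarrow> 'm \<Rightarrow> 'm set" where
  "qclass U s = a_r_coset (sects K U) (sections N U) s"

lemma N_subset:
  assumes "openin X U" "s \<in> sections N U"
  shows "s \<in> sections K U"
proof -
  interpret abelian_subgroup "sections N U" "sects K U" by (rule subgroup[OF assms(1)])
  show ?thesis using assms(2) a_subset by blast
qed

lemma mem_qclass:
  "x \<in> qclass U s \<longleftrightarrow> (\<exists>h\<in>sections N U. x = add (sects K U) h s)"
  by (auto simp: qclass_def a_r_coset_def')

lemma qclass_self:
  assumes "openin X U" "s \<in> sections K U"
  shows "s \<in> qclass U s"
proof -
  interpret abelian_subgroup "sections N U" "sects K U" by (rule subgroup[OF assms(1)])
  show ?thesis using assms(2) by (simp add: qclass_def a_rcos_self)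
qed

lemma qclass_eqI:
  assumes "openin X U" "s \<in> sections K U" "h \<in> sections N U"
  shows "qclass U (add (sects K U) h s) = qclass U s"
proof -
  interpret abelian_subgroup "sections N U" "sects K U" by (rule subgroup[OF assms(1)])
  show ?thesis using assms(2,3) a_repr_independence'[of "add (sects K U) h s" s]
    by (auto simp: qclass_def a_r_coset_def')
qed

lemma qclass_eq_iff:
  assumes "openin X U" "s \<in> sections K U" "t \<in> sections K U"
  shows "qclass U s = qclass U t \<longleftrightarrow> a_minus (sects K U) s t \<in> sections N U"
proof -
  interpret abelian_subgroup "sections N U" "sects K U" by (rule subgroup[OF assms(1)])
  show ?thesis
    using a_rcos_module[OF assms(3,2)] a_repr_independence' a_repr_independenceD assms
    by (metis qclass_def minus_eq)
qed

abbreviation "Q \<equiv> quotient_presheaf K N"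

lemma Q_carrier: "sections Q U = qclass U ` sections K U"
  by (auto simp: quotient_presheaf_def A_RCOSETS_def' qclass_def)

lemma Q_add:
  assumes "openin X U" "s \<in> sections K U" "t \<in> sections K U"
  shows "add (sects Q U) (qclass U s) (qclass U t) = qclass U (add (sects K U) s t)"
proof -
  interpret abelian_subgroup "sections N U" "sects K U" by (rule subgroup[OF assms(1)])
  show ?thesis using assms by (simp add: quotient_presheaf_def qclass_def a_rcos_sum)
qed

lemma Q_smult:
  assumes "openin X U" "f \<in> sections R U" "s \<in> sections K U"
  shows "smult (sects Q U) f (qclass U s) = qclass U (smult (sects K U) f s)"
proof -
  have "qclass U (smult (sects K U) f x) = qclass U (smult (sects K U) f s)"
    if "x \<in> qclass U s" for x
    using that assms by (auto simp: mem_qclass smult_add N_subset qclass_eqI N_smult smult_closed)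
  then have "(\<Union>x\<in>qclass U s. qclass U (smult (sects K U) f x)) = qclass U (smult (sects K U) f s)"
    using qclass_self[OF assms(1,3)] by (rule UN_constant_eq)
  then show ?thesis by (simp add: quotient_presheaf_def qclass_def)
qed

lemma Q_rstr:
  assumes "openin X U" "openin X V" "V \<subseteq> U" "s \<in> sections K U"
  shows "rstr Q U V (qclass U s) = qclass V (rstr K U V s)"
proof -
  have "qclass V (rstr K U V x) = qclass V (rstr K U V s)"
    if "x \<in> qclass U s" for x
    using that assms by (auto simp: mem_qclass rstr_add N_subset qclass_eqI N_rstr rstr_closed)
  then have "(\<Union>x\<in>qclass U s. qclass V (rstr K U V x)) = qclass V (rstr K U V s)"
    using qclass_self[OF assms(1,4)] by (rule UN_constant_eq)
  then show ?thesis by (simp add: quotient_presheaf_def qclass_def)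
qed

sublocale Q: module_presheaf X R Q
  by unfold_locales
    (auto simp: Q_carrier Q_add Q_smult Q_rstr R_rstr R_rstr_rstr
       add_closed smult_closed rstr_closed rstr_add rstr_smult rstr_rstr)

abbreviation "E \<equiv> quotient_sheaf X R K N"

text \<open>The canonical homomorphism from \<open>K\<close> to the quotient sheaf. By
  \<open>E_carrier_iff\<close> every section of the quotient is locally of this form.\<close>

definition proj :: "'p set \<Rightarrow> 'm \<Rightarrow> 'p \<Rightarrow> ('p set \<times> 'm set) set" where
  "proj U s = Q.induced U (qclass U s)"

lemma E_carrier_iff:
  "\<sigma> \<in> sections E U \<longleftrightarrow> \<sigma> \<in> extensional U \<and>
    (\<forall>P\<in>U. \<exists>V s. openin X V \<and> P \<in> V \<and> V \<subseteq> U \<and> s \<in> sections K V \<and>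
      restrict \<sigma> V = proj V s)"
  unfolding quotient_sheaf_def Q.sheafify_carrier_iff Q_carrier proj_def
    by (simp add: bex_simps image_iff) blast

lemma E_rstr: "rstr E U V \<sigma> = restrict \<sigma> V"
  by (simp add: quotient_sheaf_def Q.sheafify_rstr)

lemma proj_closed:
  assumes "openin X U" "s \<in> sections K U"
  shows "proj U s \<in> sections E U"
  using assms Q.induced_closed[of U "qclass U s"] by (auto simp: proj_def quotient_sheaf_def
    Q_carrier)

lemma proj_add:
  assumes "openin X U" "s \<in> sections K U" "t \<in> sections K U"
  shows "add (sects E U) (proj U s) (proj U t) = proj U (add (sects K U) s t)"
  using assms Q.induced_add[of U "qclass U s" "qclass U t"]
  by (auto simp: proj_def quotient_sheaf_def Q_carrier Q_add)

lemma proj_smult: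
  assumes "openin X U" "f \<in> sections R U" "s \<in> sections K U"
  shows "smult (sects E U) f (proj U s) = proj U (smult (sects K U) f s)"
  using assms Q.induced_smult[of U f "qclass U s"]
  by (auto simp: proj_def quotient_sheaf_def Q_carrier Q_smult)

lemma restrict_proj:
  assumes "openin X U" "openin X V" "V \<subseteq> U" "s \<in> sections K U"
  shows "restrict (proj U s) V = proj V (rstr K U V s)"
  using assms Q.restrict_induced[of U V "qclass U s"]
  by (auto simp: proj_def Q_carrier Q_rstr)

lemma rstr_minus:
  assumes "openin X U" "openin X V" "V \<subseteq> U" "s \<in> sections K U" "t \<in> sections K U"
  shows "rstr K U V (a_minus (sects K U) s t) = a_minus (sects K V) (rstr K U V s) (rstr K U V t)"
proof -
  interpret U: abelian_subgroup "sections N U" "sects K U" by (rule subgroup[OF assms(1)])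
  interpret V: abelian_subgroup "sections N V" "sects K V" by (rule subgroup[OF assms(2)])
  let ?d = "a_minus (sects K U) s t"
  have d: "?d \<in> sections K U" using assms by simp
  have "add (sects K U) ?d t = s" using assms by (simp add: U.minus_eq U.add.m_assoc U.l_neg)
  then have "rstr K U V s = add (sects K V) (rstr K U V ?d) (rstr K U V t)"
    using rstr_add[OF assms(1-3) d assms(5)] by simp
  then show ?thesis using assms d rstr_closed[OF assms(1-3)]
    by (simp add: V.minus_eq V.add.m_assoc V.r_neg)
qed

text \<open>Equality of germs puts the difference in \<open>N\<close> only near each point;
  \<open>N_local\<close> patches these memberships together.\<close>

lemma proj_eq_iff:
  assumes "openin X U" "s \<in> sections K U" "t \<in> sections K U"
  shows "proj U s = proj U t \<longleftrightarrow> a_minus (sects K U) s t \<in> sections N U"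
proof -
  interpret abelian_subgroup "sections N U" "sects K U" by (rule subgroup[OF assms(1)])
  have m: "a_minus (sects K U) s t \<in> sections K U" using assms by simp
  have "proj U s = proj U t \<longleftrightarrow>
    (\<forall>P\<in>U. \<exists>V. openin X V \<and> P \<in> V \<and> V \<subseteq> U \<and> qclass V (rstr K U V s) = qclass V (rstr K U V t))"
    using assms by (simp add: proj_def Q.induced_eq_iff Q_carrier Q_rstr cong: conj_cong)
  also have "\<dots> \<longleftrightarrow> (\<forall>P\<in>U. \<exists>V. openin X V \<and> P \<in> V \<and> V \<subseteq> U \<and>
      rstr K U V (a_minus (sects K U) s t) \<in> sections N V)"
    using assms by (simp add: qclass_eq_iff rstr_minus rstr_closed cong: conj_cong)
  also have "\<dots> \<longleftrightarrow> a_minus (sects K U) s t \<in> sections N U"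
    using N_local[OF assms(1) m] N_rstr assms(1) by blast
  finally show ?thesis .
qed

end

section \<open>Homomorphisms out of a quotient sheaf\<close>

locale module_sheaf = module_presheaf X R G
  for X :: "'p topology" and R :: "('p, 'r) ring_presheaf" and G :: "('p, 'r, 'l) mod_presheaf" +
  assumes group: "openin X U \<Longrightarrow> abelian_group (sects G U)"
    and separated: "\<lbrakk>openin X U; g \<in> sections G U; h \<in> sections G U;
        \<And>P. P \<in> U \<Longrightarrow> \<exists>V. openin X V \<and> P \<in> V \<and> V \<subseteq> U \<and> rstr G U V g = rstr G U V h\<rbrakk> \<Longrightarrow> g = h"
    and glue: "\<lbrakk>openin X U; \<Union>C = U; \<And>V. V \<in> C \<Longrightarrow> openin X V;
        \<And>V. V \<in> C \<Longrightarrow> k V \<in> sections G V;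
        \<And>V W. \<lbrakk>V \<in> C; W \<in> C\<rbrakk> \<Longrightarrow> rstr G V (V \<inter> W) (k V) = rstr G W (V \<inter> W) (k W)\<rbrakk>
      \<Longrightarrow> \<exists>h\<in>sections G U. \<forall>V\<in>C. rstr G U V h = k V"

text \<open>A homomorphism over \<open>U\<close> with kernel exactly \<open>N\<close>, hence an
  embedding of the quotient sheaf into \<open>G\<close>, but stated on sections of \<open>K\<close>
  so that no germs of cosets occur.\<close>

definition kernel_hom :: "'p topology \<Rightarrow> ('p, 'r) ring_presheaf \<Rightarrow> ('p, 'r, 'm) mod_presheaf
    \<Rightarrow> ('p, 'r, 'm) mod_presheaf \<Rightarrow> ('p, 'r, 'l) mod_presheaf \<Rightarrow> 'p set \<Rightarrow> ('p set \<Rightarrow> 'm \<Rightarrow> 'l) \<Rightarrow> bool"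
      where
  "kernel_hom X R K N G U \<Phi> \<longleftrightarrow>
    (\<forall>V. openin X V \<and> V \<subseteq> U \<longrightarrow> linear_map (sects R V) (sects K V) (sects G V) (\<Phi> V) \<and>
       (\<forall>s\<in>sections K V. \<Phi> V s = zero (sects G V) \<longleftrightarrow> s \<in> sections N V)) \<and>
    (\<forall>V W. openin X V \<and> openin X W \<and> W \<subseteq> V \<and> V \<subseteq> U \<longrightarrow>
       (\<forall>s\<in>sections K V. rstr G V W (\<Phi> V s) = \<Phi> W (rstr K V W s)))"

lemma linear_mapD:
  assumes "linear_map A M N h"
  shows "s \<in> carrier M \<Longrightarrow> h s \<in> carrier N"
    and "s \<in> carrier M \<Longrightarrow> t \<in> carrier M \<Longrightarrow> h (add M s t) = add N (h s) (h t)"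
    and "f \<in> carrier A \<Longrightarrow> s \<in> carrier M \<Longrightarrow> h (smult M f s) = smult N f (h s)"
  using assms by (auto simp: linear_map_def)

lemma kernel_homD:
  assumes "kernel_hom X R K N G U \<Phi>"
  shows "openin X V \<Longrightarrow> V \<subseteq> U \<Longrightarrow> linear_map (sects R V) (sects K V) (sects G V) (\<Phi> V)"
    and "openin X V \<Longrightarrow> V \<subseteq> U \<Longrightarrow> s \<in> sections K V \<Longrightarrow>
      \<Phi> V s = zero (sects G V) \<longleftrightarrow> s \<in> sections N V"
    and "openin X V \<Longrightarrow> openin X W \<Longrightarrow> W \<subseteq> V \<Longrightarrow> V \<subseteq> U \<Longrightarrow> s \<in> sections K V \<Longrightarrow>
      rstr G V W (\<Phi> V s) = \<Phi> W (rstr K V W s)"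
  using assms by (simp_all add: kernel_hom_def)

text \<open>\<open>linear_map\<close> does not mention zero; preservation of zero is recovered from
  idempotence in the target group.\<close>

lemma add_idem_zero:
  assumes "abelian_group A" "x \<in> carrier A" "add A x x = x"
  shows "x = zero A"
proof -
  interpret abelian_group A by fact
  show ?thesis using assms(2,3) by (metis add.l_cancel_one)
qed

lemma a_minus_zero:
  assumes "abelian_group A" "x \<in> carrier A"
  shows "a_minus A x (zero A) = x"
proof -
  interpret abelian_group A by fact
  have "a_minus A x (zero A) = add A (a_minus A x (zero A)) (zero A)" using assms(2) by simp
  also have "\<dots> = add A x (add A (a_inv A (zero A)) (zero A))"
    using assms(2) by (simp add: minus_eq add.m_assoc del: r_zero)
  also have "\<dots> = x" using assms(2) by (simp only: l_neg zero_closed r_zero)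
  finally show ?thesis .
qed

context sheaf_quotient
begin

text \<open>\<open>\<Phi>\<close> is the isomorphism composed with \<open>proj\<close>, and its
  kernel is \<open>N\<close> by injectivity and \<open>proj_eq_iff\<close>. Lifts are obtained only
  locally, because a section of the quotient comes from \<open>K\<close> only locally.\<close>

theorem iso_on_imp_kernel_hom:
  assumes G: "module_sheaf X R G" and U: "openin X U" and iso: "iso_on X R U E G"
  obtains \<Phi> where "kernel_hom X R K N G U \<Phi>"
    and "\<And>V g P. \<lbrakk>openin X V; V \<subseteq> U; g \<in> sections G V; P \<in> V\<rbrakk>
      \<Longrightarrow> \<exists>W s. openin X W \<and> P \<in> W \<and> W \<subseteq> V \<and> s \<in> sections K W \<and> \<Phi> W s = rstr G V W g"
proof -
  interpret G: module_sheaf X R G by fact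
  obtain \<phi> where lb: "\<forall>V. openin X V \<and> V \<subseteq> U \<longrightarrow> linear_map (sects R V) (sects E V) (sects G V) (\<phi> V)
    \<and>
      bij_betw (\<phi> V) (sections E V) (sections G V)"
    and r: "\<forall>V W. openin X V \<and> openin X W \<and> W \<subseteq> V \<and> V \<subseteq> U \<longrightarrow>
        (\<forall>s\<in>sections E V. rstr G V W (\<phi> V s) = \<phi> W (rstr E V W s))"
    using iso unfolding iso_on_def by (elim exE conjE) (rule that)
  note lin = lb[rule_format, THEN conjunct1, OF conjI]
    and bij = lb[rule_format, THEN conjunct2, OF conjI]
  have res: "rstr G V W (\<phi> V s) = \<phi> W (rstr E V W s)"
    if "openin X V" "openin X W" "W \<subseteq> V" "V \<subseteq> U" "s \<in> sections E V" for V W s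
    using r that by simp
  define \<Phi> where "\<Phi> V s = \<phi> V (proj V s)" for V s
  have "kernel_hom X R K N G U \<Phi>" unfolding kernel_hom_def
  proof (intro allI impI conjI ballI; (elim conjE)?)
    fix V assume V: "openin X V" "V \<subseteq> U"
    note l = linear_mapD[OF lin[OF V]]
    interpret K: abelian_subgroup "sections N V" "sects K V" by (rule subgroup[OF V(1)])
    show "linear_map (sects R V) (sects K V) (sects G V) (\<Phi> V)"
      using V by (auto simp: linear_map_def \<Phi>_def proj_closed l proj_add[symmetric]
        proj_smult[symmetric])
    fix s assume s: "s \<in> sections K V"
    let ?z = "zero (sects K V)"
    \<comment> \<open>Group laws for sections of the quotient have not been established, so the
      image of zero is recognised by being idempotent in the group \<open>sects G V\<close>.\<close>
    have "add (sects E V) (proj V ?z) (proj V ?z) = proj V ?z" using V by (simp add: proj_add)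
    moreover have c: "proj V ?z \<in> sections E V" using V by (simp add: proj_closed)
    ultimately have "add (sects G V) (\<phi> V (proj V ?z)) (\<phi> V (proj V ?z)) = \<phi> V (proj V ?z)"
      using l(2)[OF c c] by metis
    then have "\<phi> V (proj V ?z) = zero (sects G V)"
      by (rule add_idem_zero[OF G.group[OF V(1)] l(1)[OF c]])
    then have "\<Phi> V s = zero (sects G V) \<longleftrightarrow> \<phi> V (proj V s) = \<phi> V (proj V ?z)" by (simp add: \<Phi>_def)
    also have "\<dots> \<longleftrightarrow> proj V s = proj V ?z"
      using bij[OF V] V s by (auto simp: bij_betw_def inj_on_eq_iff proj_closed)
    also have "\<dots> \<longleftrightarrow> s \<in> sections N V" using V s by (simp add: proj_eq_iff a_minus_zero[OF
      K.abelian_group_axioms])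
    finally show "(\<Phi> V s = zero (sects G V)) = (s \<in> sections N V)" .
  next
    fix V W s assume "openin X V" "openin X W" "W \<subseteq> V" "V \<subseteq> U" "s \<in> sections K V"
    then show "rstr G V W (\<Phi> V s) = \<Phi> W (rstr K V W s)"
      by (simp add: \<Phi>_def res proj_closed E_rstr restrict_proj)
  qed
  moreover have "\<exists>W s. openin X W \<and> P \<in> W \<and> W \<subseteq> V \<and> s \<in> sections K W \<and> \<Phi> W s = rstr G V W g"
    if V: "openin X V" "V \<subseteq> U" and g: "g \<in> sections G V" and P: "P \<in> V" for V g P
  proof -
    have "g \<in> \<phi> V ` sections E V" using bij_betw_imp_surj_on[OF bij[OF V]] g by simp
    then obtain \<sigma> where \<sigma>: "\<sigma> \<in> sections E V" "\<phi> V \<sigma> = g" by blast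
    with P obtain W s where W: "openin X W" "P \<in> W" "W \<subseteq> V" "s \<in> sections K W"
      "restrict \<sigma> W = proj W s"
      unfolding E_carrier_iff by blast
    then have "\<Phi> W s = rstr G V W g" using res[OF V(1) W(1,3) V(2) \<sigma>(1)] \<sigma>(2)
      by (simp add: \<Phi>_def E_rstr)
    with W show ?thesis by blast
  qed
  ultimately show ?thesis using that by blast
qed

text \<open>The factorisation of \<open>\<Phi>\<close> through the quotient sheaf:
  \<open>\<Phi>\<close> maps local representatives of a section of the quotient, and the sheaf
  property of \<open>G\<close> glues the values. The kernel condition gives injectivity, and
  surjectivity passes to the induced map through \<open>proj\<close>.\<close>

theorem kernel_hom_imp_iso_on:
  assumes G: "module_sheaf X R G" and U: "openin X U" and \<Phi>: "kernel_hom X R K N G U \<Phi>"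
    and surj: "\<And>V g. \<lbrakk>openin X V; V \<subseteq> U; g \<in> sections G V\<rbrakk> \<Longrightarrow> g \<in> \<Phi> V ` sections K V"
  shows "iso_on X R U E G"
proof -
  interpret G: module_sheaf X R G by fact
  note lin = kernel_homD(1)[OF \<Phi>] and ker = kernel_homD(2)[OF \<Phi>] and res = kernel_homD(3)[OF \<Phi>]
  have eq: "\<Phi> V s = \<Phi> V t \<longleftrightarrow> proj V s = proj V t"
    if V: "openin X V" "V \<subseteq> U" and s: "s \<in> sections K V" and t: "t \<in> sections K V" for V s t
  proof -
    interpret K: abelian_subgroup "sections N V" "sects K V" by (rule subgroup[OF V(1)])
    interpret GV: abelian_group "sects G V" by (rule G.group[OF V(1)])
    let ?d = "a_minus (sects K V) s t"
    have d: "?d \<in> sections K V" using s t by simp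
    have "add (sects K V) ?d t = s" using s t by (simp add: K.minus_eq K.add.m_assoc K.l_neg)
    then have "\<Phi> V s = add (sects G V) (\<Phi> V ?d) (\<Phi> V t)"
      using linear_mapD(2)[OF lin[OF V] d t] by simp
    then have "\<Phi> V s = \<Phi> V t \<longleftrightarrow> \<Phi> V ?d = zero (sects G V)"
      using linear_mapD(1)[OF lin[OF V]] d t by simp
    then show ?thesis using ker[OF V d] proj_eq_iff[OF V(1) s t] by simp
  qed
  \<comment> \<open>\<open>good V \<sigma> g\<close> says that \<open>g\<close> is the value at
    \<sigma> of the map under construction. Quantifying over every local representative makes
    compatibility with restriction immediate and leaves existence to gluing.\<close>
  define good where "good V \<sigma> g \<longleftrightarrow> g \<in> sections G V \<and>
     (\<forall>W s. openin X W \<and> W \<subseteq> V \<and> s \<in> sections K W \<and> restrict \<sigma> W = proj W s \<longrightarrow>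
       rstr G V W g = \<Phi> W s)" for V \<sigma> g
  \<comment> \<open>One representative around each point suffices: on an overlap two representatives
    have the same class, hence by \<open>eq\<close> the same image under
    \<open>\<Phi>\<close>.\<close>
  have goodI: "good V \<sigma> g" if V: "openin X V" "V \<subseteq> U" and g: "g \<in> sections G V" and
    loc: "\<And>P. P \<in> V \<Longrightarrow> \<exists>W s. openin X W \<and> P \<in> W \<and> W \<subseteq> V \<and> s \<in> sections K W \<and>
      restrict \<sigma> W = proj W s \<and> rstr G V W g = \<Phi> W s" for V \<sigma> g
    unfolding good_def
  proof (intro conjI allI impI; (elim conjE)?)
    fix W s assume W: "openin X W" "W \<subseteq> V" and s: "s \<in> sections K W" "restrict \<sigma> W = proj W s"
    have WU: "W \<subseteq> U" using W V by auto
    show "rstr G V W g = \<Phi> W s"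
    proof (rule G.separated)
      fix P assume "P \<in> W"
      then have "P \<in> V" using W by blast
      from loc[OF this] obtain A t where A: "openin X A" "P \<in> A" "A \<subseteq> V" "t \<in> sections K A"
        "restrict \<sigma> A = proj A t" "rstr G V A g = \<Phi> A t" by (elim exE conjE) (rule that)
      let ?B = "W \<inter> A"
      have B: "openin X ?B" "P \<in> ?B" "?B \<subseteq> W" "?B \<subseteq> A" "?B \<subseteq> U" using A W V \<open>P \<in> W\<close> by auto
      have AU: "A \<subseteq> U" using A V by auto
      have "proj ?B (rstr K W ?B s) = restrict (restrict \<sigma> W) ?B"
        using W s B by (simp add: restrict_proj)
      also have "\<dots> = restrict (restrict \<sigma> A) ?B" by (auto simp: fun_eq_iff restrict_def)
      also have "\<dots> = proj ?B (rstr K A ?B t)" using A B by (simp add: restrict_proj)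
      finally have "\<Phi> ?B (rstr K W ?B s) = \<Phi> ?B (rstr K A ?B t)"
        using eq[OF B(1,5) rstr_closed[OF W(1) B(1,3) s(1)] rstr_closed[OF A(1) B(1,4) A(4)]]
          by simp
      also have "\<dots> = rstr G V ?B g" using res[OF A(1) B(1,4) AU A(4)] A(6)
        G.rstr_rstr[OF V(1) A(1) B(1,4) A(3) g] by simp
      also have "\<dots> = rstr G W ?B (rstr G V W g)" using G.rstr_rstr[OF V(1) W(1) B(1,3) W(2) g]
        by simp
      finally show "\<exists>B. openin X B \<and> P \<in> B \<and> B \<subseteq> W \<and> rstr G W B (rstr G V W g) = rstr G W B (\<Phi> W s)"
        using res[OF W(1) B(1,3) WU s(1)] B by (intro exI[of _ ?B]) auto
    qed (use W V g s linear_mapD(1)[OF lin[OF W(1) WU]] in \<open>auto intro: G.rstr_closed\<close>)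
  qed (use g in auto)
  have goodD: "\<exists>W s. openin X W \<and> P \<in> W \<and> W \<subseteq> V \<and> s \<in> sections K W \<and>
      restrict \<sigma> W = proj W s \<and> rstr G V W g = \<Phi> W s"
    if gd: "good V \<sigma> g" and \<sigma>: "\<sigma> \<in> sections E V" and P: "P \<in> V" for V \<sigma> g P
  proof -
    obtain W s where W: "openin X W" "P \<in> W" "W \<subseteq> V" "s \<in> sections K W" "restrict \<sigma> W = proj W s"
      using \<sigma> P unfolding E_carrier_iff by blast
    have "rstr G V W g = \<Phi> W s" using gd W by (simp add: good_def)
    with W show ?thesis by blast
  qed
  have ex: "\<exists>g. good V \<sigma> g" if V: "openin X V" "V \<subseteq> U" and \<sigma>: "\<sigma> \<in> sections E V" for V \<sigma>
  proof -
    define rep where "rep W s \<longleftrightarrow> openin X W \<and> W \<subseteq> V \<and> s \<in> sections K W \<and> restrict \<sigma> W = proj W s"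
      for W s
    \<comment> \<open>The cover consists of all open sets on which \<sigma> has a representative,
      with one chosen for each; their images agree on overlaps by \<open>eq\<close>.\<close>
    define C where "C = {W. \<exists>s. rep W s}"
    define s where "s W = (SOME s. rep W s)" for W
    have s: "rep W (s W)" if "W \<in> C" for W using that unfolding C_def s_def by (auto intro: someI)
    have "\<Union>C = V" using \<sigma> unfolding E_carrier_iff C_def rep_def by blast
    have ov: "rstr G W (W \<inter> A) (\<Phi> W (s W)) = rstr G A (W \<inter> A) (\<Phi> A (s A))"
      if WA: "W \<in> C" "A \<in> C" for W A
    proof -
      let ?B = "W \<inter> A"
      note sW = s[OF WA(1), unfolded rep_def] and sA = s[OF WA(2), unfolded rep_def]
      have B: "openin X ?B" "?B \<subseteq> W" "?B \<subseteq> A" "?B \<subseteq> U" "W \<subseteq> U" "A \<subseteq> U" using sW sA V by auto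
      have "proj ?B (rstr K W ?B (s W)) = restrict (restrict \<sigma> W) ?B"
        using sW B by (simp add: restrict_proj)
      also have "\<dots> = restrict (restrict \<sigma> A) ?B" by (auto simp: fun_eq_iff restrict_def)
      also have "\<dots> = proj ?B (rstr K A ?B (s A))" using sA B by (simp add: restrict_proj)
      finally have "\<Phi> ?B (rstr K W ?B (s W)) = \<Phi> ?B (rstr K A ?B (s A))"
        using eq[OF B(1,4)] rstr_closed[of W ?B "s W"] rstr_closed[of A ?B "s A"] sW sA B by simp
      then show ?thesis using res[of W ?B "s W"] res[of A ?B "s A"] sW sA B by simp
    qed
    obtain g where g: "g \<in> sections G V" "\<forall>W\<in>C. rstr G V W g = \<Phi> W (s W)"
    proof -
      have c: "openin X W \<and> \<Phi> W (s W) \<in> sections G W" if W: "W \<in> C" for W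
      proof -
        have *: "openin X W" "W \<subseteq> U" "s W \<in> sections K W" using s[OF W] V by (auto simp: rep_def)
        then show ?thesis using linear_mapD(1)[OF lin[OF *(1,2)] *(3)] by simp
      qed
      show thesis
        using G.glue[OF V(1) \<open>\<Union>C = V\<close>, of "\<lambda>W. \<Phi> W (s W)"] c ov that by blast
    qed
    have "good V \<sigma> g"
    proof (rule goodI[OF V g(1)])
      fix P assume "P \<in> V"
      then obtain W where W: "W \<in> C" "P \<in> W" using \<open>\<Union>C = V\<close> by blast
      then show "\<exists>W s. openin X W \<and> P \<in> W \<and> W \<subseteq> V \<and> s \<in> sections K W \<and>
        restrict \<sigma> W = proj W s \<and> rstr G V W g = \<Phi> W s"
        using s[OF W(1)] g(2) W by (intro exI[of _ W] exI[of _ "s W"]) (simp add: rep_def)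
    qed
    then show ?thesis by blast
  qed
  have uniq: "g = h" if V: "openin X V" "V \<subseteq> U" and \<sigma>: "\<sigma> \<in> sections E V"
    and g: "good V \<sigma> g" and h: "good V \<sigma> h" for V \<sigma> g h
  proof (rule G.separated[OF V(1)])
    fix P assume "P \<in> V"
    from goodD[OF g \<sigma> this] obtain W s where W: "openin X W" "P \<in> W" "W \<subseteq> V" "s \<in> sections K W"
      "restrict \<sigma> W = proj W s" "rstr G V W g = \<Phi> W s" by blast
    have "rstr G V W h = \<Phi> W s" using h W by (simp add: good_def)
    with W show "\<exists>W. openin X W \<and> P \<in> W \<and> W \<subseteq> V \<and> rstr G V W g = rstr G V W h" by auto
  qed (use g h in \<open>auto simp: good_def\<close>)
  define \<phi> where "\<phi> V \<sigma> = (SOME g. good V \<sigma> g)" for V \<sigma>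
  have \<phi>: "good V \<sigma> (\<phi> V \<sigma>)" if "openin X V" "V \<subseteq> U" "\<sigma> \<in> sections E V" for V \<sigma>
    using ex[OF that] unfolding \<phi>_def by (rule someI_ex)
  have \<phi>c: "\<phi> V \<sigma> \<in> sections G V" if "openin X V" "V \<subseteq> U" "\<sigma> \<in> sections E V" for V \<sigma>
    using \<phi>[OF that] by (simp add: good_def)
  have inj: "\<sigma> = \<tau>" if V: "openin X V" "V \<subseteq> U" and \<sigma>: "\<sigma> \<in> sections E V" and
    \<tau>: "\<tau> \<in> sections E V" and e: "\<phi> V \<sigma> = \<phi> V \<tau>" for V \<sigma> \<tau>
  proof (rule extensionalityI)
    show "\<sigma> \<in> extensional V" "\<tau> \<in> extensional V" using \<sigma> \<tau> by (auto simp: E_carrier_iff)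
    fix P assume P: "P \<in> V"
    from goodD[OF \<phi>[OF V \<sigma>] \<sigma> P] obtain W s where W: "openin X W" "P \<in> W" "W \<subseteq> V" "s \<in> sections K W"
      "restrict \<sigma> W = proj W s" "rstr G V W (\<phi> V \<sigma>) = \<Phi> W s" by blast
    from goodD[OF \<phi>[OF V \<tau>] \<tau> P] obtain A t where A: "openin X A" "P \<in> A" "A \<subseteq> V" "t \<in> sections K A"
      "restrict \<tau> A = proj A t" "rstr G V A (\<phi> V \<tau>) = \<Phi> A t" by blast
    let ?B = "W \<inter> A"
    have B: "openin X ?B" "?B \<subseteq> W" "?B \<subseteq> A" "?B \<subseteq> U" "W \<subseteq> U" "A \<subseteq> U" "P \<in> ?B" using W A V by auto
    have "\<Phi> ?B (rstr K W ?B s) = rstr G V ?B (\<phi> V \<sigma>)"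
      using res[OF W(1) B(1,2,5) W(4)] W(6) G.rstr_rstr[OF V(1) W(1) B(1,2) W(3) \<phi>c[OF V \<sigma>]] by simp
    also have "\<dots> = \<Phi> ?B (rstr K A ?B t)" unfolding e
      using res[OF A(1) B(1,3,6) A(4)] A(6) G.rstr_rstr[OF V(1) A(1) B(1,3) A(3) \<phi>c[OF V \<tau>]] by simp
    finally have "proj ?B (rstr K W ?B s) = proj ?B (rstr K A ?B t)"
      using eq[OF B(1,4) rstr_closed[OF W(1) B(1,2) W(4)] rstr_closed[OF A(1) B(1,3) A(4)]] by simp
    then have "restrict (proj W s) ?B = restrict (proj A t) ?B"
      using restrict_proj[OF W(1) B(1,2) W(4)] restrict_proj[OF A(1) B(1,3) A(4)] by simp
    then have "proj W s P = proj A t P" using B(7) by (metis restrict_apply')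
    moreover have "proj W s P = \<sigma> P" "proj A t P = \<tau> P" using W A by (metis restrict_apply')+
    ultimately show "\<sigma> P = \<tau> P" by simp
  qed
  \<comment> \<open>Closure of the quotient sections under addition and additivity of the map are
    proved from the same data: on an intersection of neighbourhoods both summands have
    representatives, and the sum of these represents the sum.\<close>
  have addE: "add (sects E V) \<sigma> \<tau> \<in> sections E V \<and>
       \<phi> V (add (sects E V) \<sigma> \<tau>) = add (sects G V) (\<phi> V \<sigma>) (\<phi> V \<tau>)"
    if V: "openin X V" "V \<subseteq> U" and \<sigma>: "\<sigma> \<in> sections E V" and \<tau>: "\<tau> \<in> sections E V" for V \<sigma> \<tau>
  proof -
    have loc: "\<exists>W s. openin X W \<and> P \<in> W \<and> W \<subseteq> V \<and> s \<in> sections K W \<and>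
      restrict (add (sects E V) \<sigma> \<tau>) W = proj W s \<and>
      rstr G V W (add (sects G V) (\<phi> V \<sigma>) (\<phi> V \<tau>)) = \<Phi> W s" if P: "P \<in> V" for P
    proof -
      from goodD[OF \<phi>[OF V \<sigma>] \<sigma> P] obtain W s where W: "openin X W" "P \<in> W" "W \<subseteq> V" "s \<in> sections K
        W"
        "restrict \<sigma> W = proj W s" "rstr G V W (\<phi> V \<sigma>) = \<Phi> W s" by blast
      from goodD[OF \<phi>[OF V \<tau>] \<tau> P] obtain A t where A: "openin X A" "P \<in> A" "A \<subseteq> V" "t \<in> sections K
        A"
        "restrict \<tau> A = proj A t" "rstr G V A (\<phi> V \<tau>) = \<Phi> A t" by blast
      let ?B = "W \<inter> A"
      have B: "openin X ?B" "?B \<subseteq> W" "?B \<subseteq> A" "?B \<subseteq> U" "W \<subseteq> U" "A \<subseteq> U" "?B \<subseteq> V" using W A V by auto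
      let ?s = "rstr K W ?B s" and ?t = "rstr K A ?B t"
      have st: "?s \<in> sections K ?B" "?t \<in> sections K ?B"
        using rstr_closed[OF W(1) B(1,2) W(4)] rstr_closed[OF A(1) B(1,3) A(4)] by auto
      have "restrict \<sigma> ?B = restrict (restrict \<sigma> W) ?B" "restrict \<tau> ?B = restrict (restrict \<tau> A) ?B"
        by (auto simp: fun_eq_iff restrict_def)
      then have "restrict \<sigma> ?B = proj ?B ?s" "restrict \<tau> ?B = proj ?B ?t"
        using W(5) A(5) restrict_proj[OF W(1) B(1,2) W(4)] restrict_proj[OF A(1) B(1,3) A(4)]
          by auto
      then have 1: "restrict (add (sects E V) \<sigma> \<tau>) ?B = proj ?B (add (sects K ?B) ?s ?t)"
        using Q.sheafify_add_restrict[OF B(7)] proj_add[OF B(1) st]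
          by (simp add: quotient_sheaf_def)
      have "rstr G V ?B (\<phi> V \<sigma>) = \<Phi> ?B ?s"
        using res[OF W(1) B(1,2,5) W(4)] W(6) G.rstr_rstr[OF V(1) W(1) B(1,2) W(3) \<phi>c[OF V \<sigma>]]
          by simp
      moreover have "rstr G V ?B (\<phi> V \<tau>) = \<Phi> ?B ?t"
        using res[OF A(1) B(1,3,6) A(4)] A(6) G.rstr_rstr[OF V(1) A(1) B(1,3) A(3) \<phi>c[OF V \<tau>]]
          by simp
      ultimately have "rstr G V ?B (add (sects G V) (\<phi> V \<sigma>) (\<phi> V \<tau>)) = \<Phi> ?B (add (sects K ?B) ?s
        ?t)"
        using G.rstr_add[OF V(1) B(1,7) \<phi>c[OF V \<sigma>] \<phi>c[OF V \<tau>]] linear_mapD(2)[OF lin[OF B(1,4)] st]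
          by simp
      then show ?thesis using 1 B W(2) A(2) add_closed[OF B(1) st] by (intro exI[of _ ?B] exI) auto
    qed
    have c: "add (sects E V) \<sigma> \<tau> \<in> sections E V"
      unfolding E_carrier_iff
    proof
      show "add (sects E V) \<sigma> \<tau> \<in> extensional V" by (simp add: quotient_sheaf_def sheafify_def)
      show "\<forall>P\<in>V. \<exists>W s. openin X W \<and> P \<in> W \<and> W \<subseteq> V \<and> s \<in> sections K W \<and>
        restrict (add (sects E V) \<sigma> \<tau>) W = proj W s"
      proof
        fix P assume "P \<in> V"
        from loc[OF this] show "\<exists>W s. openin X W \<and> P \<in> W \<and> W \<subseteq> V \<and> s \<in> sections K W \<and>
          restrict (add (sects E V) \<sigma> \<tau>) W = proj W s" by blast
      qed
    qed
    have "good V (add (sects E V) \<sigma> \<tau>) (add (sects G V) (\<phi> V \<sigma>) (\<phi> V \<tau>))"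
      by (rule goodI[OF V G.add_closed[OF V(1) \<phi>c[OF V \<sigma>] \<phi>c[OF V \<tau>]]]) (rule loc)
    then show ?thesis using uniq[OF V c \<phi>[OF V c]] c by blast
  qed
  have smultE: "\<phi> V (smult (sects E V) f \<sigma>) = smult (sects G V) f (\<phi> V \<sigma>)"
    if V: "openin X V" "V \<subseteq> U" and f: "f \<in> sections R V" and \<sigma>: "\<sigma> \<in> sections E V" for V f \<sigma>
  proof -
    have loc: "\<exists>W s. openin X W \<and> P \<in> W \<and> W \<subseteq> V \<and> s \<in> sections K W \<and>
      restrict (smult (sects E V) f \<sigma>) W = proj W s \<and>
      rstr G V W (smult (sects G V) f (\<phi> V \<sigma>)) = \<Phi> W s" if P: "P \<in> V" for P
    proof -
      from goodD[OF \<phi>[OF V \<sigma>] \<sigma> P] obtain W s where W: "openin X W" "P \<in> W" "W \<subseteq> V" "s \<in> sections K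
        W"
        "restrict \<sigma> W = proj W s" "rstr G V W (\<phi> V \<sigma>) = \<Phi> W s" by blast
      have WU: "W \<subseteq> U" using W V by auto
      let ?f = "rstr R V W f"
      have f': "?f \<in> sections R W" using R_rstr V W f by blast
      have 1: "restrict (smult (sects E V) f \<sigma>) W = proj W (smult (sects K W) ?f s)"
        using Q.sheafify_smult_restrict[OF V(1) W(1,3) f] \<sigma> W(5) proj_smult[OF W(1) f' W(4)]
        by (simp add: quotient_sheaf_def)
      have "rstr G V W (smult (sects G V) f (\<phi> V \<sigma>)) = \<Phi> W (smult (sects K W) ?f s)"
        using G.rstr_smult[OF V(1) W(1,3) f \<phi>c[OF V \<sigma>]] W(6) linear_mapD(3)[OF lin[OF W(1) WU] f'
          W(4)] by simp
      then show ?thesis using 1 W smult_closed[OF W(1) f' W(4)] by blast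
    qed
    have c: "smult (sects E V) f \<sigma> \<in> sections E V"
      unfolding E_carrier_iff
    proof
      show "smult (sects E V) f \<sigma> \<in> extensional V" by (simp add: quotient_sheaf_def sheafify_def)
      show "\<forall>P\<in>V. \<exists>W s. openin X W \<and> P \<in> W \<and> W \<subseteq> V \<and> s \<in> sections K W \<and>
        restrict (smult (sects E V) f \<sigma>) W = proj W s"
      proof
        fix P assume "P \<in> V"
        from loc[OF this] show "\<exists>W s. openin X W \<and> P \<in> W \<and> W \<subseteq> V \<and> s \<in> sections K W \<and>
          restrict (smult (sects E V) f \<sigma>) W = proj W s" by blast
      qed
    qed
    have "good V (smult (sects E V) f \<sigma>) (smult (sects G V) f (\<phi> V \<sigma>))"
      by (rule goodI[OF V G.smult_closed[OF V(1) f \<phi>c[OF V \<sigma>]]]) (rule loc)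
    then show ?thesis using uniq[OF V c \<phi>[OF V c]] by blast
  qed
  show ?thesis unfolding iso_on_def
  proof (intro exI[of _ \<phi>] conjI allI impI ballI; (elim conjE)?)
    fix V assume V: "openin X V" "V \<subseteq> U"
    show "linear_map (sects R V) (sects E V) (sects G V) (\<phi> V)"
      using V \<phi>c addE smultE by (auto simp: linear_map_def)
    \<comment> \<open>A preimage of \<open>g\<close> under \<open>\<Phi>\<close> over all of
      \<open>V\<close> gives a preimage under the induced map, namely its class.\<close>
    have "g \<in> \<phi> V ` sections E V" if g: "g \<in> sections G V" for g
    proof -
      obtain s where s: "s \<in> sections K V" "g = \<Phi> V s" using surj[OF V g] by blast
      have c: "proj V s \<in> sections E V" using proj_closed V s by blast
      have "good V (proj V s) g"
        unfolding good_def
      proof (intro conjI allI impI g; elim conjE)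
        fix W t assume W: "openin X W" "W \<subseteq> V" "t \<in> sections K W" "restrict (proj V s) W = proj W t"
        then have "proj W (rstr K V W s) = proj W t" using restrict_proj[OF V(1) W(1,2) s(1)]
          by simp
        then have "\<Phi> W (rstr K V W s) = \<Phi> W t" using eq[OF W(1) _ rstr_closed[OF V(1) W(1,2) s(1)]
          W(3)] W V by auto
        then show "rstr G V W g = \<Phi> W t" using res[OF V(1) W(1,2) V(2) s(1)] s(2) by simp
      qed
      then have "g = \<phi> V (proj V s)" using uniq[OF V c _ \<phi>[OF V c]] by blast
      then show ?thesis using c by blast
    qed
    then show "bij_betw (\<phi> V) (sections E V) (sections G V)"
      unfolding bij_betw_def using inj[OF V] \<phi>c[OF V] by (auto intro!: inj_onI)
  next
    fix V W \<sigma> assume V: "openin X V" "V \<subseteq> U" and W: "openin X W" "W \<subseteq> V" and \<sigma>: "\<sigma> \<in> sections E V"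
    have WU: "W \<subseteq> U" using W V by auto
    have c: "restrict \<sigma> W \<in> sections E W" unfolding E_carrier_iff
    proof (intro conjI ballI)
      fix P assume "P \<in> W"
      then obtain A t where A: "openin X A" "P \<in> A" "A \<subseteq> V" "t \<in> sections K A" "restrict \<sigma> A =
        proj A t"
        using \<sigma> W unfolding E_carrier_iff by blast
      let ?B = "W \<inter> A"
      have B: "openin X ?B" "?B \<subseteq> A" using A W by auto
      have "restrict (restrict \<sigma> W) ?B = restrict (restrict \<sigma> A) ?B"
        by (auto simp: fun_eq_iff restrict_def)
      also have "\<dots> = proj ?B (rstr K A ?B t)" using restrict_proj[OF A(1) B A(4)] A(5) by simp
      finally show "\<exists>B s. openin X B \<and> P \<in> B \<and> B \<subseteq> W \<and> s \<in> sections K B \<and>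
        restrict (restrict \<sigma> W) B = proj B s"
        using B A \<open>P \<in> W\<close> rstr_closed[OF A(1) B A(4)] by (intro exI[of _ ?B] exI) auto
    qed simp
    have "good W (restrict \<sigma> W) (rstr G V W (\<phi> V \<sigma>))"
      unfolding good_def
    proof (intro conjI allI impI; (elim conjE)?)
      show "rstr G V W (\<phi> V \<sigma>) \<in> sections G W" using G.rstr_closed[OF V(1) W \<phi>c[OF V \<sigma>]] .
      fix A s assume A: "openin X A" "A \<subseteq> W" "s \<in> sections K A" "restrict (restrict \<sigma> W) A =
        proj A s"
      have "restrict (restrict \<sigma> W) A = restrict \<sigma> A" using A(2)
        by (auto simp: fun_eq_iff restrict_def)
      then have "restrict \<sigma> A = proj A s" "A \<subseteq> V" using A W by auto
      then have "rstr G V A (\<phi> V \<sigma>) = \<Phi> A s" using \<phi>[OF V \<sigma>] A by (simp add: good_def)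
      then show "rstr G W A (rstr G V W (\<phi> V \<sigma>)) = \<Phi> A s"
        using G.rstr_rstr[OF V(1) W(1) A(1,2) W(2) \<phi>c[OF V \<sigma>]] by simp
    qed
    then show "rstr G V W (\<phi> V \<sigma>) = \<phi> W (rstr E V W \<sigma>)"
      using uniq[OF W(1) WU c _ \<phi>[OF W(1) WU c]] by (simp add: E_rstr)
  qed
qed

end

section \<open>Regular functions on projective space\<close>

lemma homog_poly_scale: "homog_poly d f \<Longrightarrow> f (c *s v) = c ^ d * f v"
  by (induction rule: homog_poly.induct) (auto simp: algebra_simps power_add)

lemma homog_poly_cmult: "homog_poly d f \<Longrightarrow> homog_poly d (\<lambda>v. c * f v)"
  using homog_poly.mult[OF homog_poly.const] by fastforce

lemma homog_poly_coord_power: "homog_poly n (\<lambda>v. (vec_nth v k) ^ n)"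
proof (induction n)
  case (Suc n)
  then show ?case using homog_poly.mult[OF homog_poly.coord[of k] Suc] by simp
qed (use homog_poly.const[of 1] in simp)

abbreviation zopen :: "(complex ^ 'n) set set \<Rightarrow> bool" where
  "zopen \<equiv> openin zariski"

lemma openin_zariski_nonzero:
  "homog_poly d f \<Longrightarrow> zopen {P \<in> proj_space. \<forall>v\<in>P. f v \<noteq> 0}"
  unfolding zariski_def by (rule topology_generated_by_Basis) blast

lemma topspace_zariski: "topspace (zariski :: (complex ^ 'n) set topology) = proj_space"
proof -
  have "{P \<in> proj_space. \<forall>v\<in>P. (1::complex) \<noteq> 0} \<in>
      {{P \<in> proj_space. \<forall>v\<in>P. f v \<noteq> 0} |f. \<exists>d. homog_poly d (f :: complex ^ 'n \<Rightarrow> complex)}"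
    by (intro CollectI exI[of _ "\<lambda>_. 1"]) (use homog_poly.const[of 1] in auto)
  then show ?thesis unfolding zariski_def by (auto simp: topology_generated_by_topspace)
qed

lemma openin_zariski_subset: "zopen U \<Longrightarrow> U \<subseteq> proj_space"
  using openin_subset topspace_zariski by blast

lemma proj_point_eq:
  assumes "v \<in> proj_point u"
  shows "proj_point v = proj_point u"
proof -
  obtain c where c: "c \<noteq> 0" "v = c *s u" using assms by (auto simp: proj_point_def)
  have "d *s v \<in> proj_point u" if "d \<noteq> 0" for d
    unfolding proj_point_def using c that by (intro CollectI exI[of _ "d * c"]) (simp add:
      vector_smult_assoc)
  moreover have "d *s u \<in> proj_point v" if "d \<noteq> 0" for d
    unfolding proj_point_def using c that by (intro CollectI exI[of _ "d / c"]) (simp add: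
      vector_smult_assoc)
  ultimately show ?thesis by (auto simp: proj_point_def[of v] proj_point_def[of u])
qed

lemma mem_proj_point: "v \<in> proj_point v"
  unfolding proj_point_def by (rule CollectI, rule exI[of _ 1]) simp

lemma proj_spaceD:
  assumes "P \<in> proj_space" "v \<in> P"
  shows "v \<noteq> 0" "P = proj_point v"
proof -
  obtain u where u: "u \<noteq> 0" "P = proj_point u" using assms by (auto simp: proj_space_def)
  then show "P = proj_point v" using assms proj_point_eq by blast
  show "v \<noteq> 0" using assms u by (auto simp: proj_point_def)
qed

lemma mem_cone_iff:
  assumes "U \<subseteq> proj_space"
  shows "v \<in> \<Union>U \<longleftrightarrow> proj_point v \<in> U"
  using assms proj_spaceD mem_proj_point by blast

text \<open>Distinct points of projective space are disjoint sets of vectors, so a vector in both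
  cones belongs to a common point.\<close>

lemma cone_Int:
  assumes "U \<subseteq> proj_space" "V \<subseteq> proj_space"
  shows "\<Union>(U \<inter> V) = \<Union>U \<inter> \<Union>V"
proof -
  have "v \<in> \<Union>(U \<inter> V) \<longleftrightarrow> v \<in> \<Union>U \<inter> \<Union>V" for v
    using mem_cone_iff[of U v] mem_cone_iff[of V v] mem_cone_iff[of "U \<inter> V" v] assms by blast
  then show ?thesis by blast
qed

section \<open>Regular functions of a given degree\<close>

definition reg_at :: "int \<Rightarrow> (complex ^ 'n) set set \<Rightarrow> (complex ^ 'n \<Rightarrow> complex) \<Rightarrow> (complex ^ 'n) set \<Rightarrow>
  bool" where
  "reg_at d U f P \<longleftrightarrow> (\<exists>V m n g h. zopen V \<and> P \<in> V \<and> V \<subseteq> U \<and> homog_poly m g \<and>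
    homog_poly n h \<and> int m - int n = d \<and> (\<forall>v\<in>\<Union>V. h v \<noteq> 0 \<and> f v = g v / h v))"

text \<open>\<open>twist_sections\<close> without extensionality, so that pointwise formulas can be
  used without \<open>restrict\<close>.\<close>

definition reg :: "int \<Rightarrow> (complex ^ 'n) set set \<Rightarrow> (complex ^ 'n \<Rightarrow> complex) \<Rightarrow> bool" where
  "reg d U f \<longleftrightarrow> (\<forall>P\<in>U. reg_at d U f P)"

lemma twist_sections_iff: "f \<in> twist_sections d U \<longleftrightarrow> f \<in> extensional (\<Union>U) \<and> reg d U f"
  by (simp add: twist_sections_def reg_def reg_at_def)

lemma reg_atI:
  assumes "zopen V" "P \<in> V" "V \<subseteq> U" "homog_poly m g" "homog_poly n h" "int m - int n = d"
    "\<And>v. v \<in> \<Union>V \<Longrightarrow> h v \<noteq> 0 \<and> f v = g v / h v"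
  shows "reg_at d U f P"
proof -
  have "\<forall>v\<in>\<Union>V. h v \<noteq> 0 \<and> f v = g v / h v" using assms(7) by (rule ballI)
  then show ?thesis unfolding reg_at_def
    by (intro exI[of _ V] exI[of _ m] exI[of _ n] exI[of _ g] exI[of _ h]) (intro conjI assms(1-6))
qed

lemma regE:
  assumes "reg d U f" "P \<in> U"
  obtains V m g n h where "zopen V" "P \<in> V" "V \<subseteq> U" "homog_poly m g" "homog_poly n h"
    "int m - int n = d" "\<forall>v\<in>\<Union>V. h v \<noteq> 0" "\<forall>v\<in>\<Union>V. f v = g v / h v"
proof -
  obtain V m n g h where *: "zopen V" "P \<in> V" "V \<subseteq> U" "homog_poly m g" "homog_poly n h"
    "int m - int n = d" and "\<forall>v\<in>\<Union>V. h v \<noteq> 0 \<and> f v = g v / h v"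
    using bspec[OF assms(1)[unfolded reg_def] assms(2)] unfolding reg_at_def
      by (elim exE conjE) (rule that)
  then have "\<forall>v\<in>\<Union>V. h v \<noteq> 0" "\<forall>v\<in>\<Union>V. f v = g v / h v" by auto
  with * show thesis by (rule that)
qed

lemma regI: "(\<And>P. P \<in> U \<Longrightarrow> reg_at d U f P) \<Longrightarrow> reg d U f"
  by (simp add: reg_def)

lemma reg_cong: "(\<And>v. v \<in> \<Union>U \<Longrightarrow> f v = g v) \<Longrightarrow> reg d U f \<longleftrightarrow> reg d U g"
proof -
  have *: "reg d U g" if e: "\<And>v. v \<in> \<Union>U \<Longrightarrow> f v = g v" and f: "reg d U f" for f g
  proof (rule regI)
    fix P assume "P \<in> U"
    from f this show "reg_at d U g P"
    proof (rule regE)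
      fix V m n a h assume *: "zopen V" "P \<in> V" "V \<subseteq> U" "homog_poly m a" "homog_poly n h"
        "int m - int n = d" "\<forall>v\<in>\<Union>V. h v \<noteq> 0" "\<forall>v\<in>\<Union>V. f v = a v / h v"
      have "g v = a v / h v" if "v \<in> \<Union>V" for v
      proof -
        have "f v = g v" by (rule e) (use that *(3) in blast)
        then show ?thesis using *(8)[rule_format, OF that] by simp
      qed
      with * show ?thesis
        by (intro reg_atI[OF *(1-6)]) auto
    qed
  qed
  show "(\<And>v. v \<in> \<Union>U \<Longrightarrow> f v = g v) \<Longrightarrow> reg d U f \<longleftrightarrow> reg d U g"
    using *[of f g] *[of g f] by auto
qed

lemma reg_restrict [simp]: "reg d U (restrict f (\<Union>U)) \<longleftrightarrow> reg d U f"
  by (rule reg_cong) auto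

lemma reg_mono:
  assumes "reg d U f" "zopen V" "V \<subseteq> U"
  shows "reg d V f"
proof (rule regI)
  fix P assume P: "P \<in> V"
  with assms have "P \<in> U" by auto
  from assms(1) this show "reg_at d V f P"
  proof (rule regE)
    fix W m n a h assume *: "zopen W" "P \<in> W" "W \<subseteq> U" "homog_poly m a" "homog_poly n h"
      "int m - int n = d" "\<forall>v\<in>\<Union>W. h v \<noteq> 0" "\<forall>v\<in>\<Union>W. f v = a v / h v"
    then show ?thesis using assms P
      by (intro reg_atI[OF openin_Int[OF *(1) assms(2)] _ _ *(4,5,6)]) auto
  qed
qed

lemma reg_local:
  assumes "\<And>P. P \<in> U \<Longrightarrow> \<exists>V. zopen V \<and> P \<in> V \<and> V \<subseteq> U \<and> reg d V f"
  shows "reg d U f"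
proof (rule regI)
  fix P assume P: "P \<in> U"
  from assms[OF this] obtain V where V: "P \<in> V" "V \<subseteq> U" "reg d V f" by blast
  from V(3,1) show "reg_at d U f P"
  proof (rule regE)
    fix W m n a h assume *: "zopen W" "P \<in> W" "W \<subseteq> V" "homog_poly m a" "homog_poly n h"
      "int m - int n = d" "\<forall>v\<in>\<Union>W. h v \<noteq> 0" "\<forall>v\<in>\<Union>W. f v = a v / h v"
    then show ?thesis using V
      by (intro reg_atI[OF *(1,2) _ *(4,5,6)]) auto
  qed
qed

lemma reg_const: "zopen U \<Longrightarrow> reg 0 U (\<lambda>v. c)"
proof (rule regI)
  fix P assume "zopen U" "P \<in> U"
  then show "reg_at 0 U (\<lambda>v. c) P"
    using homog_poly.const[of c] homog_poly.const[of 1]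
    by (intro reg_atI[of U P U 0 "\<lambda>v. c" 0 "\<lambda>v. 1"]) auto
qed

lemma reg_coord:
  assumes "zopen U"
  shows "reg 1 U (\<lambda>v. vec_nth v k)"
proof (rule regI)
  fix P assume "P \<in> U"
  then show "reg_at 1 U (\<lambda>v. vec_nth v k) P"
    using assms homog_poly.coord[of k] homog_poly.const[of 1]
    by (intro reg_atI[of U P U 1 "\<lambda>v. vec_nth v k" 0 "\<lambda>v. 1"]) auto
qed

lemma reg_add:
  assumes "reg d U f" "reg d U g"
  shows "reg d U (\<lambda>v. f v + g v)"
proof (rule regI)
  fix P assume P: "P \<in> U"
  from assms(1) P obtain V1 m1 n1 a1 b1 where 1: "zopen V1" "P \<in> V1" "V1 \<subseteq> U"
    "homog_poly m1 a1" "homog_poly n1 b1" "int m1 - int n1 = d"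
    "\<forall>v\<in>\<Union>V1. b1 v \<noteq> 0" "\<forall>v\<in>\<Union>V1. f v = a1 v / b1 v" by (rule regE)
  from assms(2) P obtain V2 m2 n2 a2 b2 where 2: "zopen V2" "P \<in> V2" "V2 \<subseteq> U"
    "homog_poly m2 a2" "homog_poly n2 b2" "int m2 - int n2 = d"
    "\<forall>v\<in>\<Union>V2. b2 v \<noteq> 0" "\<forall>v\<in>\<Union>V2. g v = a2 v / b2 v" by (rule regE)
  have "m2 + n1 = m1 + n2" using 1(6) 2(6) by linarith
  then have num: "homog_poly (m1 + n2) (\<lambda>v. a1 v * b2 v + a2 v * b1 v)"
    using homog_poly.add[OF homog_poly.mult[OF 1(4) 2(5)]] homog_poly.mult[OF 2(4) 1(5)] by simp
  have den: "homog_poly (n1 + n2) (\<lambda>v. b1 v * b2 v)" by (rule homog_poly.mult[OF 1(5) 2(5)])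
  have "b1 v * b2 v \<noteq> 0 \<and> f v + g v = (a1 v * b2 v + a2 v * b1 v) / (b1 v * b2 v)"
    if "v \<in> \<Union>(V1 \<inter> V2)" for v
  proof -
    have v: "v \<in> \<Union>V1" "v \<in> \<Union>V2" using that by auto
    then show ?thesis using 1(7,8)[rule_format, OF v(1)] 2(7,8)[rule_format, OF v(2)]
      by (simp add: add_frac_eq)
  qed
  then show "reg_at d U (\<lambda>v. f v + g v) P"
    using 1(2,3,6) 2(2,6) by (intro reg_atI[OF openin_Int[OF 1(1) 2(1)] _ _ num den]) auto
qed

lemma reg_mult:
  assumes "reg d U f" "reg e U g"
  shows "reg (d + e) U (\<lambda>v. f v * g v)"
proof (rule regI)
  fix P assume P: "P \<in> U"
  from assms(1) P obtain V1 m1 n1 a1 b1 where 1: "zopen V1" "P \<in> V1" "V1 \<subseteq> U"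
    "homog_poly m1 a1" "homog_poly n1 b1" "int m1 - int n1 = d"
    "\<forall>v\<in>\<Union>V1. b1 v \<noteq> 0" "\<forall>v\<in>\<Union>V1. f v = a1 v / b1 v" by (rule regE)
  from assms(2) P obtain V2 m2 n2 a2 b2 where 2: "zopen V2" "P \<in> V2" "V2 \<subseteq> U"
    "homog_poly m2 a2" "homog_poly n2 b2" "int m2 - int n2 = e"
    "\<forall>v\<in>\<Union>V2. b2 v \<noteq> 0" "\<forall>v\<in>\<Union>V2. g v = a2 v / b2 v" by (rule regE)
  have "b1 v * b2 v \<noteq> 0 \<and> f v * g v = (a1 v * a2 v) / (b1 v * b2 v)" if "v \<in> \<Union>(V1 \<inter> V2)" for v
  proof -
    have v: "v \<in> \<Union>V1" "v \<in> \<Union>V2" using that by auto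
    then show ?thesis using 1(7,8)[rule_format, OF v(1)] 2(7,8)[rule_format, OF v(2)] by simp
  qed
  then show "reg_at (d + e) U (\<lambda>v. f v * g v) P"
    using 1(2,3,6) 2(2,6)
    by (intro reg_atI[OF openin_Int[OF 1(1) 2(1)] _ _ homog_poly.mult[OF 1(4) 2(4)]
          homog_poly.mult[OF 1(5) 2(5)]]) auto
qed

lemma reg_cmult: "zopen U \<Longrightarrow> reg d U f \<Longrightarrow> reg d U (\<lambda>v. c * f v)"
  using reg_mult[OF reg_const, of U d f c] by simp

lemma reg_uminus: "zopen U \<Longrightarrow> reg d U f \<Longrightarrow> reg d U (\<lambda>v. - f v)"
  using reg_cmult[of U d f "-1"] by simp

lemma reg_inverse:
  assumes "reg d U f" "\<And>v. v \<in> \<Union>U \<Longrightarrow> f v \<noteq> 0"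
  shows "reg (- d) U (\<lambda>v. inverse (f v))"
proof (rule regI)
  fix P assume P: "P \<in> U"
  from assms(1) P obtain V m n a b where 1: "zopen V" "P \<in> V" "V \<subseteq> U"
    "homog_poly m a" "homog_poly n b" "int m - int n = d"
    "\<forall>v\<in>\<Union>V. b v \<noteq> 0" "\<forall>v\<in>\<Union>V. f v = a v / b v" by (rule regE)
  have "a v \<noteq> 0 \<and> inverse (f v) = b v / a v" if "v \<in> \<Union>V" for v
    using assms(2)[of v] 1(3) 1(8)[rule_format, OF that] that by auto
  then show "reg_at (- d) U (\<lambda>v. inverse (f v)) P"
    using 1(6) by (intro reg_atI[OF 1(1,2,3,5,4)]) auto
qed

text \<open>Near the point the function is a quotient with homogeneous numerator, so whether it
  vanishes does not depend on the coordinate vector chosen for the point.\<close>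

lemma reg_nonzero_scale:
  assumes "reg d U f" "P \<in> U" "P \<in> proj_space" "u \<in> P" "v \<in> P" "f u \<noteq> 0"
  shows "f v \<noteq> 0"
proof -
  from assms(1,2) obtain V m n a b where 1: "zopen V" "P \<in> V" "V \<subseteq> U"
    "homog_poly m a" "homog_poly n b" "int m - int n = d"
    "\<forall>v\<in>\<Union>V. b v \<noteq> 0" "\<forall>v\<in>\<Union>V. f v = a v / b v" by (rule regE)
  have uv: "u \<in> \<Union>V" "v \<in> \<Union>V" using 1 assms by auto
  obtain c where c: "c \<noteq> 0" "v = c *s u" using proj_spaceD(2)[OF assms(3,4)] assms(5)
    by (auto simp: proj_point_def)
  then show ?thesis using homog_poly_scale[OF 1(4), of c u] 1(8)[rule_format,
    OF uv(1)] 1(8)[rule_format, OF uv(2)] 1(7)[rule_format, OF uv(2)] assms(6)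
    by auto
qed

text \<open>Where the function is a quotient \<open>a / b\<close>, its nonvanishing locus is that of
  the homogeneous polynomial \<open>a\<close>, a basic open set.\<close>

lemma openin_reg_nonzero:
  assumes U: "zopen U" and f: "reg d U f"
  shows "zopen {P \<in> U. \<forall>v\<in>P. f v \<noteq> 0}"
proof (subst openin_subopen, intro ballI)
  fix P assume "P \<in> {P \<in> U. \<forall>v\<in>P. f v \<noteq> 0}"
  then have P: "P \<in> U" "\<forall>v\<in>P. f v \<noteq> 0" by auto
  from f P(1) obtain V m n a b where 1: "zopen V" "P \<in> V" "V \<subseteq> U"
    "homog_poly m a" "homog_poly n b" "int m - int n = d"
    "\<forall>v\<in>\<Union>V. b v \<noteq> 0" "\<forall>v\<in>\<Union>V. f v = a v / b v" by (rule regE)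
  let ?W = "V \<inter> {P \<in> proj_space. \<forall>v\<in>P. a v \<noteq> 0}"
  have "zopen ?W" using 1(1) openin_zariski_nonzero[OF 1(4)] by (rule openin_Int)
  moreover have "P \<in> ?W" using P 1 openin_zariski_subset[OF U] by auto
  moreover have "?W \<subseteq> {P \<in> U. \<forall>v\<in>P. f v \<noteq> 0}" using 1 by auto
  ultimately show "\<exists>T. zopen T \<and> P \<in> T \<and> T \<subseteq> {P \<in> U. \<forall>v\<in>P. f v \<noteq> 0}" by blast
qed

lemma reg_nonzero_nbhd:
  assumes U: "zopen U" and f: "reg d U f" and P: "P \<in> U" "v \<in> P" "f v \<noteq> 0"
  obtains V where "zopen V" "P \<in> V" "V \<subseteq> U" "\<forall>u\<in>\<Union>V. f u \<noteq> 0"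
proof -
  have "P \<in> proj_space" using U P openin_zariski_subset by blast
  then have "\<forall>u\<in>P. f u \<noteq> 0" using reg_nonzero_scale[OF f P(1) _ P(2)] P(3) by blast
  with P(1) show thesis by (intro that[OF openin_reg_nonzero[OF U f]]) blast+
qed

lemma coord_nbhd:
  assumes "P \<in> proj_space"
  obtains V k where "zopen V" "P \<in> V" "\<forall>u\<in>\<Union>V. vec_nth u k \<noteq> 0"
proof -
  obtain v where v: "v \<noteq> 0" "v \<in> P" using assms mem_proj_point by (auto simp: proj_space_def)
  then obtain k where "vec_nth v k \<noteq> 0" by (auto simp: Finite_Cartesian_Product.vec_eq_iff)
  moreover have "zopen proj_space" using topspace_zariski openin_topspace by metis
  ultimately obtain V where "zopen V" "P \<in> V" "\<forall>u\<in>\<Union>V. vec_nth u k \<noteq> 0"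
    using reg_nonzero_nbhd[OF _ reg_coord assms v(2)] by metis
  then show thesis by (rule that)
qed

text \<open>In negative degree even the zero section needs a denominator of degree
  \<open>- d\<close> without zeros; a power of a coordinate that does not vanish near the point
  serves. One of \<open>nat d\<close> and \<open>nat (- d)\<close> is 0, which treats both signs at
  once.\<close>

lemma reg_zero:
  assumes "zopen U"
  shows "reg d U (\<lambda>v. 0)"
proof (rule reg_local)
  fix P assume P: "P \<in> U"
  then have "P \<in> proj_space" using assms openin_zariski_subset by blast
  then obtain V k where V: "zopen V" "P \<in> V" "\<forall>u\<in>\<Union>V. vec_nth u k \<noteq> 0"
    by (rule coord_nbhd)
  let ?W = "V \<inter> U"
  have "reg d ?W (\<lambda>v. 0)"
  proof (rule regI)
    fix Q assume "Q \<in> ?W"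
    then show "reg_at d (V \<inter> U) (\<lambda>v. 0) Q"
      using homog_poly_cmult[OF homog_poly_coord_power[of "nat d" k], of 0]
        homog_poly_coord_power[of "nat (- d)" k] V assms
      by (intro reg_atI[of ?W Q _ "nat d" "\<lambda>v. 0 * vec_nth v k ^ nat d" "nat (- d)"
            "\<lambda>v. vec_nth v k ^ nat (- d)"]) auto
  qed
  then show "\<exists>V. zopen V \<and> P \<in> V \<and> V \<subseteq> U \<and> reg d V (\<lambda>v. 0)"
    using V P assms by (intro exI[of _ ?W]) auto
qed

lemma reg_sum:
  assumes "zopen U" "\<And>i. i \<in> I \<Longrightarrow> reg d U (f i)"
  shows "reg d U (\<lambda>v. \<Sum>i\<in>I. f i v)"
  using assms(2) by (induction I rule: infinite_finite_induct) (auto intro: reg_zero reg_add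
    assms(1))

lemma reg_prod:
  assumes "zopen U" "\<And>i. i \<in> I \<Longrightarrow> reg 0 U (f i)"
  shows "reg 0 U (\<lambda>v. \<Prod>i\<in>I. f i v)"
  using assms(2)
proof (induction I rule: infinite_finite_induct)
  case (insert x F)
  then show ?case using reg_mult[of 0 U "f x" 0 "\<lambda>v. \<Prod>i\<in>F. f i v"] by simp
qed (auto intro: reg_const assms(1))

lemma reg_mult0: "reg 0 U f \<Longrightarrow> reg d U g \<Longrightarrow> reg d U (\<lambda>v. f v * g v)"
  using reg_mult[of 0 U f d g] by simp

lemma module_sheaf_free: "module_sheaf zariski structure_sheaf (free_sheaf structure_sheaf n)"
  (is "module_sheaf _ _ ?G")
proof (intro module_sheaf.intro module_presheaf.intro module_sheaf_axioms.intro)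
  fix U V :: "(complex ^ 'a) set set" and f assume *: "zopen U" "zopen V" "V \<subseteq> U"
    "f \<in> sections structure_sheaf U"
  then show "rstr structure_sheaf U V f \<in> sections structure_sheaf V"
    by (auto simp: structure_sheaf_def twist_sections_iff intro: reg_mono)
next
  fix U V W :: "(complex ^ 'a) set set" and f assume "W \<subseteq> V" "V \<subseteq> U"
  then have "\<Union>W \<subseteq> \<Union>V" by blast
  then show "rstr structure_sheaf V W (rstr structure_sheaf U V f) = rstr structure_sheaf U W f"
    by (auto simp: structure_sheaf_def restrict_def fun_eq_iff)
next
  fix U :: "(complex ^ 'a) set set" and s t assume "zopen U"
    "s \<in> sections ?G U" "t \<in> sections ?G U"
  then show "add (sects ?G U) s t \<in> sections ?G U"
    by (auto simp: free_sheaf_def structure_sheaf_def twist_sections_iff PiE_iff intro!: reg_add)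
next
  fix U :: "(complex ^ 'a) set set" and f s assume "zopen U"
    "f \<in> sections structure_sheaf U" "s \<in> sections ?G U"
  then show "smult (sects ?G U) f s \<in> sections ?G U"
    by (auto simp: free_sheaf_def structure_sheaf_def twist_sections_iff PiE_iff intro!: reg_mult0)
next
  fix U V :: "(complex ^ 'a) set set" and s assume "zopen U" "zopen V" "V \<subseteq> U"
    "s \<in> sections ?G U"
  then show "rstr ?G U V s \<in> sections ?G V"
    by (auto simp: free_sheaf_def structure_sheaf_def twist_sections_iff PiE_iff intro: reg_mono)
next
  fix U V :: "(complex ^ 'a) set set" and s t assume "V \<subseteq> U"
  then have "\<Union>V \<subseteq> \<Union>U" by blast
  then show "rstr ?G U V (add (sects ?G U) s t) = add (sects ?G V) (rstr ?G U V s) (rstr ?G U V t)"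
    by (auto simp: free_sheaf_def structure_sheaf_def restrict_def fun_eq_iff)
next
  fix U V :: "(complex ^ 'a) set set" and f s assume "V \<subseteq> U"
  then have "\<Union>V \<subseteq> \<Union>U" by blast
  then show "rstr ?G U V (smult (sects ?G U) f s) =
      smult (sects ?G V) (rstr structure_sheaf U V f) (rstr ?G U V s)"
    by (auto simp: free_sheaf_def structure_sheaf_def restrict_def fun_eq_iff)
next
  fix U V W :: "(complex ^ 'a) set set" and s assume "W \<subseteq> V" "V \<subseteq> U"
  then have "\<Union>W \<subseteq> \<Union>V" by blast
  then show "rstr ?G V W (rstr ?G U V s) = rstr ?G U W s"
    by (auto simp: free_sheaf_def structure_sheaf_def restrict_def fun_eq_iff)
next
  fix U :: "(complex ^ 'a) set set" assume U: "zopen U"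
  show "abelian_group (sects ?G U)"
  proof (rule abelian_groupI)
    fix s assume s: "s \<in> sections ?G U"
    show "\<exists>t\<in>sections ?G U. add (sects ?G U) t s = zero (sects ?G U)"
    proof
      show "(\<lambda>k\<in>{..<n}. \<lambda>v\<in>\<Union>U. - s k v) \<in> sections ?G U"
        using s by (auto simp: free_sheaf_def structure_sheaf_def twist_sections_iff PiE_iff intro!:
          reg_uminus[OF U])
      show "add (sects ?G U) (\<lambda>k\<in>{..<n}. \<lambda>v\<in>\<Union>U. - s k v) s = zero (sects ?G U)"
        by (auto simp: free_sheaf_def structure_sheaf_def restrict_def fun_eq_iff)
    qed
    show "add (sects ?G U) (zero (sects ?G U)) s = s"
      using s by (auto simp: free_sheaf_def structure_sheaf_def restrict_def fun_eq_iff
          twist_sections_iff PiE_iff extensional_def)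
    fix t assume t: "t \<in> sections ?G U"
    show "add (sects ?G U) s t \<in> sections ?G U"
      using s t by (auto simp: free_sheaf_def structure_sheaf_def twist_sections_iff PiE_iff intro!:
        reg_add)
    show "add (sects ?G U) s t = add (sects ?G U) t s"
      by (auto simp: free_sheaf_def structure_sheaf_def restrict_def fun_eq_iff)
    fix u
    show "add (sects ?G U) (add (sects ?G U) s t) u = add (sects ?G U) s (add (sects ?G U) t u)"
      by (auto simp: free_sheaf_def structure_sheaf_def restrict_def fun_eq_iff)
  next
    show "zero (sects ?G U) \<in> sections ?G U"
      using U by (auto simp: free_sheaf_def structure_sheaf_def twist_sections_iff PiE_iff intro!:
        reg_zero)
  qed
next
  fix U :: "(complex ^ 'a) set set" and g h assume U: "zopen U"
    and gh: "g \<in> sections ?G U" "h \<in> sections ?G U"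
    and loc: "\<And>P. P \<in> U \<Longrightarrow> \<exists>V. zopen V \<and> P \<in> V \<and> V \<subseteq> U \<and> rstr ?G U V g = rstr ?G U V h"
  have "g k v = h k v" if k: "k < n" and v: "v \<in> \<Union>U" for k v
  proof -
    obtain P where P: "P \<in> U" "v \<in> P" using v by blast
    then obtain V where V: "P \<in> V" "rstr ?G U V g = rstr ?G U V h" using loc by blast
    then have "restrict (g k) (\<Union>V) = restrict (h k) (\<Union>V)"
      using k by (auto simp: free_sheaf_def structure_sheaf_def dest!: fun_cong[of _ _ k])
    then show ?thesis using V P by (auto simp only: restrict_eq_restrict_iff)
  qed
  moreover have "g k v = h k v" if "k < n" "v \<notin> \<Union>U" for k v
    using gh that by (auto simp: free_sheaf_def structure_sheaf_def PiE_iff twist_sections_iff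
      extensional_def)
  moreover have "g k = h k" if "\<not> k < n" for k
    using gh that by (auto simp: free_sheaf_def PiE_iff extensional_def)
  ultimately show "g = h" by (metis ext)
next
  fix U :: "(complex ^ 'a) set set" and C k assume U: "zopen U" "\<Union>C = U"
    and C: "\<And>V. V \<in> C \<Longrightarrow> zopen V" "\<And>V. V \<in> C \<Longrightarrow> k V \<in> sections ?G V"
    and ov: "\<And>V W. V \<in> C \<Longrightarrow> W \<in> C \<Longrightarrow> rstr ?G V (V \<inter> W) (k V) = rstr ?G W (V \<inter> W) (k W)"
  \<comment> \<open>The glued tuple is defined pointwise: at \<open>v\<close> it takes the value of
    a chosen member of the cover whose cone contains \<open>v\<close>. By \<open>cone_Int\<close>
    any two such members have \<open>v\<close> in the cone over their overlap, where they
    agree.\<close>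
  define ch where "ch v = (SOME V. V \<in> C \<and> v \<in> \<Union>V)" for v
  have ch: "ch v \<in> C \<and> v \<in> \<Union>(ch v)" if "v \<in> \<Union>U" for v
    unfolding ch_def by (rule someI_ex) (use that U in blast)
  define h where "h = (\<lambda>i\<in>{..<n}. \<lambda>v\<in>\<Union>U. k (ch v) i v)"
  have h: "h i v = k V i v" if i: "i < n" and V: "V \<in> C" and v: "v \<in> \<Union>V" for i v V
  proof -
    have vU: "v \<in> \<Union>U" using v V U by blast
    let ?W = "ch v"
    have "v \<in> \<Union>(V \<inter> ?W)" using cone_Int[of V ?W] ch[OF vU] C(1) V v openin_zariski_subset by blast
    moreover have "restrict (k V i) (\<Union>(V \<inter> ?W)) = restrict (k ?W i) (\<Union>(V \<inter> ?W))"
      using ov[OF V, of ?W] ch[OF vU] i by (auto simp: free_sheaf_def structure_sheaf_def dest!: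
        fun_cong[of _ _ i])
    ultimately have "k V i v = k ?W i v" unfolding restrict_eq_restrict_iff by (rule bspec[rotated])
    then show ?thesis using i vU by (simp add: h_def)
  qed
  have "reg 0 U (h i)" if i: "i < n" for i
  proof (rule reg_local)
    fix P assume "P \<in> U"
    then obtain V where V: "V \<in> C" "P \<in> V" using U by blast
    have "reg 0 V (k V i)" using C(2)[OF V(1)] i by (auto simp: free_sheaf_def structure_sheaf_def
      PiE_iff twist_sections_iff)
    then have "reg 0 V (h i)" using reg_cong[of V "h i" "k V i" 0] h[OF i V(1)] by blast
    then show "\<exists>V. zopen V \<and> P \<in> V \<and> V \<subseteq> U \<and> reg 0 V (h i)" using V C(1) U by blast
  qed
  then have "h \<in> sections ?G U"
    by (auto simp: free_sheaf_def structure_sheaf_def twist_sections_iff PiE_iff h_def)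
  moreover have "rstr ?G U V h = k V" if V: "V \<in> C" for V
  proof (rule extensionalityI[of _ "{..<n}"])
    fix i assume i: "i \<in> {..<n}"
    have e: "k V i \<in> extensional (\<Union>V)" using C(2)[OF V] i
      by (auto simp: free_sheaf_def structure_sheaf_def PiE_iff twist_sections_iff)
    have "restrict (h i) (\<Union>V) = k V i"
      by (rule extensionalityI[OF _ e]) (use h[OF _ V] i in auto)
    then show "rstr ?G U V h i = k V i" using i by (simp add: free_sheaf_def structure_sheaf_def)
  qed (use C(2)[OF V] in \<open>auto simp: free_sheaf_def PiE_iff\<close>)
  ultimately show "\<exists>h\<in>sections ?G U. \<forall>V\<in>C. rstr ?G U V h = k V" by blast
qed

section \<open>Vector-valued regular functions\<close>

abbreviation functional :: "(complex \<Rightarrow> 'e::ab_group_add \<Rightarrow> 'e) \<Rightarrow> ('e \<Rightarrow> complex) \<Rightarrow> bool" where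
  "functional sc \<equiv> Vector_Spaces.linear sc (*)"

text \<open>Testing with all functionals keeps regularity free of bases;
  \<open>tensor_twist_carrier_iff\<close> identifies these functions with the sections of the tensor
  product.\<close>

definition vreg :: "(complex \<Rightarrow> 'e::ab_group_add \<Rightarrow> 'e) \<Rightarrow> int \<Rightarrow> (complex ^ 'n) set set
    \<Rightarrow> (complex ^ 'n \<Rightarrow> 'e) \<Rightarrow> bool" where
  "vreg sc d U s \<longleftrightarrow> (\<forall>\<phi>. functional sc \<phi> \<longrightarrow> reg d U (\<lambda>v. \<phi> (s v)))"

text \<open>A regular family of linear maps, that is a section of \<open>Hom(E, F)\<close> twisted
  by \<open>d\<close>. Linearity is imposed at every vector, regularity only over
  \<open>U\<close>.\<close>

definition oreg :: "(complex \<Rightarrow> 'e::ab_group_add \<Rightarrow> 'e) \<Rightarrow> (complex \<Rightarrow> 'f::ab_group_add \<Rightarrow> 'f) \<Rightarrow> int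
    \<Rightarrow> (complex ^ 'n) set set \<Rightarrow> (complex ^ 'n \<Rightarrow> 'e \<Rightarrow> 'f) \<Rightarrow> bool" where
  "oreg sE sF d U T \<longleftrightarrow> (\<forall>v. Vector_Spaces.linear sE sF (T v)) \<and> (\<forall>e. vreg sF d U (\<lambda>v. T v e))"

lemma vregD: "vreg sc d U s \<Longrightarrow> functional sc \<phi> \<Longrightarrow> reg d U (\<lambda>v. \<phi> (s v))"
  by (simp add: vreg_def)

lemma vreg_cong: "(\<And>v. v \<in> \<Union>U \<Longrightarrow> s v = t v) \<Longrightarrow> vreg sc d U s \<longleftrightarrow> vreg sc d U t"
  unfolding vreg_def by (intro all_cong reg_cong) simp

lemma vreg_restrict [simp]: "vreg sc d U (restrict s (\<Union>U)) \<longleftrightarrow> vreg sc d U s"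
  by (rule vreg_cong) auto

lemma vreg_mono: "vreg sc d U s \<Longrightarrow> zopen V \<Longrightarrow> V \<subseteq> U \<Longrightarrow> vreg sc d V s"
  unfolding vreg_def using reg_mono by blast

lemma vreg_local:
  assumes "\<And>P. P \<in> U \<Longrightarrow> \<exists>V. zopen V \<and> P \<in> V \<and> V \<subseteq> U \<and> vreg sc d V s"
  shows "vreg sc d U s"
  unfolding vreg_def
proof (intro allI impI reg_local)
  fix \<phi> P assume "functional sc \<phi>" "P \<in> U"
  from assms[OF this(2)] obtain V where V: "zopen V" "P \<in> V" "V \<subseteq> U" "vreg sc d V s" by blast
  with \<open>functional sc \<phi>\<close> show "\<exists>V. zopen V \<and> P \<in> V \<and> V \<subseteq> U \<and> reg d V (\<lambda>v. \<phi> (s v))"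
    by (intro exI[of _ V]) (simp add: vregD)
qed

lemma oreg_mono: "oreg sE sF d U T \<Longrightarrow> zopen V \<Longrightarrow> V \<subseteq> U \<Longrightarrow> oreg sE sF d V T"
  unfolding oreg_def using vreg_mono by blast

lemma linear_simps:
  assumes "Vector_Spaces.linear sE sF T"
  shows "T (x + y) = T x + T y" "T (sE c x) = sF c (T x)" "T 0 = 0" "T (- x) = - T x" "T (x - y) =
    T x - T y"
    "T (sum f A) = (\<Sum>a\<in>A. T (f a))"
proof -
  interpret Vector_Spaces.linear sE sF T by fact
  show "T (x + y) = T x + T y" "T (sE c x) = sF c (T x)" "T 0 = 0" "T (- x) = - T x" "T (x - y) =
    T x - T y"
    "T (sum f A) = (\<Sum>a\<in>A. T (f a))" by (auto simp: add scale zero neg diff sum)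
qed

lemma linear_compose_vs:
  "Vector_Spaces.linear sE sF S \<Longrightarrow> Vector_Spaces.linear sF sG T \<Longrightarrow> Vector_Spaces.linear sE sG (\<lambda>x. T
    (S x))"
  using Vector_Spaces.linear_compose[of sE sF S sG T] by (simp add: o_def)

lemma linearI_vs:
  assumes "vector_space sE" "vector_space sF" "\<And>x y. T (x + y) = T x + T y" "\<And>c x. T (sE c x) =
    sF c (T x)"
  shows "Vector_Spaces.linear sE sF T"
proof -
  interpret E: vector_space sE by fact
  interpret F: vector_space sF by fact
  show ?thesis by unfold_locales (auto simp: assms(3,4))
qed

lemma vreg_add:
  assumes "vreg sc d U s" "vreg sc d U t"
  shows "vreg sc d U (\<lambda>v. s v + t v)"
  unfolding vreg_def
proof (intro allI impI)
  fix \<phi> assume \<phi>: "functional sc \<phi>"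
  show "reg d U (\<lambda>v. \<phi> (s v + t v))"
    using reg_add[OF vregD[OF assms(1) \<phi>] vregD[OF assms(2) \<phi>]] by (simp add: linear_simps[OF \<phi>])
qed

lemma vreg_uminus:
  assumes "zopen U" "vreg sc d U s"
  shows "vreg sc d U (\<lambda>v. - s v)"
  unfolding vreg_def
proof (intro allI impI)
  fix \<phi> assume \<phi>: "functional sc \<phi>"
  show "reg d U (\<lambda>v. \<phi> (- s v))"
    using reg_uminus[OF assms(1) vregD[OF assms(2) \<phi>]] by (simp add: linear_simps[OF \<phi>])
qed

lemma vreg_diff:
  assumes "zopen U" "vreg sc d U s" "vreg sc d U t"
  shows "vreg sc d U (\<lambda>v. s v - t v)"
  using vreg_add[OF assms(2) vreg_uminus[OF assms(1,3)]] by simp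

lemma vreg_const: "zopen U \<Longrightarrow> vreg sc 0 U (\<lambda>v. e)"
  unfolding vreg_def by (auto intro: reg_const)

lemma vreg_zero:
  assumes "zopen U"
  shows "vreg sc d U (\<lambda>v. 0)"
  unfolding vreg_def
proof (intro allI impI)
  fix \<phi> assume \<phi>: "functional sc \<phi>"
  show "reg d U (\<lambda>v. \<phi> 0)"
    using reg_zero[OF assms] by (simp add: linear_simps[OF \<phi>])
qed

lemma vreg_scale:
  assumes "reg d U f" "vreg sc e U s"
  shows "vreg sc (d + e) U (\<lambda>v. sc (f v) (s v))"
  unfolding vreg_def
proof (intro allI impI)
  fix \<phi> assume \<phi>: "functional sc \<phi>"
  show "reg (d + e) U (\<lambda>v. \<phi> (sc (f v) (s v)))"
    using reg_mult[OF assms(1) vregD[OF assms(2) \<phi>]] by (simp add: linear_simps[OF \<phi>])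
qed

lemma vreg_sum:
  assumes "zopen U" "\<And>i. i \<in> I \<Longrightarrow> vreg sc d U (s i)"
  shows "vreg sc d U (\<lambda>v. \<Sum>i\<in>I. s i v)"
  using assms(2) by (induction I rule: infinite_finite_induct) (auto intro: vreg_zero vreg_add
    assms(1))

lemma vreg_scale0: "reg 0 U f \<Longrightarrow> vreg sc e U s \<Longrightarrow> vreg sc e U (\<lambda>v. sc (f v) (s v))"
  using vreg_scale[of 0 U f sc e s] by simp

lemma vreg_scale_const:
  assumes "reg d U f" "zopen U"
  shows "vreg sc d U (\<lambda>v. sc (f v) e)"
  using vreg_scale[OF assms(1) vreg_const[OF assms(2)]] by simp

context finite_dimensional_vector_space
begin

lemma sum_Basis: "(\<Sum>b\<in>Basis. scale (representation Basis e b) b) = e"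
  by (rule sum_representation_eq[OF independent_Basis _ finite_Basis order_refl]) (simp add:
    span_Basis)

lemma linear_representation: "Vector_Spaces.linear scale (*) (\<lambda>e. representation Basis e b)"
proof -
  have "vector_space ((*) :: 'a \<Rightarrow> 'a \<Rightarrow> 'a)" by unfold_locales (auto simp: algebra_simps)
  then show ?thesis
    by (intro linearI_vs vector_space_axioms) (auto simp: representation_add representation_scale
      independent_Basis span_Basis)
qed

end

section \<open>Inverses of regular families of endomorphisms\<close>

lemma reg_det:
  fixes A :: "complex ^ 'n \<Rightarrow> complex mat"
  assumes U: "zopen U" and A: "\<And>v. A v \<in> carrier_mat n n"
    and r: "\<And>i j. i < n \<Longrightarrow> j < n \<Longrightarrow> reg 0 U (\<lambda>v. A v $$ (i, j))"
  shows "reg 0 U (\<lambda>v. Determinant.det (A v))"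
proof -
  have "reg 0 U (\<lambda>v. \<Sum>p | p permutes {0..<n}. signof p * (\<Prod>i = 0..<n. A v $$ (i, p i)))"
  proof (intro reg_sum[OF U] reg_cmult[OF U] reg_prod[OF U])
    fix p i assume "p \<in> {p. p permutes {0..<n}}" "i \<in> {0..<n}"
    then have "i < n" "p i < n" using permutes_in_image[of p "{0..<n}" i] by auto
    then show "reg 0 U (\<lambda>v. A v $$ (i, p i))" by (rule r)
  qed
  then show ?thesis unfolding det_def'[OF A] .
qed

lemma reg_adj_mat:
  fixes A :: "complex ^ 'n \<Rightarrow> complex mat"
  assumes U: "zopen U" and A: "\<And>v. A v \<in> carrier_mat n n"
    and r: "\<And>i j. i < n \<Longrightarrow> j < n \<Longrightarrow> reg 0 U (\<lambda>v. A v $$ (i, j))"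
    and ij: "i < n" "j < n"
  shows "reg 0 U (\<lambda>v. adj_mat (A v) $$ (i, j))"
proof -
  have dims: "dim_row (A v) = n" "dim_col (A v) = n" for v using A[of v] by auto
  have "reg 0 U (\<lambda>v. Determinant.det (mat_delete (A v) j i))"
  proof (rule reg_det[OF U])
    show "mat_delete (A v) j i \<in> carrier_mat (n - 1) (n - 1)" for v by (rule mat_delete_carrier[OF
      A])
    fix k l assume "k < n - 1" "l < n - 1"
    then show "reg 0 U (\<lambda>v. mat_delete (A v) j i $$ (k, l))"
      by (simp add: mat_delete_def dims r)
  qed
  then show ?thesis using ij by (simp add: adj_mat_def dims cofactor_def reg_cmult[OF U])
qed

locale complex_vector_space = finite_dimensional_vector_space sc Basis
  for sc :: "complex \<Rightarrow> 'e::ab_group_add \<Rightarrow> 'e" and Basis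
begin

text \<open>A finite sum of tensors is regular under every functional. Conversely, the coordinates
  in a basis are functionals, so the basis expansion of a regular function is such a sum.\<close>

lemma tensor_twist_carrier_iff:
  assumes U: "zopen U"
  shows "s \<in> carrier (sects (tensor_twist sc d) U) \<longleftrightarrow> s \<in> extensional (\<Union>U) \<and> vreg sc d U s"
proof
  assume "s \<in> carrier (sects (tensor_twist sc d) U)"
  then obtain m :: nat and f b where s: "s = (\<lambda>v\<in>\<Union>U. \<Sum>k<m. sc (f k v) (b k))"
    and f: "\<forall>k<m. f k \<in> twist_sections d U" by (auto simp: tensor_twist_def)
  have "vreg sc d U (\<lambda>v. \<Sum>k<m. sc (f k v) (b k))"
    using f by (intro vreg_sum[OF U] vreg_scale_const[OF _ U]) (auto simp: twist_sections_iff)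
  then show "s \<in> extensional (\<Union>U) \<and> vreg sc d U s" using s by simp
next
  assume s: "s \<in> extensional (\<Union>U) \<and> vreg sc d U s"
  obtain b where b: "bij_betw b {0..<card Basis} Basis" using ex_bij_betw_nat_finite[OF
    finite_Basis] by blast
  let ?f = "\<lambda>k. \<lambda>v\<in>\<Union>U. representation Basis (s v) (b k)"
  have "(\<Sum>k<card Basis. sc (?f k v) (b k)) = s v" if "v \<in> \<Union>U" for v
    using that sum.reindex_bij_betw[OF b, of "\<lambda>b. sc (representation Basis (s v) b) b"]
    by (simp add: sum_Basis atLeast0LessThan)
  then have "s = (\<lambda>v\<in>\<Union>U. \<Sum>k<card Basis. sc (?f k v) (b k))"
    using s by (intro extensionalityI[of s "\<Union>U"]) auto
  moreover have "\<forall>k<card Basis. ?f k \<in> twist_sections d U"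
    using vregD[OF _ linear_representation, of d U s] s by (auto simp: twist_sections_iff)
  ultimately have "s \<in> {(\<lambda>v\<in>\<Union>U. \<Sum>k<m. sc (f k v) (b k)) | (m::nat) f b.
      \<forall>k<m. f k \<in> twist_sections d U}"
    by (intro CollectI exI[of _ "card Basis"] exI[of _ ?f] exI[of _ b] conjI)
  then show "s \<in> carrier (sects (tensor_twist sc d) U)" by (simp add: tensor_twist_def)
qed

text \<open>Expanding \<open>s v\<close> in the constant basis leaves products of a coordinate of
  degree \<open>e\<close> with some \<open>T v b\<close> of degree \<open>d\<close>.\<close>

lemma oreg_apply:
  assumes U: "zopen U" and T: "oreg sc sF d U T" and s: "vreg sc e U s"
  shows "vreg sF (d + e) U (\<lambda>v. T v (s v))"
proof -
  have lin: "Vector_Spaces.linear sc sF (T v)" for v using T by (simp add: oreg_def)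
  have "vreg sF (e + d) U (\<lambda>v. \<Sum>b\<in>Basis. sF (representation Basis (s v) b) (T v b))"
    using T by (intro vreg_sum[OF U] vreg_scale vregD[OF s linear_representation]) (simp add:
      oreg_def)
  moreover have "(\<Sum>b\<in>Basis. sF (representation Basis (s v) b) (T v b)) = T v (s v)" for v
  proof -
    have "(\<Sum>b\<in>Basis. sF (representation Basis (s v) b) (T v b)) = T v (\<Sum>b\<in>Basis. sc (representation
      Basis (s v) b) b)"
      by (simp add: linear_simps[OF lin])
    then show ?thesis by (simp add: sum_Basis)
  qed
  ultimately show ?thesis by (simp add: add.commute)
qed

lemma oreg_compose:
  assumes U: "zopen U" and T: "oreg sc sF d U T" and S: "oreg sE sc e U S"
  shows "oreg sE sF (d + e) U (\<lambda>v x. T v (S v x))"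
  unfolding oreg_def
proof (intro conjI allI)
  show "Vector_Spaces.linear sE sF (\<lambda>x. T v (S v x))" for v
    by (rule linear_compose_vs[of sE sc "S v" sF "T v"]) (use T S in \<open>simp_all add: oreg_def\<close>)
  show "vreg sF (d + e) U (\<lambda>v. T v (S v x))" for x
    by (rule oreg_apply[OF U T, of e "\<lambda>v. S v x"]) (use S in \<open>simp add: oreg_def\<close>)
qed

text \<open>In a basis the family is a matrix of regular functions. Its determinant is regular and
  nonzero at \<open>v0\<close>, hence nonzero near \<open>P\<close>, and there Cramer's formula
  gives a regular inverse.\<close>

theorem oreg_inverse:
  assumes U: "zopen U" and T: "oreg sc sc 0 U T" and P: "P \<in> U" "v0 \<in> P"
    and inj: "\<And>e. T v0 e = 0 \<Longrightarrow> e = 0"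
  obtains W S where "zopen W" "P \<in> W" "W \<subseteq> U" "oreg sc sc 0 W S"
    "\<forall>v\<in>\<Union>W. \<forall>e. T v (S v e) = e \<and> S v (T v e) = e"
proof -
  have lin: "Vector_Spaces.linear sc sc (T v)" for v using T by (simp add: oreg_def)
  define n where "n = card Basis"
  obtain b where b: "bij_betw b {0..<n} Basis" using ex_bij_betw_nat_finite[OF finite_Basis]
    by (auto simp: n_def)
  define co where "co i e = representation Basis e (b i)" for i e
  have co_lin: "functional sc (co i)" for i unfolding co_def by (rule linear_representation)
  have sum_co: "(\<Sum>i = 0..<n. sc (co i e) (b i)) = e" for e
    using sum.reindex_bij_betw[OF b, of "\<lambda>b. sc (representation Basis e b) b"]
      by (simp add: sum_Basis co_def)
  have co_b: "co i (b j) = (if i = j then 1 else 0)" if "i < n" "j < n" for i j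
  proof -
    have "b j \<in> Basis" using bij_betwE[OF b] that by simp
    moreover have "b i = b j \<longleftrightarrow> i = j"
      using bij_betw_imp_inj_on[OF b] that by (auto dest: inj_onD)
    ultimately show ?thesis by (auto simp: co_def representation_basis[OF independent_Basis])
  qed
  have co_sum: "co i (\<Sum>j = 0..<n. sc (x j) (b j)) = x i" if "i < n" for i x
    using that by (simp add: linear_simps[OF co_lin] co_b if_distrib[of "\<lambda>c. _ * c"] sum.delta'
      cong: if_cong)
  define A where "A v = mat n n (\<lambda>(i, j). co i (T v (b j)))" for v
  have A: "A v \<in> carrier_mat n n" for v by (simp add: A_def)
  have Areg: "reg 0 U (\<lambda>v. A v $$ (i, j))" if "i < n" "j < n" for i j
  proof -
    have "vreg sc 0 U (\<lambda>v. T v (b j))" using T by (simp add: oreg_def)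
    from vregD[OF this co_lin] that show ?thesis by (simp add: A_def)
  qed
  have Tsum: "T v (\<Sum>j = 0..<n. sc (x j) (b j)) = (\<Sum>i = 0..<n. sc (\<Sum>j = 0..<n. A v $$ (i,
    j) * x j) (b i))" for v x
  proof -
    have "co i (T v (\<Sum>j = 0..<n. sc (x j) (b j))) = (\<Sum>j = 0..<n. A v $$ (i, j) * x j)" if "i < n"
      for i
      using that by (simp add: linear_simps[OF lin] linear_simps[OF co_lin] A_def mult.commute)
    then have "(\<Sum>i = 0..<n. sc (co i (T v (\<Sum>j = 0..<n. sc (x j) (b j)))) (b i)) =
        (\<Sum>i = 0..<n. sc (\<Sum>j = 0..<n. A v $$ (i, j) * x j) (b i))" by simp
    then show ?thesis by (simp only: sum_co)
  qed
  \<comment> \<open>A nonzero kernel vector of the matrix at \<open>v0\<close> is the coordinate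
    vector of a nonzero element killed by \<open>T v0\<close>.\<close>
  have det0: "Determinant.det (A v0) \<noteq> 0"
  proof
    assume "Determinant.det (A v0) = 0"
    then obtain w where w: "w \<in> carrier_vec n" "w \<noteq> 0\<^sub>v n" "A v0 *\<^sub>v w = 0\<^sub>v n"
      using det_0_iff_vec_prod_zero[OF A] by blast
    have "(\<Sum>j = 0..<n. A v0 $$ (i, j) * vec_index w j) = 0" if "i < n" for i
    proof -
      have "vec_index (A v0 *\<^sub>v w) i = (\<Sum>j = 0..<n. A v0 $$ (i, j) * vec_index w j)"
        using that w(1) A[of v0] by (simp add: scalar_prod_def)
      then show ?thesis using that w(3) by simp
    qed
    then have "T v0 (\<Sum>j = 0..<n. sc (vec_index w j) (b j)) = 0" by (simp add: Tsum)
    then have "(\<Sum>j = 0..<n. sc (vec_index w j) (b j)) = 0" by (rule inj)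
    then have "vec_index w i = 0" if "i < n" for i using co_sum[OF that, of "vec_index w"]
      linear_simps(3)[OF co_lin] by simp
    then have "w = 0\<^sub>v n" using w(1) by (intro eq_vecI) auto
    with w(2) show False by simp
  qed
  have dreg: "reg 0 U (\<lambda>v. Determinant.det (A v))" by (rule reg_det[OF U A Areg])
  obtain W where W: "zopen W" "P \<in> W" "W \<subseteq> U" "\<forall>v\<in>\<Union>W. Determinant.det (A v) \<noteq> 0"
    by (rule reg_nonzero_nbhd[OF U dreg P det0])
  \<comment> \<open>The adjugate divided by the determinant, written in coordinates.\<close>
  define S where "S v e = (\<Sum>i = 0..<n. sc (\<Sum>j = 0..<n. adj_mat (A v) $$ (i,
    j) * inverse (Determinant.det (A v)) * co j e) (b i))" for v e
  have "oreg sc sc 0 W S" unfolding oreg_def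
  proof (intro conjI allI)
    show "Vector_Spaces.linear sc sc (S v)" for v
      unfolding S_def by (intro linearI_vs vector_space_axioms)
        (simp_all add: linear_simps[OF co_lin] scale_left_distrib distrib_left sum.distrib
          scale_sum_right sum_distrib_left mult.left_commute)
    have inv: "reg 0 W (\<lambda>v. inverse (Determinant.det (A v)))"
      using reg_inverse[OF reg_mono[OF dreg W(1,3)]] W(4) by simp
    have "reg 0 W (\<lambda>v. adj_mat (A v) $$ (i, j) * inverse (Determinant.det (A v)) * co j e)"
      if "i < n" "j < n" for i j e
      using reg_mult0[OF reg_mult0[OF reg_mono[OF reg_adj_mat[OF U A Areg that] W(1,3)] inv]
        reg_const[OF W(1)]]
      by simp
    then show "vreg sc 0 W (\<lambda>v. S v e)" for e
      unfolding S_def by (intro vreg_sum[OF W(1)] vreg_scale_const[OF _ W(1)] reg_sum[OF W(1)]) auto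
  qed
  moreover have "T v (S v e) = e \<and> S v (T v e) = e" if v: "v \<in> \<Union>W" for v e
  proof -
    have d: "Determinant.det (A v) \<noteq> 0" using W(4) v by blast
    have TS: "T v (S v e) = e" for e
    proof -
      have "(\<Sum>i = 0..<n. A v $$ (l, i) * (\<Sum>j = 0..<n. adj_mat (A v) $$ (i,
        j) * inverse (Determinant.det (A v)) * co j e)) = co l e"
        if l: "l < n" for l
      proof -
        have "(\<Sum>i = 0..<n. A v $$ (l, i) * adj_mat (A v) $$ (i, j)) = (if l = j then Determinant.det
          (A v) else 0)"
          if j: "j < n" for j
        proof -
          have "(A v * adj_mat (A v)) $$ (l, j) = (Determinant.det (A v) \<cdot>\<^sub>m 1\<^sub>m n) $$ (l, j)"
            using adj_mat(2)[OF A[of v]] by simp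
          then show ?thesis using l j A[of v] adj_mat(1)[OF A[of v]] by (simp add: scalar_prod_def)
        qed
        then have "(\<Sum>j = 0..<n. (\<Sum>i = 0..<n. A v $$ (l, i) * adj_mat (A v) $$ (i, j)) * (inverse
          (Determinant.det (A v)) * co j e)) =
            (\<Sum>j = 0..<n. if l = j then co j e else 0)"
          using d by (intro sum.cong) auto
        also have "\<dots> = co l e" using l by simp
        finally show ?thesis
          by (simp add: sum_distrib_left sum_distrib_right mult.assoc) (subst sum.swap, simp)
      qed
      then show ?thesis unfolding S_def Tsum by (simp add: sum_co)
    qed
    \<comment> \<open>Only the right inverse is computed. In finite dimension the surjective map
      \<open>T v\<close> is injective, so the same \<open>S v\<close> is a left inverse.\<close>
    then have "surj (T v)" by (metis surjI)
    then have "Fun.inj (T v)" by (rule linear_surj_imp_inj[OF lin])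
    then show ?thesis using TS by (metis injD)
  qed
  ultimately show thesis using that[OF W(1-3)] by blast
qed

end

lemma oreg_const: "zopen U \<Longrightarrow> Vector_Spaces.linear sE sF T \<Longrightarrow> oreg sE sF 0 U (\<lambda>v. T)"
  by (simp add: oreg_def vreg_const)

lemma linear_add_vs:
  assumes "Vector_Spaces.linear sE sF S" "Vector_Spaces.linear sE sF T"
  shows "Vector_Spaces.linear sE sF (\<lambda>x. S x + T x)"
proof -
  interpret S: Vector_Spaces.linear sE sF S by fact
  show ?thesis
    by (intro linearI_vs S.vs1.vector_space_axioms S.vs2.vector_space_axioms)
      (simp_all add: linear_simps[OF assms(1)] linear_simps[OF assms(2)] S.vs2.scale_right_distrib
        algebra_simps)
qed

lemma linear_scale_vs:
  assumes "Vector_Spaces.linear sE sF S"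
  shows "Vector_Spaces.linear sE sF (\<lambda>x. sF c (S x))"
proof -
  interpret S: Vector_Spaces.linear sE sF S by fact
  show ?thesis
    by (intro linearI_vs S.vs1.vector_space_axioms S.vs2.vector_space_axioms)
      (simp_all add: linear_simps[OF assms(1)] S.vs2.scale_right_distrib S.vs2.scale_left_commute)
qed

lemma oreg_add: "oreg sE sF d U S \<Longrightarrow> oreg sE sF d U T \<Longrightarrow> oreg sE sF d U (\<lambda>v x. S v x + T v x)"
  by (simp add: oreg_def vreg_add linear_add_vs)

lemma oreg_scale: "reg d U f \<Longrightarrow> oreg sE sF e U T \<Longrightarrow> oreg sE sF (d + e) U (\<lambda>v x. sF (f v) (T v x))"
  by (auto simp: oreg_def intro: vreg_scale linear_scale_vs)

lemma oreg_uminus: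
  assumes "zopen U" "oreg sE sF d U T"
  shows "oreg sE sF d U (\<lambda>v x. - T v x)"
proof -
  have "Vector_Spaces.linear sE sF (\<lambda>x. - T v x)" for v
  proof -
    have l: "Vector_Spaces.linear sE sF (T v)" using assms(2) by (simp add: oreg_def)
    then interpret T: Vector_Spaces.linear sE sF "T v" .
    show ?thesis by (intro linearI_vs T.vs1.vector_space_axioms T.vs2.vector_space_axioms)
      (simp_all add: linear_simps[OF l] T.vs2.scale_minus_right)
  qed
  then show ?thesis using assms by (simp add: oreg_def vreg_uminus)
qed

lemma oreg_diff: "zopen U \<Longrightarrow> oreg sE sF d U S \<Longrightarrow> oreg sE sF d U T \<Longrightarrow> oreg sE sF d U (\<lambda>v x. S v x - T v
  x)"
  using oreg_add[OF _ oreg_uminus, of sE sF d U S T] by simp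

section \<open>Eigenvalues and joint eigenvectors\<close>

context complex_vector_space
begin

text \<open>The Horner scheme for \<open>p(B) v\<close>; the vector is kept as an argument, so that
  no algebra of operators has to be set up.\<close>

definition poly_op :: "('e \<Rightarrow> 'e) \<Rightarrow> complex poly \<Rightarrow> 'e \<Rightarrow> 'e" where
  "poly_op B p v = fold_coeffs (\<lambda>a u. sc a v + B u) p 0"

context
  fixes B assumes B: "Vector_Spaces.linear sc sc B"
begin

lemma poly_op_0 [simp]: "poly_op B 0 v = 0"
  by (simp add: poly_op_def)

lemma poly_op_pCons [simp]: "poly_op B (pCons a p) v = sc a v + B (poly_op B p v)"
  by (cases "p = 0 \<and> a = 0") (auto simp: poly_op_def linear_simps[OF B])

lemma poly_op_add: "poly_op B (p + q) v = poly_op B p v + poly_op B q v"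
  by (induction p q rule: poly_induct2) (simp_all add: linear_simps[OF B] scale_left_distrib
    algebra_simps)

lemma poly_op_smult: "poly_op B (Polynomial.smult c p) v = sc c (poly_op B p v)"
  by (induction p) (simp_all add: linear_simps[OF B] scale_right_distrib)

lemma poly_op_mult: "poly_op B (p * q) v = poly_op B p (poly_op B q v)"
  by (induction p) (simp_all add: poly_op_add poly_op_smult)

lemma poly_op_sum: "poly_op B (sum f A) v = (\<Sum>a\<in>A. poly_op B (f a) v)"
  by (induction A rule: infinite_finite_induct) (simp_all add: poly_op_add)

lemma poly_op_monom: "poly_op B (monom c n) v = sc c ((B ^^ n) v)"
  by (induction n) (simp_all add: monom_0 monom_Suc linear_simps[OF B])

lemma poly_op_linear: "Vector_Spaces.linear sc sc (poly_op B p)"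
proof (intro linearI_vs vector_space_axioms)
  show "poly_op B p (x + y) = poly_op B p x + poly_op B p y" for x y
    by (induction p) (simp_all add: linear_simps[OF B] scale_right_distrib algebra_simps)
  show "poly_op B p (sc c x) = sc c (poly_op B p x)" for c x
    by (induction p) (simp_all add: linear_simps[OF B] scale_right_distrib mult.commute)
qed

lemma poly_op_eigen: "B u = sc l u \<Longrightarrow> poly_op B p u = sc (poly p l) u"
  by (induction p) (simp_all add: linear_simps[OF B] scale_left_distrib mult.commute)

lemma poly_op_mem:
  assumes "subspace S" "B ` S \<subseteq> S" "v \<in> S"
  shows "poly_op B p v \<in> S"
proof (induction p)
  case (pCons a p)
  then show ?case using assms by (auto intro!: subspace_add subspace_scale)
qed (use assms in \<open>simp add: subspace_0\<close>)

text \<open>The powers \<open>(B ^^ i) v\<close> with \<open>i\<close> up to the dimension are one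
  too many to be independent. If two of them coincide, a difference of monomials annihilates
  \<open>v\<close>; otherwise they form a dependent set and the dependence supplies the
  coefficients.\<close>

lemma ex_annihilator_vector: "\<exists>p. p \<noteq> 0 \<and> poly_op B p v = 0"
proof (cases "inj_on (\<lambda>i. (B ^^ i) v) {..dim UNIV}")
  case False
  then obtain i j where ij: "i \<noteq> j" "(B ^^ i) v = (B ^^ j) v" by (auto simp: inj_on_def)
  let ?p = "monom 1 i + monom (-1) j :: complex poly"
  have "coeff ?p i = 1" using ij by simp
  then have "?p \<noteq> 0" by (metis coeff_0 zero_neq_one)
  moreover have "poly_op B ?p v = 0" using ij by (simp add: poly_op_add poly_op_monom)
  ultimately show ?thesis by blast
next
  case True
  let ?f = "\<lambda>i. (B ^^ i) v" and ?I = "{..dim UNIV}"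
  have "dependent (?f ` ?I)"
    using independent_bound_general[of "?f ` ?I"] dim_subset_UNIV[of "?f ` ?I"] card_image[OF True]
    by (fastforce simp: dim_UNIV dimension_def)
  then obtain u w where u: "w \<in> ?f ` ?I" "u w \<noteq> 0" "(\<Sum>x\<in>?f ` ?I. sc (u x) x) = 0"
    by (auto simp: dependent_finite)
  let ?p = "\<Sum>i\<in>?I. monom (u (?f i)) i"
  obtain i where i: "i \<in> ?I" "w = ?f i" using u by blast
  have "coeff ?p i = (\<Sum>j\<in>?I. if j = i then u (?f i) else 0)"
    unfolding coeff_sum by (intro sum.cong) auto
  also have "\<dots> = u w" using i by simp
  finally have "?p \<noteq> 0" using u by (metis coeff_0)
  moreover have "poly_op B ?p v = (\<Sum>i\<in>?I. sc (u (?f i)) (?f i))"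
    by (simp add: poly_op_sum poly_op_monom)
  moreover have "\<dots> = 0" using u(3) unfolding sum.reindex[OF True] by simp
  ultimately show ?thesis by metis
qed

text \<open>Polynomials in \<open>B\<close> commute, so the product of annihilators of the basis
  vectors kills each basis vector.\<close>

lemma ex_annihilator: "\<exists>p. p \<noteq> 0 \<and> (\<forall>v. poly_op B p v = 0)"
proof -
  obtain p where p: "\<And>b. p b \<noteq> 0 \<and> poly_op B (p b) b = 0" using ex_annihilator_vector by metis
  let ?p = "\<Prod>b\<in>Basis. p b"
  have "poly_op B ?p b = 0" if "b \<in> Basis" for b
  proof -
    have "?p = (\<Prod>b\<in>Basis - {b}. p b) * p b" using that finite_Basis
      by (simp add: prod.remove mult.commute)
    then show ?thesis using p[of b] by (simp add: poly_op_mult linear_simps[OF poly_op_linear])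
  qed
  then have "poly_op B ?p (\<Sum>b\<in>Basis. sc (representation Basis v b) b) = 0" for v
    by (simp add: linear_simps[OF poly_op_linear])
  then have "\<forall>v. poly_op B ?p v = 0" by (simp add: sum_Basis)
  moreover have "?p \<noteq> 0" using p finite_Basis by (simp add: prod_zero_iff)
  ultimately show ?thesis by blast
qed

text \<open>If \<open>B u = l u\<close> then \<open>p(B) u = p(l) u\<close>, so every eigenvalue is
  a root of an annihilating polynomial.\<close>

lemma finite_eigenvalues: "finite {l. \<exists>u. u \<noteq> 0 \<and> B u = sc l u}"
proof -
  obtain p where p: "p \<noteq> 0" "\<forall>v. poly_op B p v = 0" using ex_annihilator by blast
  have "{l. \<exists>u. u \<noteq> 0 \<and> B u = sc l u} \<subseteq> {l. poly p l = 0}"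
    using p(2) poly_op_eigen[of _ _ p] by (auto simp: scale_eq_0_iff)
  then show ?thesis using poly_roots_finite[OF p(1)] finite_subset by blast
qed

text \<open>Induction on the degree of a polynomial annihilating \<open>v\<close>. After splitting
  off a root \<open>l\<close>, either the cofactor still annihilates \<open>v\<close>, or it maps
  \<open>v\<close> to an eigenvector for \<open>l\<close>, which lies in \<open>S\<close> by
  invariance.\<close>

lemma ex_eigenvector:
  assumes S: "subspace S" "B ` S \<subseteq> S" and v: "v \<in> S" "v \<noteq> 0"
  obtains l u where "u \<in> S" "u \<noteq> 0" "B u = sc l u"
proof -
  have "\<exists>l u. u \<in> S \<and> u \<noteq> 0 \<and> B u = sc l u" if "p \<noteq> 0" "poly_op B p v = 0" for p
    using that
  proof (induction "degree p" arbitrary: p rule: less_induct)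
    case less
    show ?case
    proof (cases "degree p = 0")
      case True
      then obtain a where "p = [:a:]" by (rule degree_eq_zeroE)
      then show ?thesis using less.prems v by (simp add: linear_simps[OF B] scale_eq_0_iff)
    next
      case False
      then have "\<not> constant (poly p)" by (simp add: constant_degree)
      then obtain l where "poly p l = 0" using fundamental_theorem_of_algebra by blast
      then obtain q where q: "p = [:-l, 1:] * q" by (auto simp: poly_eq_0_iff_dvd elim: dvdE)
      have q0: "q \<noteq> 0" using q less.prems(1) by auto
      have d: "degree q < degree p"
      proof -
        have "degree ([:-l, 1:] * q) = degree [:-l, 1:] + degree q"
          by (rule degree_mult_eq) (use q0 in auto)
        then show ?thesis using q by simp
      qed
      show ?thesis
      proof (cases "poly_op B q v = 0")
        case True
        with less.hyps[OF d q0] show ?thesis by blast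
      next
        case False
        have "B (poly_op B q v) = sc l (poly_op B q v)"
          using less.prems(2) unfolding q poly_op_mult by (simp add: linear_simps[OF B]
            scale_minus_left)
        then show ?thesis using False poly_op_mem[OF S v(1)] by blast
      qed
    qed
  qed
  then show thesis using that ex_annihilator_vector[of v] by blast
qed

end

text \<open>An eigenspace of \<open>B\<close> inside \<open>S\<close> is preserved by
  \<open>C\<close>, so it contains an eigenvector of \<open>C\<close>. Commutation is asked only on
  \<open>S\<close>, since the ADHM equation provides it only where \<open>j\<close>
  vanishes.\<close>

lemma ex_joint_eigenvector:
  assumes B: "Vector_Spaces.linear sc sc B" and C: "Vector_Spaces.linear sc sc C"
    and S: "subspace S" "B ` S \<subseteq> S" "C ` S \<subseteq> S" and v: "v \<in> S" "v \<noteq> 0"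
    and comm: "\<And>s. s \<in> S \<Longrightarrow> B (C s) = C (B s)"
  obtains l m u where "u \<in> S" "u \<noteq> 0" "B u = sc l u" "C u = sc m u"
proof -
  obtain l u where u: "u \<in> S" "u \<noteq> 0" "B u = sc l u" by (rule ex_eigenvector[OF B S(1,2) v])
  let ?S = "{s \<in> S. B s = sc l s}"
  have "subspace ?S"
    using S(1) by (auto simp: subspace_def linear_simps[OF B] scale_right_distrib mult.commute)
  moreover have "C ` ?S \<subseteq> ?S"
    using S(3) by (auto simp: comm linear_simps[OF C])
  ultimately obtain m w where "w \<in> ?S" "w \<noteq> 0" "C w = sc m w"
    using ex_eigenvector[OF C] u by (metis (mono_tags, lifting) mem_Collect_eq)
  then show thesis using that by blast
qed

end

section \<open>The monad of a complex ADHM datum on fibres\<close>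

lemma complex_vector_space_sum_scale:
  assumes "complex_vector_space sV bV" "complex_vector_space sW bW"
  obtains bM where "complex_vector_space (sum_scale sV sW) bM"
proof -
  interpret V: complex_vector_space sV bV by fact
  interpret W: complex_vector_space sW bW by fact
  interpret VW: finite_dimensional_vector_space_prod sV sW bV bW by unfold_locales
  interpret VVW: finite_dimensional_vector_space_prod sV VW.scale bV VW.Basis_pair by unfold_locales
  have "VVW.scale = sum_scale sV sW"
    by (auto simp: fun_eq_iff sum_scale_def VVW.scale_def VW.scale_def)
  then have "complex_vector_space (sum_scale sV sW) VVW.Basis_pair"
    using VVW.p.finite_dimensional_vector_space_axioms by (simp add: complex_vector_space_def)
  then show thesis by (rule that)
qed

locale adhm_monad = V: complex_vector_space sV bV + W: complex_vector_space sW bW +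
    M: complex_vector_space "sum_scale sV sW" bM
  for sV :: "complex \<Rightarrow> 'v::ab_group_add \<Rightarrow> 'v" and bV
    and sW :: "complex \<Rightarrow> 'w::ab_group_add \<Rightarrow> 'w" and bW and bM +
  fixes D :: "('v, 'w) complex_adhm"
  assumes datum: "complex_adhm_datum sV sW D" and eqs: "complex_adhm_equations D"
begin

abbreviation "sM \<equiv> sum_scale sV sW"
abbreviation "\<alpha> \<equiv> monad_alpha sV sW D"
abbreviation "\<beta> \<equiv> monad_beta sV D"

lemma lin:
  "Vector_Spaces.linear sV sV (B11 D)" "Vector_Spaces.linear sV sV (B12 D)"
  "Vector_Spaces.linear sV sV (B21 D)" "Vector_Spaces.linear sV sV (B22 D)"
  "Vector_Spaces.linear sW sV (i1 D)" "Vector_Spaces.linear sW sV (i2 D)"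
  "Vector_Spaces.linear sV sW (j1 D)" "Vector_Spaces.linear sV sW (j2 D)"
  using datum by (auto simp: complex_adhm_datum_def)

lemmas lin_simps = linear_simps[OF lin(1)] linear_simps[OF lin(2)] linear_simps[OF lin(3)]
  linear_simps[OF lin(4)] linear_simps[OF lin(5)] linear_simps[OF lin(6)]
  linear_simps[OF lin(7)] linear_simps[OF lin(8)]

text \<open>Separates the four coordinates from constant vectors, which makes degree 1 visible for
  \<open>oreg_alpha\<close>.\<close>

lemma alpha_eq: "\<alpha> p a = sM (vec_nth p 1) (a, 0, 0) + sM (vec_nth p 2) (0, a, 0)
    + sM (vec_nth p 3) (B11 D a, B12 D a, j1 D a) + sM (vec_nth p 4) (B21 D a, B22 D a, j2 D a)"
  by (simp add: monad_alpha_def sum_scale_def Let_def algebra_simps)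

lemma beta_eq: "\<beta> p m = sV (vec_nth p 1) (fst (snd m)) + sV (vec_nth p 2) (- fst m)
    + sV (vec_nth p 3) (B11 D (fst (snd m)) - B12 D (fst m) + i1 D (snd (snd m)))
    + sV (vec_nth p 4) (B21 D (fst (snd m)) - B22 D (fst m) + i2 D (snd (snd m)))"
  by (cases m) (simp add: monad_beta_def Let_def V.scale_right_distrib V.scale_right_diff_distrib
      V.scale_minus_right algebra_simps)

lemma linear_alpha: "Vector_Spaces.linear sV sM (\<alpha> p)"
  by (intro linearI_vs V.vector_space_axioms M.vector_space_axioms)
    (simp_all add: monad_alpha_def sum_scale_def Let_def lin_simps V.scale_right_distrib
      W.scale_right_distrib
      mult.commute algebra_simps)

lemma linear_beta: "Vector_Spaces.linear sM sV (\<beta> p)"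
  by (intro linearI_vs V.vector_space_axioms M.vector_space_axioms)
    (auto simp: monad_beta_def sum_scale_def Let_def lin_simps V.scale_right_distrib
      V.scale_right_diff_distrib
      V.scale_minus_right mult.commute algebra_simps)

lemma oreg_alpha: "zopen U \<Longrightarrow> oreg sV sM 1 U \<alpha>"
  unfolding oreg_def
proof (intro conjI allI linear_alpha)
  fix a assume "zopen U"
  then show "vreg sM 1 U (\<lambda>p. \<alpha> p a)"
    unfolding alpha_eq by (intro vreg_add vreg_scale_const reg_coord)
qed

lemma oreg_beta: "zopen U \<Longrightarrow> oreg sM sV 1 U \<beta>"
  unfolding oreg_def
proof (intro conjI allI linear_beta)
  fix m assume "zopen U"
  then show "vreg sV 1 U (\<lambda>p. \<beta> p m)"
    unfolding beta_eq by (intro vreg_add vreg_scale_const reg_coord)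
qed

lemma adhm_at_simps:
  "aB1 (adhm_at sV sW D z w) v = sV z (B11 D v) + sV w (B21 D v)"
  "aB2 (adhm_at sV sW D z w) v = sV z (B12 D v) + sV w (B22 D v)"
  "ai (adhm_at sV sW D z w) u = sV z (i1 D u) + sV w (i2 D u)"
  "aj (adhm_at sV sW D z w) v = sW z (j1 D v) + sW w (j2 D v)"
  by (simp_all add: adhm_at_def)

lemma linear_adhm_at:
  "Vector_Spaces.linear sV sV (aB1 (adhm_at sV sW D z w))"
  "Vector_Spaces.linear sV sV (aB2 (adhm_at sV sW D z w))"
  by (intro linearI_vs V.vector_space_axioms;
      simp add: adhm_at_simps lin_simps V.scale_right_distrib mult.commute algebra_simps)+

text \<open>The left side is a quadratic form in \<open>(z, w)\<close>; the three complex ADHM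
  equations say that its coefficients at \<open>z * z\<close>, \<open>w * w\<close> and
  \<open>z * w\<close> vanish.\<close>

lemma adhm_at_equation:
  "aB1 (adhm_at sV sW D z w) (aB2 (adhm_at sV sW D z w) v) - aB2 (adhm_at sV sW D z w) (aB1 (adhm_at
    sV sW D z w) v)
    + ai (adhm_at sV sW D z w) (aj (adhm_at sV sW D z w) v) = 0" (is "?L = 0")
proof -
  let ?e1 = "B11 D (B12 D v) - B12 D (B11 D v) + i1 D (j1 D v)"
  let ?e2 = "B21 D (B22 D v) - B22 D (B21 D v) + i2 D (j2 D v)"
  let ?e3 = "(B11 D (B22 D v) - B22 D (B11 D v)) + (B21 D (B12 D v) - B12 D (B21 D v))
          + i1 D (j2 D v) + i2 D (j1 D v)"
  have "?L = sV (z * z) ?e1 + sV (w * w) ?e2 + sV (z * w) ?e3"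
    by (simp add: adhm_at_simps lin_simps V.scale_right_distrib V.scale_right_diff_distrib
      mult.commute algebra_simps)
  moreover have "?e1 = 0" "?e2 = 0" "?e3 = 0" using eqs by (auto simp: complex_adhm_equations_def)
  ultimately show ?thesis by (simp only: V.scale_zero_right add_0_left)
qed

lemma alpha_adhm_at: "\<alpha> p a = (aB1 (adhm_at sV sW D (vec_nth p 3) (vec_nth p 4)) a + sV (vec_nth p
  1) a,
    aB2 (adhm_at sV sW D (vec_nth p 3) (vec_nth p 4)) a + sV (vec_nth p 2) a,
    aj (adhm_at sV sW D (vec_nth p 3) (vec_nth p 4)) a)"
  by (simp add: monad_alpha_def adhm_at_simps Let_def)

lemma beta_adhm_at: "\<beta> p (a, b, u) = aB1 (adhm_at sV sW D (vec_nth p 3) (vec_nth p 4)) b + sV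
  (vec_nth p 1) b
    - (aB2 (adhm_at sV sW D (vec_nth p 3) (vec_nth p 4)) a + sV (vec_nth p 2) a)
    + ai (adhm_at sV sW D (vec_nth p 3) (vec_nth p 4)) u"
  by (simp add: monad_beta_def adhm_at_simps Let_def algebra_simps)

text \<open>The scalars \<open>x\<close> and \<open>y\<close> commute with both operators and
  cancel, which leaves the ADHM equation of the datum at \<open>[z:w]\<close>.\<close>

lemma beta_alpha: "\<beta> p (\<alpha> p a) = 0"
proof -
  let ?A = "adhm_at sV sW D (vec_nth p 3) (vec_nth p 4)"
  let ?x = "vec_nth p 1" and ?y = "vec_nth p 2"
  have "\<beta> p (\<alpha> p a) = aB1 ?A (aB2 ?A a) - aB2 ?A (aB1 ?A a) + ai ?A (aj ?A a)"
    unfolding alpha_adhm_at beta_adhm_at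
    by (simp add: linear_simps[OF linear_adhm_at(1)] linear_simps[OF linear_adhm_at(2)]
       V.scale_right_distrib mult.commute algebra_simps)
  then show ?thesis by (simp add: adhm_at_equation)
qed

text \<open>On the line \<open>z = w = 0\<close> stability gives no information, but there \<beta>
  is \<open>(-y, x, 0)\<close> with \<open>x\<close> or \<open>y\<close> nonzero.\<close>

lemma surj_beta:
  assumes st: "C_stable sV sW D" and p: "p \<noteq> 0"
  shows "surj (\<beta> p)"
proof -
  let ?x = "vec_nth p 1" and ?y = "vec_nth p 2" and ?z = "vec_nth p 3" and ?w = "vec_nth p 4"
  let ?A = "adhm_at sV sW D ?z ?w"
  \<comment> \<open>On the first two summands \<beta> is \<open>-(B2 + y)\<close> and
    \<open>B1 + x\<close>, so \<open>B1\<close> and \<open>B2\<close> agree with values of \<beta>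
    up to sign and a scalar multiple; this makes the range invariant.\<close>
  have b1: "aB1 ?A b = \<beta> p (0, b, 0) - sV ?x b" for b
    unfolding beta_adhm_at by (simp add: linear_simps[OF linear_adhm_at(2)] adhm_at_simps(3)
      lin_simps)
  have b2: "aB2 ?A b = - \<beta> p (b, 0, 0) - sV ?y b" for b
    unfolding beta_adhm_at by (simp add: linear_simps[OF linear_adhm_at(1)] adhm_at_simps(3)
      lin_simps)
  have bi: "ai ?A u = \<beta> p (0, 0, u)" for u
    unfolding beta_adhm_at by (simp add: linear_simps[OF linear_adhm_at(1)] linear_simps[OF
      linear_adhm_at(2)])
  have sub: "V.subspace (range (\<beta> p))" unfolding V.subspace_def
    using linear_simps(1,2,3)[OF linear_beta, symmetric] by blast
  show ?thesis
  proof (cases "(?z, ?w) = (0, 0)")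
    case False
    then have "stable sV ?A" using st unfolding C_stable_def by blast
    moreover have "aB1 ?A ` range (\<beta> p) \<subseteq> range (\<beta> p)"
      unfolding b1 using sub by (auto intro!: V.subspace_diff V.subspace_scale)
    moreover have "aB2 ?A ` range (\<beta> p) \<subseteq> range (\<beta> p)"
      unfolding b2 using sub by (auto intro!: V.subspace_diff V.subspace_scale V.subspace_neg)
    moreover have "range (ai ?A) \<subseteq> range (\<beta> p)" by (auto simp: bi)
    ultimately show ?thesis using sub unfolding stable_def by blast
  next
    case True
    then have zw: "?z = 0" "?w = 0" by auto
    have "?x \<noteq> 0 \<or> ?y \<noteq> 0" using p zw by (auto simp: Finite_Cartesian_Product.vec_eq_iff forall_4)
    then show ?thesis
    proof
      assume x: "?x \<noteq> 0"
      have "\<beta> p (0, sV (1 / ?x) e, 0) = e" for e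
        unfolding beta_adhm_at using zw x by (simp add: adhm_at_simps)
      then show ?thesis by (rule surjI)
    next
      assume y: "?y \<noteq> 0"
      have "\<beta> p (sV (- 1 / ?y) e, 0, 0) = e" for e
        unfolding beta_adhm_at using zw y by (simp add: adhm_at_simps V.scale_minus_left)
      then show ?thesis by (rule surjI)
    qed
  qed
qed

text \<open>On the kernel both operators act as the scalars \<open>-x\<close> and \<open>-y\<close>,
  so it is invariant. On the line \<open>z = w = 0\<close> the map is \<open>(x, y, 0)\<close>,
  injective by itself.\<close>

lemma inj_alpha_if_costable:
  assumes co: "\<And>z w. (z, w) \<noteq> (0, 0) \<Longrightarrow> costable sV (adhm_at sV sW D z w)" and p: "p \<noteq> 0"
    and a: "\<alpha> p a = 0"
  shows "a = 0"
proof -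
  let ?x = "vec_nth p 1" and ?y = "vec_nth p 2" and ?z = "vec_nth p 3" and ?w = "vec_nth p 4"
  let ?A = "adhm_at sV sW D ?z ?w"
  have ker: "\<alpha> p s = 0 \<longleftrightarrow> aB1 ?A s = - sV ?x s \<and> aB2 ?A s = - sV ?y s \<and> aj ?A s = 0" for s
    unfolding alpha_adhm_at by (simp add: zero_prod_def add_eq_0_iff2)
  show ?thesis
  proof (cases "(?z, ?w) = (0, 0)")
    case False
    let ?S = "{s. \<alpha> p s = 0}"
    have sub: "V.subspace ?S" by (simp add: V.subspace_def linear_simps[OF linear_alpha]
      M.scale_zero_right)
    moreover have "aB1 ?A ` ?S \<subseteq> ?S" "aB2 ?A ` ?S \<subseteq> ?S"
    proof -
      have "aB1 ?A s \<in> ?S \<and> aB2 ?A s \<in> ?S" if "s \<in> ?S" for s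
      proof -
        have "aB1 ?A s = sV (- ?x) s" "aB2 ?A s = sV (- ?y) s" using that ker[of s]
          by (auto simp: V.scale_minus_left)
        then show ?thesis
          using V.subspace_scale[OF sub that, of "- ?x"] V.subspace_scale[OF sub that, of "- ?y"]
            by (simp only: simp_thms)
      qed
      then show "aB1 ?A ` ?S \<subseteq> ?S" "aB2 ?A ` ?S \<subseteq> ?S" by blast+
    qed
    moreover have "?S \<subseteq> {v. aj ?A v = 0}" using ker by blast
    moreover have "costable sV ?A" using False co by blast
    ultimately have "?S = {0}" unfolding costable_def by blast
    then show ?thesis using a by blast
  next
    case True
    then have zw: "?z = 0" "?w = 0" by auto
    then have "?x \<noteq> 0 \<or> ?y \<noteq> 0" using p by (auto simp: Finite_Cartesian_Product.vec_eq_iff forall_4)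
    moreover have "sV ?x a = 0" "sV ?y a = 0" using a zw unfolding ker
      by (simp_all add: adhm_at_simps)
    ultimately show ?thesis by (auto simp: V.scale_eq_0_iff)
  qed
qed

lemma costable_if_inj_alpha:
  assumes inj: "\<And>p a. p \<noteq> 0 \<Longrightarrow> \<alpha> p a = 0 \<Longrightarrow> a = 0" and zw: "(z, w) \<noteq> (0, 0)"
  shows "costable sV (adhm_at sV sW D z w)"
  unfolding costable_def
proof (rule notI, elim exE conjE)
  fix S
  let ?A = "adhm_at sV sW D z w"
  assume S: "V.subspace S" "S \<noteq> {0}" "aB1 ?A ` S \<subseteq> S" "aB2 ?A ` S \<subseteq> S" "S \<subseteq> {v. aj ?A v = 0}"
  then obtain v where v: "v \<in> S" "v \<noteq> 0" using V.subspace_0 by blast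
  \<comment> \<open>On \<open>S\<close> the map \<open>j\<close> vanishes, so the term
    \<open>i j\<close> drops out of the ADHM equation and the commutator is zero.\<close>
  have comm: "aB1 ?A (aB2 ?A s) = aB2 ?A (aB1 ?A s)" if "s \<in> S" for s
    using adhm_at_equation[of z w s] that S(5) by (auto simp: adhm_at_simps(3) lin_simps subset_iff)
  obtain l m u where u: "u \<in> S" "u \<noteq> 0" "aB1 ?A u = sV l u" "aB2 ?A u = sV m u"
    by (rule V.ex_joint_eigenvector[OF linear_adhm_at S(1,3,4) v comm])
  \<comment> \<open>The first two coordinates are the negatives of the joint eigenvalues, which puts
    \<open>u\<close> in the kernels of \<open>B1 + x\<close> and \<open>B2 + y\<close>;
    \<open>j u = 0\<close> since \<open>u\<close> lies in \<open>S\<close>.\<close>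
  define p :: "complex ^ 4" where
    "p = vec_lambda (\<lambda>i. if i = 1 then - l else if i = 2 then - m else if i = 3 then z else w)"
  have p: "vec_nth p 1 = - l" "vec_nth p 2 = - m" "vec_nth p 3 = z" "vec_nth p 4 = w"
    by (simp_all add: p_def)
  then have "p \<noteq> 0" using zw by auto
  moreover have "\<alpha> p u = 0"
    using u S(5) by (auto simp: alpha_adhm_at p V.scale_minus_left zero_prod_def)
  ultimately show False using inj u(2) by blast
qed

lemma C_regular_iff:
  assumes "C_stable sV sW D"
  shows "C_regular sV sW D \<longleftrightarrow> (\<forall>p a. p \<noteq> 0 \<longrightarrow> \<alpha> p a = 0 \<longrightarrow> a = 0)"
proof -
  have "C_regular sV sW D \<longleftrightarrow> (\<forall>z w. (z, w) \<noteq> (0, 0) \<longrightarrow> costable sV (adhm_at sV sW D z w))"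
    using assms by (simp add: C_regular_def regular_def C_stable_def)
  then show ?thesis using inj_alpha_if_costable costable_if_inj_alpha by metis
qed

end

section \<open>The kernel and image sheaves of the monad\<close>

context adhm_monad
begin

abbreviation "K \<equiv> kernel_sheaf (tensor_twist sM 0) (tensor_twist sV 1) (sheaf_map \<beta>)"
abbreviation "N \<equiv> image_sheaf zariski (tensor_twist sV (- 1)) (tensor_twist sM 0) (sheaf_map \<alpha>)"

text \<open>Membership in \<open>K\<close> without extensionality, as \<open>reg\<close> is for
  \<open>twist_sections\<close>; \<open>in_im\<close> plays the same part for
  \<open>N\<close>.\<close>

definition in_ker :: "(complex ^ 4) set set \<Rightarrow> (complex ^ 4 \<Rightarrow> 'v \<times> 'v \<times> 'w) \<Rightarrow> bool" where
  "in_ker U s \<longleftrightarrow> vreg sM 0 U s \<and> (\<forall>v\<in>\<Union>U. \<beta> v (s v) = 0)"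

definition image_at :: "(complex ^ 4) set set \<Rightarrow> (complex ^ 4 \<Rightarrow> 'v \<times> 'v \<times> 'w) \<Rightarrow> (complex ^ 4) set \<Rightarrow>
  bool" where
  "image_at U s P \<longleftrightarrow> (\<exists>V t. zopen V \<and> P \<in> V \<and> V \<subseteq> U \<and> vreg sV (- 1) V t \<and>
     (\<forall>v\<in>\<Union>V. s v = \<alpha> v (t v)))"

definition in_im :: "(complex ^ 4) set set \<Rightarrow> (complex ^ 4 \<Rightarrow> 'v \<times> 'v \<times> 'w) \<Rightarrow> bool" where
  "in_im U s \<longleftrightarrow> vreg sM 0 U s \<and> (\<forall>P\<in>U. image_at U s P)"

lemma image_atI:
  assumes "zopen V" "P \<in> V" "V \<subseteq> U" "vreg sV (- 1) V t" "\<forall>v\<in>\<Union>V. s v = \<alpha> v (t v)"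
  shows "image_at U s P"
  unfolding image_at_def by (intro exI[of _ V] exI[of _ t] conjI assms)

lemma K_carrier_iff:
  assumes "zopen U"
  shows "s \<in> sections K U \<longleftrightarrow> s \<in> extensional (\<Union>U) \<and> in_ker U s"
proof -
  have "sheaf_map \<beta> U s = zero (sects (tensor_twist sV 1) U) \<longleftrightarrow> (\<forall>v\<in>\<Union>U. \<beta> v (s v) = 0)"
    unfolding sheaf_map_def tensor_twist_def by (simp add: restrict_eq_restrict_iff)
  then show ?thesis using M.tensor_twist_carrier_iff[OF assms, of s 0]
    by (auto simp: kernel_sheaf_def in_ker_def)
qed

lemma image_locally:
  assumes V: "zopen V"
  shows "restrict s (\<Union>V) \<in> sheaf_map \<alpha> V ` carrier (sects (tensor_twist sV (- 1)) V) \<longleftrightarrow>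
    (\<exists>t. vreg sV (- 1) V t \<and> (\<forall>v\<in>\<Union>V. s v = \<alpha> v (t v)))" (is "?L \<longleftrightarrow> ?R")
proof
  assume ?L
  then obtain t where t: "t \<in> carrier (sects (tensor_twist sV (- 1)) V)" "restrict s (\<Union>V) =
    sheaf_map \<alpha> V t"
    by blast
  then have "\<forall>v\<in>\<Union>V. s v = \<alpha> v (t v)" unfolding sheaf_map_def
    by (simp only: restrict_eq_restrict_iff)
  then show ?R using t(1) V.tensor_twist_carrier_iff[OF V, of t "-1"] by blast
next
  assume ?R
  then obtain t where t: "vreg sV (- 1) V t" "\<forall>v\<in>\<Union>V. s v = \<alpha> v (t v)" by blast
  have "restrict s (\<Union>V) = sheaf_map \<alpha> V (restrict t (\<Union>V))"
    unfolding sheaf_map_def using t(2) by (simp add: restrict_eq_restrict_iff)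
  moreover have "restrict t (\<Union>V) \<in> carrier (sects (tensor_twist sV (- 1)) V)"
    using t(1) V.tensor_twist_carrier_iff[OF V, of "restrict t (\<Union>V)" "-1"] by simp
  ultimately show ?L by blast
qed

lemma N_carrier_iff:
  assumes "zopen U"
  shows "s \<in> sections N U \<longleftrightarrow> s \<in> extensional (\<Union>U) \<and> in_im U s"
proof -
  have "s \<in> sections N U \<longleftrightarrow> s \<in> carrier (sects (tensor_twist sM 0) U) \<and>
    (\<forall>P\<in>U. \<exists>V. zopen V \<and> P \<in> V \<and> V \<subseteq> U \<and>
      restrict s (\<Union>V) \<in> sheaf_map \<alpha> V ` carrier (sects (tensor_twist sV (- 1)) V))"
    by (simp add: image_sheaf_def tensor_twist_def[of sM])
  also have "\<dots> \<longleftrightarrow> s \<in> extensional (\<Union>U) \<and> in_im U s"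
    unfolding in_im_def image_at_def using M.tensor_twist_carrier_iff[OF assms, of s 0]
    by (simp add: image_locally cong: conj_cong)
  finally show ?thesis .
qed

lemma KN_ops:
  "add (sects K U) s t = (\<lambda>v\<in>\<Union>U. s v + t v)"
  "smult (sects K U) f s = (\<lambda>v\<in>\<Union>U. sM (f v) (s v))"
  "zero (sects K U) = (\<lambda>v\<in>\<Union>U. 0)"
  "rstr K U V s = restrict s (\<Union>V)"
  by (simp_all add: kernel_sheaf_def tensor_twist_def)

lemma O_carrier_iff: "f \<in> sections structure_sheaf U \<longleftrightarrow> f \<in> extensional (\<Union>U) \<and> reg 0 U f"
  by (simp add: structure_sheaf_def twist_sections_iff)

lemma O_rstr: "rstr structure_sheaf U V f = restrict f (\<Union>V)"
  by (simp add: structure_sheaf_def)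

lemma in_ker_restrict [simp]: "in_ker U (restrict s (\<Union>U)) \<longleftrightarrow> in_ker U s"
  by (simp add: in_ker_def)

lemma in_im_cong:
  assumes "\<And>v. v \<in> \<Union>U \<Longrightarrow> s v = s' v"
  shows "in_im U s \<longleftrightarrow> in_im U s'"
proof -
  have "(\<forall>v\<in>\<Union>V. s v = \<alpha> v (t v)) \<longleftrightarrow> (\<forall>v\<in>\<Union>V. s' v = \<alpha> v (t v))" if "V \<subseteq> U" for V t
    using assms that by (metis UnionI UnionE subsetD)
  then show ?thesis unfolding in_im_def image_at_def using vreg_cong[of U s s' sM 0, OF assms]
    by (simp cong: conj_cong)
qed

lemma in_im_restrict [simp]: "in_im U (restrict s (\<Union>U)) \<longleftrightarrow> in_im U s"
  by (rule in_im_cong) simp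

lemma in_ker_mono: "in_ker U s \<Longrightarrow> zopen V \<Longrightarrow> V \<subseteq> U \<Longrightarrow> in_ker V s"
  unfolding in_ker_def using vreg_mono by blast

lemma in_imE:
  assumes "in_im U s" "P \<in> U"
  obtains V t where "zopen V" "P \<in> V" "V \<subseteq> U" "vreg sV (- 1) V t" "\<forall>v\<in>\<Union>V. s v = \<alpha> v (t v)"
proof -
  have "image_at U s P" using assms by (simp add: in_im_def)
  then show thesis unfolding image_at_def by (elim exE conjE) (rule that)
qed

lemma in_im_mono:
  assumes "in_im U s" "zopen V" "V \<subseteq> U"
  shows "in_im V s"
  unfolding in_im_def
proof (intro conjI ballI)
  show "vreg sM 0 V s" using assms vreg_mono unfolding in_im_def by blast
  fix P assume P: "P \<in> V"
  then have "P \<in> U" using assms by blast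
  with assms(1) obtain W t where W: "zopen W" "P \<in> W" "W \<subseteq> U" "vreg sV (- 1) W t"
    "\<forall>v\<in>\<Union>W. s v = \<alpha> v (t v)" by (rule in_imE)
  then show "image_at V s P"
    using P assms(2) by (intro image_atI[of "W \<inter> V" _ _ t]) (auto intro: vreg_mono)
qed

lemma in_im_add:
  assumes "in_im U s" "in_im U s'"
  shows "in_im U (\<lambda>v. s v + s' v)"
  unfolding in_im_def
proof (intro conjI ballI)
  show "vreg sM 0 U (\<lambda>v. s v + s' v)" using assms by (simp add: in_im_def vreg_add)
  fix P assume P: "P \<in> U"
  from assms(1) P obtain V t where V: "zopen V" "P \<in> V" "V \<subseteq> U" "vreg sV (- 1) V t"
    "\<forall>v\<in>\<Union>V. s v = \<alpha> v (t v)" by (rule in_imE)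
  from assms(2) P obtain W u where W: "zopen W" "P \<in> W" "W \<subseteq> U" "vreg sV (- 1) W u"
    "\<forall>v\<in>\<Union>W. s' v = \<alpha> v (u v)" by (rule in_imE)
  have o: "zopen (V \<inter> W)" using V W by auto
  have "vreg sV (- 1) (V \<inter> W) (\<lambda>v. t v + u v)"
    using vreg_mono[OF V(4) o] vreg_mono[OF W(4) o] by (simp add: vreg_add)
  then show "image_at U (\<lambda>v. s v + s' v) P"
    using V W by (intro image_atI[OF o, of _ _ "\<lambda>v. t v + u v"]) (auto simp: linear_simps[OF
      linear_alpha])
qed

lemma in_im_smult:
  assumes "reg 0 U f" "in_im U s"
  shows "in_im U (\<lambda>v. sM (f v) (s v))"
  unfolding in_im_def
proof (intro conjI ballI)
  show "vreg sM 0 U (\<lambda>v. sM (f v) (s v))" using assms by (simp add: in_im_def vreg_scale0)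
  fix P assume P: "P \<in> U"
  from assms(2) P obtain V t where V: "zopen V" "P \<in> V" "V \<subseteq> U" "vreg sV (- 1) V t"
    "\<forall>v\<in>\<Union>V. s v = \<alpha> v (t v)" by (rule in_imE)
  have "vreg sV (- 1) V (\<lambda>v. sV (f v) (t v))"
    by (rule vreg_scale0[OF reg_mono[OF assms(1) V(1,3)] V(4)])
  then show "image_at U (\<lambda>v. sM (f v) (s v)) P"
    using V by (intro image_atI[OF V(1), of _ _ "\<lambda>v. sV (f v) (t v)"]) (auto simp: linear_simps[OF
      linear_alpha])
qed

lemma in_im_imp_Ksec:
  assumes "in_im U s"
  shows "in_ker U s"
  unfolding in_ker_def
proof (intro conjI ballI)
  show "vreg sM 0 U s" using assms by (simp add: in_im_def)
  fix v assume "v \<in> \<Union>U"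
  then obtain P where P: "P \<in> U" "v \<in> P" by blast
  from assms P(1) obtain V t where V: "zopen V" "P \<in> V" "V \<subseteq> U" "vreg sV (- 1) V t"
    "\<forall>v\<in>\<Union>V. s v = \<alpha> v (t v)" by (rule in_imE)
  then have "s v = \<alpha> v (t v)" using P(2) by blast
  then show "\<beta> v (s v) = 0" by (simp add: beta_alpha)
qed

lemma in_ker_add: "in_ker U s \<Longrightarrow> in_ker U t \<Longrightarrow> in_ker U (\<lambda>v. s v + t v)"
  by (simp add: in_ker_def vreg_add linear_simps[OF linear_beta])

lemma in_ker_smult: "reg 0 U f \<Longrightarrow> in_ker U s \<Longrightarrow> in_ker U (\<lambda>v. sM (f v) (s v))"
  by (simp add: in_ker_def vreg_scale0 linear_simps[OF linear_beta])

lemma in_ker_zero: "zopen U \<Longrightarrow> in_ker U (\<lambda>v. 0)"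
  by (simp add: in_ker_def vreg_zero linear_simps[OF linear_beta])

lemma in_ker_uminus: "zopen U \<Longrightarrow> in_ker U s \<Longrightarrow> in_ker U (\<lambda>v. - s v)"
  by (simp add: in_ker_def vreg_uminus linear_simps[OF linear_beta])

lemma in_im_uminus:
  assumes "zopen U" "in_im U s"
  shows "in_im U (\<lambda>v. - s v)"
  using in_im_smult[OF reg_const[OF assms(1), of "-1"] assms(2)] by (simp add: M.scale_minus_left)

lemma in_im_zero:
  assumes "zopen U"
  shows "in_im U (\<lambda>v. 0)"
  unfolding in_im_def
proof (intro conjI ballI)
  show "vreg sM 0 U (\<lambda>v. 0)" by (rule vreg_zero[OF assms])
  fix P assume "P \<in> U"
  then show "image_at U (\<lambda>v. 0) P"
    by (intro image_atI[OF assms, of _ _ "\<lambda>_. 0"]) (auto simp: vreg_zero[OF assms] linear_simps[OF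
      linear_alpha])
qed

lemma in_im_local:
  assumes "\<And>P. P \<in> U \<Longrightarrow> \<exists>V. zopen V \<and> P \<in> V \<and> V \<subseteq> U \<and> in_im V s"
  shows "in_im U s"
  unfolding in_im_def
proof (intro conjI ballI)
  show "vreg sM 0 U s"
  proof (rule vreg_local)
    fix P assume "P \<in> U"
    from assms[OF this] obtain V where "zopen V" "P \<in> V" "V \<subseteq> U" "in_im V s" by blast
    then show "\<exists>V. zopen V \<and> P \<in> V \<and> V \<subseteq> U \<and> vreg sM 0 V s"
      by (intro exI[of _ V]) (simp add: in_im_def)
  qed
  fix P assume "P \<in> U"
  from assms[OF this] obtain V where V: "P \<in> V" "V \<subseteq> U" "in_im V s" by blast
  from V(3,1) obtain W t where W: "zopen W" "P \<in> W" "W \<subseteq> V" "vreg sV (- 1) W t"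
    "\<forall>v\<in>\<Union>W. s v = \<alpha> v (t v)" by (rule in_imE)
  then show "image_at U s P"
    using V(2) by (intro image_atI[of W _ _ t]) auto
qed

lemma abelian_group_K:
  assumes U: "zopen U"
  shows "abelian_group (sects K U)"
proof (rule abelian_groupI)
  show "zero (sects K U) \<in> sections K U" using U by (simp add: K_carrier_iff KN_ops in_ker_zero)
  fix s assume s: "s \<in> sections K U"
  show "\<exists>t\<in>sections K U. add (sects K U) t s = zero (sects K U)"
  proof
    show "(\<lambda>v\<in>\<Union>U. - s v) \<in> sections K U" using s U by (simp add: K_carrier_iff in_ker_uminus)
    show "add (sects K U) (\<lambda>v\<in>\<Union>U. - s v) s = zero (sects K U)"
      unfolding KN_ops restrict_eq_restrict_iff by simp
  qed
  show "add (sects K U) (zero (sects K U)) s = s"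
    using s by (intro extensionalityI[of _ "\<Union>U"]) (simp_all add: KN_ops K_carrier_iff U)
  fix t assume t: "t \<in> sections K U"
  show "add (sects K U) s t \<in> sections K U" using s t U by (simp add: K_carrier_iff KN_ops
    in_ker_add)
  show "add (sects K U) s t = add (sects K U) t s"
    unfolding KN_ops restrict_eq_restrict_iff by (simp add: add.commute)
  fix u
  show "add (sects K U) (add (sects K U) s t) u = add (sects K U) s (add (sects K U) t u)"
    unfolding KN_ops restrict_eq_restrict_iff by (simp add: add.assoc)
qed

lemma K_minus:
  assumes U: "zopen U" and s: "s \<in> sections K U"
  shows "a_inv (sects K U) s = (\<lambda>v\<in>\<Union>U. - s v)"
proof -
  interpret abelian_group "sects K U" by (rule abelian_group_K[OF U])
  have "(\<lambda>v\<in>\<Union>U. - s v) \<in> sections K U" using s U by (simp add: K_carrier_iff in_ker_uminus)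
  moreover have "add (sects K U) (\<lambda>v\<in>\<Union>U. - s v) s = zero (sects K U)"
    unfolding KN_ops restrict_eq_restrict_iff by simp
  ultimately show ?thesis using s by (metis minus_equality)
qed

lemma abelian_subgroup_N:
  assumes U: "zopen U"
  shows "abelian_subgroup (sections N U) (sects K U)"
proof (rule abelian_subgroupI3)
  show "abelian_group (sects K U)" by (rule abelian_group_K[OF U])
  show "additive_subgroup (sections N U) (sects K U)"
  proof (rule additive_subgroupI, rule subgroup.intro)
    show sub: "sections N U \<subseteq> carrier (add_monoid (sects K U))"
      using U by (auto simp: N_carrier_iff K_carrier_iff in_im_imp_Ksec)
    show "monoid.mult (add_monoid (sects K U)) x y \<in> sections N U"
      if "x \<in> sections N U" "y \<in> sections N U" for x y
      using that U by (simp add: N_carrier_iff KN_ops in_im_add)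
    show "monoid.one (add_monoid (sects K U)) \<in> sections N U"
      using U by (simp add: N_carrier_iff KN_ops in_im_zero)
    show "m_inv (add_monoid (sects K U)) x \<in> sections N U" if x: "x \<in> sections N U" for x
    proof -
      have "x \<in> sections K U" using sub x by auto
      from K_minus[OF U this] show ?thesis
        using x U by (simp add: N_carrier_iff a_inv_def in_im_uminus)
    qed
  qed
qed

text \<open>\<open>N_local\<close> holds because the sheaf image is defined by local membership; the
  subgroup property rests on \<open>beta_alpha\<close>, which puts the image inside the
  kernel.\<close>

sublocale sheaf_quotient zariski structure_sheaf K N
proof (intro sheaf_quotient.intro module_presheaf.intro sheaf_quotient_axioms.intro)
  fix U V W :: "(complex ^ 4) set set" and f s
  assume U: "zopen U"
  show "abelian_subgroup (sections N U) (sects K U)" by (rule abelian_subgroup_N[OF U])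
  {
    assume f: "f \<in> sections structure_sheaf U"
    show "smult (sects K U) f s \<in> sections N U" if "s \<in> sections N U"
      using that f U by (simp add: N_carrier_iff O_carrier_iff KN_ops in_im_smult)
    show "smult (sects K U) f s \<in> sections K U" if "s \<in> sections K U"
      using that f U by (simp add: K_carrier_iff O_carrier_iff KN_ops in_ker_smult)
    show "smult (sects K U) f (add (sects K U) s t) = add (sects K U) (smult (sects K U) f s) (smult
      (sects K U) f t)" for t
      unfolding KN_ops restrict_eq_restrict_iff by (simp add: M.scale_right_distrib)
  }
  show "add (sects K U) s t \<in> sections K U"
    if "s \<in> sections K U" "t \<in> sections K U" for t
    using that U by (simp add: K_carrier_iff KN_ops in_ker_add)
  show "s \<in> sections N U" if s: "s \<in> sections K U" and
    loc: "\<And>P. P \<in> U \<Longrightarrow> \<exists>V. zopen V \<and> P \<in> V \<and> V \<subseteq> U \<and> rstr K U V s \<in> sections N V"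
  proof -
    have "in_im U s"
    proof (rule in_im_local)
      fix P assume "P \<in> U"
      from loc[OF this] obtain V where V: "zopen V" "P \<in> V" "V \<subseteq> U" "rstr K U V s \<in> sections N V"
        by blast
      then have "in_im V s" by (simp add: N_carrier_iff KN_ops)
      with V show "\<exists>V. zopen V \<and> P \<in> V \<and> V \<subseteq> U \<and> in_im V s" by blast
    qed
    then show ?thesis using s U by (simp add: N_carrier_iff K_carrier_iff)
  qed
  assume V: "zopen V" "V \<subseteq> U"
  then have VU: "v \<in> \<Union>U" if "v \<in> \<Union>V" for v using that by blast
  show "rstr K U V s \<in> sections N V" if "s \<in> sections N U"
    using that U V in_im_mono[of U s V] by (simp add: N_carrier_iff KN_ops)
  show "rstr K U V s \<in> sections K V" if "s \<in> sections K U"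
    using that U V in_ker_mono[of U s V] by (simp add: K_carrier_iff KN_ops)
  show "rstr structure_sheaf U V f \<in> sections structure_sheaf V" if "f \<in> sections structure_sheaf U"
    using that U V reg_mono[of 0 U f V] by (simp add: O_carrier_iff O_rstr)
  show "rstr K U V (add (sects K U) s t) = add (sects K V) (rstr K U V s) (rstr K U V t)" for t
    unfolding KN_ops restrict_eq_restrict_iff using VU by simp
  show "rstr K U V (smult (sects K U) f s) = smult (sects K V) (rstr structure_sheaf U V f) (rstr K
    U V s)"
    unfolding KN_ops O_rstr restrict_eq_restrict_iff using VU by simp
  assume W: "zopen W" "W \<subseteq> V"
  then have WV: "v \<in> \<Union>V" if "v \<in> \<Union>W" for v using that by blast
  show "rstr K V W (rstr K U V s) = rstr K U W s"
    unfolding KN_ops restrict_eq_restrict_iff using WV by simp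
  show "rstr structure_sheaf V W (rstr structure_sheaf U V f) = rstr structure_sheaf U W f"
    unfolding O_rstr restrict_eq_restrict_iff using WV by simp
qed

lemma monad_cohomology_eq: "monad_cohomology sV sW D = E"
  by (simp add: monad_cohomology_def Let_def)

end

section \<open>Fibrewise injectivity from local freeness\<close>

lemma continuous_on_homog_poly: "homog_poly d f \<Longrightarrow> continuous_on A f"
  by (induction rule: homog_poly.induct) (auto intro!: continuous_intros)

text \<open>Comparison with the Euclidean topology of the coordinate space: a line through a vector
  of the cone over a Zariski open set meets that cone in infinitely many parameters.\<close>

lemma open_cone:
  assumes "zopen U"
  shows "open (\<Union>U)"
proof -
  let ?S = "{{P \<in> proj_space. \<forall>v\<in>P. f v \<noteq> 0} | f. \<exists>d. homog_poly d f}"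
  have "generate_topology_on ?S U"
    using assms unfolding zariski_def openin_topology_generated_by_iff .
  then show ?thesis
  proof induction
    case (Int a b)
    have "zopen a" "zopen b"
      using Int(1,2) unfolding zariski_def openin_topology_generated_by_iff by auto
    then have "\<Union>(a \<inter> b) = \<Union>a \<inter> \<Union>b" by (intro cone_Int openin_zariski_subset)
    then show ?case using Int by auto
  next
    case (UN K)
    have "\<Union>(\<Union>K) = (\<Union>U\<in>K. \<Union>U)" by blast
    then show ?case using UN by auto
  next
    case (Basis s)
    then obtain f d where f: "homog_poly d f" "s = {P \<in> proj_space. \<forall>v\<in>P. f v \<noteq> 0}" by blast
    have "v \<in> \<Union>s \<longleftrightarrow> v \<noteq> 0 \<and> f v \<noteq> 0" for v
    proof
      assume "v \<in> \<Union>s"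
      then show "v \<noteq> 0 \<and> f v \<noteq> 0" using f(2) proj_spaceD(1) by blast
    next
      assume v: "v \<noteq> 0 \<and> f v \<noteq> 0"
      then have "proj_point v \<in> s" using f
        by (auto simp: proj_space_def proj_point_def homog_poly_scale[OF f(1)])
      then show "v \<in> \<Union>s" using mem_proj_point by blast
    qed
    then have "\<Union>s = {v. v \<noteq> 0} \<inter> {v. f v \<noteq> 0}" by blast
    moreover have "open {v. f v \<noteq> 0}"
      using continuous_on_homog_poly[OF f(1)] by (intro open_Collect_neq continuous_on_const)
    moreover have "open {v :: complex ^ 'a. v \<noteq> 0}" by (intro open_Collect_neq continuous_on_id
      continuous_on_const)
    ultimately show ?case by (simp add: open_Int)
  qed simp
qed

context adhm_monad
begin

text \<open>
  Along the line through \<open>p\<close> in the direction of the first coordinate only the summand \<open>x \<cdot> id\<close>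
  of \<open>\<alpha>\<close> varies, so \<open>\<alpha>\<close> fails to be injective at finitely many points of that line only.
\<close>

lemma alpha_kernel_zero:
  assumes U: "zopen U" and r: "vreg sV d U r" and ker: "\<forall>v\<in>\<Union>U. \<alpha> v (r v) = 0"
    and P: "P \<in> U" "p \<in> P"
  shows "r p = 0"
proof (rule ccontr)
  assume "r p \<noteq> 0"
  moreover have "(\<Sum>b\<in>bV. sV (V.representation bV (r p) b) b) = r p" by (rule V.sum_Basis)
  ultimately obtain b where b: "V.representation bV (r p) b \<noteq> 0"
    by (metis (no_types, lifting) V.scale_zero_left sum.neutral)
  have lr: "functional sV (\<lambda>e. V.representation bV e b)" by (rule V.linear_representation)
  \<comment> \<open>A nonzero coordinate of \<open>r\<close> stays nonzero near \<open>P\<close>, so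
    \<alpha> has a nonzero kernel vector throughout the cone over \<open>W\<close>.\<close>
  obtain W where W: "zopen W" "P \<in> W" "W \<subseteq> U" "\<forall>v\<in>\<Union>W. V.representation bV (r v) b \<noteq> 0"
    by (rule reg_nonzero_nbhd[OF U vregD[OF r lr] P b])
  define q where "q t = p + axis 1 t" for t :: complex
  define B where "B = aB1 (adhm_at sV sW D (vec_nth p 3) (vec_nth p 4))"
  have qn: "vec_nth (q t) 1 = vec_nth p 1 + t" "vec_nth (q t) 3 = vec_nth p 3" "vec_nth (q t) 4 =
    vec_nth p 4" for t
    by (simp_all add: q_def axis_def)
  \<comment> \<open>Since \<open>z\<close> and \<open>w\<close> are constant along the line, a
    kernel vector at \<open>q t\<close> is an eigenvector of the fixed operator \<open>B\<close>,
    with an eigenvalue that determines \<open>t\<close>.\<close>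
  have "- (vec_nth p 1 + t) \<in> {l. \<exists>u. u \<noteq> 0 \<and> B u = sV l u}" if t: "q t \<in> \<Union>W" for t
  proof -
    have "V.representation bV (r (q t)) b \<noteq> 0" using W(4) t by blast
    then have "r (q t) \<noteq> 0" by (auto simp: V.representation_zero)
    moreover have "\<alpha> (q t) (r (q t)) = 0" using ker W(3) t by blast
    then have "B (r (q t)) + sV (vec_nth p 1 + t) (r (q t)) = 0"
      unfolding alpha_adhm_at qn B_def by (simp add: zero_prod_def)
    then have "B (r (q t)) = sV (- (vec_nth p 1 + t)) (r (q t))"
      by (simp only: V.scale_minus_left add_eq_0_iff2)
    ultimately show ?thesis by blast
  qed
  then have "(\<lambda>t. - (vec_nth p 1 + t)) ` {t. q t \<in> \<Union>W} \<subseteq> {l. \<exists>u. u \<noteq> 0 \<and> B u = sV l u}" by blast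
  moreover have "finite {l. \<exists>u. u \<noteq> 0 \<and> B u = sV l u}"
    unfolding B_def by (rule V.finite_eigenvalues[OF linear_adhm_at(1)])
  ultimately have "finite ((\<lambda>t. - (vec_nth p 1 + t)) ` {t. q t \<in> \<Union>W})" by (rule finite_subset)
  then have fin: "finite {t. q t \<in> \<Union>W}" by (rule finite_imageD) (simp add: inj_on_def)
  have "continuous_on UNIV q"
  proof -
    have "q = (\<lambda>t. p + t *s axis 1 1)" by (auto simp: q_def fun_eq_iff axis_def
      Finite_Cartesian_Product.vec_eq_iff)
    then show ?thesis unfolding vector_scalar_mult_def by (auto intro!: continuous_intros)
  qed
  then have "open (q -` \<Union>W)" using open_cone[OF W(1)] by (rule open_vimage[rotated])
  then have op: "open {t. q t \<in> \<Union>W}" by (simp only: vimage_def)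
  have "q 0 = p" by (simp add: q_def axis_def Finite_Cartesian_Product.vec_eq_iff)
  then have "0 \<in> {t. q t \<in> \<Union>W}" using W(2) P(2) by auto
  \<comment> \<open>The parameter set is open, finite and contains 0, which is impossible in the
    complex line.\<close>
  with finite_imp_not_open[OF fin] op show False by (metis empty_iff)
qed

text \<open>A constant right inverse \<open>g\<close> of \<open>\<beta> p\<close> remains one near
  \<open>p\<close> up to an invertible factor: the family \<open>v \<mapsto> l \<beta> g\<close>,
  with \<open>l\<close> the inverse of a nonvanishing coordinate, has degree 0 and is the identity
  up to a scalar at \<open>p\<close>. With its inverse \<open>S\<close>, the projection is
  \<open>1 - g S l \<beta>\<close>.\<close>

lemma ker_beta_projection:
  assumes st: "C_stable sV sW D" and U: "zopen U" and P: "P \<in> U" "p \<in> P"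
    and k: "\<forall>v\<in>\<Union>U. vec_nth v k \<noteq> 0"
  obtains W Pr where "zopen W" "P \<in> W" "W \<subseteq> U" "oreg sM sM 0 W Pr"
    "\<forall>v\<in>\<Union>W. \<forall>m. \<beta> v (Pr v m) = 0 \<and> (\<beta> v m = 0 \<longrightarrow> Pr v m = m)"
proof -
  interpret MV: vector_space_pair sM sV by unfold_locales
  let ?l = "\<lambda>v. inverse (vec_nth v k)"
  have "p \<noteq> 0" using P U openin_zariski_subset proj_spaceD(1) by blast
  then have "surj (\<beta> p)" by (rule surj_beta[OF st])
  then obtain g where g: "Vector_Spaces.linear sV sM g" "\<beta> p \<circ> g = id"
    using MV.linear_surjective_right_inverse[OF linear_beta] by blast
  have l: "reg (- 1) U ?l" using reg_inverse[OF reg_coord[OF U, of k]] k by blast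
  have bg: "oreg sM sV 0 U (\<lambda>v m. sV (?l v) (\<beta> v m))"
    using oreg_scale[OF l oreg_beta[OF U]] by simp
  have T: "oreg sV sV 0 U (\<lambda>v e. sV (?l v) (\<beta> v (g e)))"
    using M.oreg_compose[OF U bg oreg_const[OF U g(1)]] by simp
  have "e = 0" if "sV (?l p) (\<beta> p (g e)) = 0" for e
  proof -
    have "?l p \<noteq> 0" using k P by auto
    moreover have "\<beta> p (g e) = e" using g(2) by (metis comp_apply id_apply)
    ultimately show ?thesis using that by (auto simp: V.scale_eq_0_iff)
  qed
  then obtain W S where W: "zopen W" "P \<in> W" "W \<subseteq> U" and S: "oreg sV sV 0 W S"
    and inv: "\<forall>v\<in>\<Union>W. \<forall>e. sV (?l v) (\<beta> v (g (S v e))) = e \<and> S v (sV (?l v) (\<beta> v (g e))) = e"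
    by (rule V.oreg_inverse[OF U T P])
  define Pr where "Pr v m = m - g (S v (sV (?l v) (\<beta> v m)))" for v m
  have 1: "oreg sM sV 0 W (\<lambda>v m. S v (sV (?l v) (\<beta> v m)))"
    using V.oreg_compose[OF W(1) S oreg_mono[OF bg W(1,3)]] by simp
  have "oreg sM sM 0 W (\<lambda>v m. g (S v (sV (?l v) (\<beta> v m))))"
    using V.oreg_compose[OF W(1) oreg_const[OF W(1) g(1)] 1] by simp
  moreover have "oreg sM sM 0 W (\<lambda>v m. m)"
    using oreg_const[OF W(1) M.linear_id] by (simp add: id_def)
  ultimately have Pr: "oreg sM sM 0 W Pr" unfolding Pr_def by (intro oreg_diff W(1))
  have "\<beta> v (Pr v m) = 0 \<and> (\<beta> v m = 0 \<longrightarrow> Pr v m = m)" if v: "v \<in> \<Union>W" for v m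
  proof
    have l0: "?l v \<noteq> 0" using k v W(3) by auto
    have "sV (?l v) (\<beta> v (g (S v (sV (?l v) (\<beta> v m))))) = sV (?l v) (\<beta> v m)" using inv v by blast
    then have "\<beta> v (g (S v (sV (?l v) (\<beta> v m)))) = \<beta> v m" using l0 by simp
    then show "\<beta> v (Pr v m) = 0" by (simp add: Pr_def linear_simps[OF linear_beta])
    show "\<beta> v m = 0 \<longrightarrow> Pr v m = m"
    proof
      have lS: "Vector_Spaces.linear sV sV (S v)" using S by (simp add: oreg_def)
      assume "\<beta> v m = 0"
      then show "Pr v m = m" by (simp add: Pr_def linear_simps[OF lS] linear_simps[OF g(1)])
    qed
  qed
  then show thesis using that[OF W Pr] by blast
qed

end

section \<open>Coordinates of kernel sections in a local trivialisation\<close>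

context adhm_monad
begin

text \<open>\<open>\<Phi>\<close> is controlled only on extensional sections; restricting first
  allows it to be applied to plain pointwise formulas.\<close>

definition coord :: "((complex ^ 4) set set \<Rightarrow> (complex ^ 4 \<Rightarrow> 'v \<times> 'v \<times> 'w) \<Rightarrow> nat \<Rightarrow> complex ^ 4 \<Rightarrow>
  complex)
    \<Rightarrow> (complex ^ 4) set set \<Rightarrow> (complex ^ 4 \<Rightarrow> 'v \<times> 'v \<times> 'w) \<Rightarrow> nat \<Rightarrow> complex ^ 4 \<Rightarrow> complex" where
  "coord \<Phi> V s = \<Phi> V (restrict s (\<Union>V))"

lemma coord_cong: "(\<And>v. v \<in> \<Union>V \<Longrightarrow> s v = t v) \<Longrightarrow> coord \<Phi> V s = coord \<Phi> V t"
  unfolding coord_def by (rule arg_cong[of _ _ "\<Phi> V"]) (simp add: restrict_eq_restrict_iff)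

abbreviation "G n \<equiv> free_sheaf structure_sheaf n"

lemma G_carrier_iff:
  "g \<in> carrier (sects (G n) U) \<longleftrightarrow> g \<in> extensional {..<n} \<and> (\<forall>k<n. g k \<in> extensional (\<Union>U) \<and>
    reg 0 U (g k))"
  by (auto simp: free_sheaf_def O_carrier_iff PiE_iff)

lemma G_ops:
  "add (sects (G n) U) g h = (\<lambda>k\<in>{..<n}. \<lambda>v\<in>\<Union>U. g k v + h k v)"
  "smult (sects (G n) U) f g = (\<lambda>k\<in>{..<n}. \<lambda>v\<in>\<Union>U. f v * g k v)"
  "zero (sects (G n) U) = (\<lambda>k\<in>{..<n}. \<lambda>v\<in>\<Union>U. 0)"
  "rstr (G n) U V g = (\<lambda>k\<in>{..<n}. restrict (g k) (\<Union>V))"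
  by (simp_all add: free_sheaf_def structure_sheaf_def)

context
  fixes U n \<Phi> assumes \<Phi>: "kernel_hom zariski structure_sheaf K N (G n) U \<Phi>"
begin

lemma restrict_in_K: "zopen V \<Longrightarrow> in_ker V s \<Longrightarrow> restrict s (\<Union>V) \<in> sections K V"
  by (simp add: K_carrier_iff)

lemma coord_carrier:
  assumes V: "zopen V" "V \<subseteq> U" and s: "in_ker V s"
  shows "coord \<Phi> V s \<in> carrier (sects (G n) V)"
  unfolding coord_def using linear_mapD(1)[OF kernel_homD(1)[OF \<Phi> V] restrict_in_K[OF V(1) s]] .

lemma coord_reg:
  assumes V: "zopen V" "V \<subseteq> U" and s: "in_ker V s" and k: "k < n"
  shows "reg 0 V (coord \<Phi> V s k)"
  using coord_carrier[OF V s] k by (simp add: G_carrier_iff)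

lemma coord_add:
  assumes V: "zopen V" "V \<subseteq> U" and s: "in_ker V s" "in_ker V t" and k: "k < n" and v: "v \<in> \<Union>V"
  shows "coord \<Phi> V (\<lambda>v. s v + t v) k v = coord \<Phi> V s k v + coord \<Phi> V t k v"
proof -
  have "restrict (\<lambda>v. s v + t v) (\<Union>V) = add (sects K V) (restrict s (\<Union>V)) (restrict t (\<Union>V))"
    unfolding KN_ops restrict_eq_restrict_iff by simp
  then have "coord \<Phi> V (\<lambda>v. s v + t v) = add (sects (G n) V) (coord \<Phi> V s) (coord \<Phi> V t)"
    unfolding coord_def
    using linear_mapD(2)[OF kernel_homD(1)[OF \<Phi> V] restrict_in_K[OF V(1) s(1)] restrict_in_K[OF V(1)
      s(2)]] by simp
  then show ?thesis using k v by (simp only: G_ops) simp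
qed

lemma coord_smult:
  assumes V: "zopen V" "V \<subseteq> U" and f: "reg 0 V f" and s: "in_ker V s" and k: "k < n" and v: "v \<in> \<Union>V"
  shows "coord \<Phi> V (\<lambda>v. sM (f v) (s v)) k v = f v * coord \<Phi> V s k v"
proof -
  have f': "restrict f (\<Union>V) \<in> sections structure_sheaf V" using f by (simp add: O_carrier_iff)
  have "restrict (\<lambda>v. sM (f v) (s v)) (\<Union>V) = smult (sects K V) (restrict f (\<Union>V)) (restrict s (\<Union>V))"
    unfolding KN_ops restrict_eq_restrict_iff by simp
  then have "coord \<Phi> V (\<lambda>v. sM (f v) (s v)) = smult (sects (G n) V) (restrict f (\<Union>V)) (coord \<Phi> V s)"
    unfolding coord_def
    using linear_mapD(3)[OF kernel_homD(1)[OF \<Phi> V] f' restrict_in_K[OF V(1) s]] by simp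
  then show ?thesis using k v by (simp only: G_ops) simp
qed

text \<open>Used in both directions: vanishing coordinates place a section in the image of \<alpha>,
  and a section of that image yields relations among coordinates.\<close>

lemma coord_eq_0_iff:
  assumes V: "zopen V" "V \<subseteq> U" and s: "in_ker V s"
  shows "(\<forall>k<n. \<forall>v\<in>\<Union>V. coord \<Phi> V s k v = 0) \<longleftrightarrow> in_im V s"
proof -
  have "(\<forall>k<n. \<forall>v\<in>\<Union>V. coord \<Phi> V s k v = 0) \<longleftrightarrow> coord \<Phi> V s = zero (sects (G n) V)"
  proof
    assume "\<forall>k<n. \<forall>v\<in>\<Union>V. coord \<Phi> V s k v = 0"
    then show "coord \<Phi> V s = zero (sects (G n) V)"
      using coord_carrier[OF V s] unfolding G_carrier_iff G_ops
      by (intro extensionalityI[of _ "{..<n}"]) (auto intro!: extensionalityI[of _ "\<Union>V"])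
  next
    assume "coord \<Phi> V s = zero (sects (G n) V)"
    then show "\<forall>k<n. \<forall>v\<in>\<Union>V. coord \<Phi> V s k v = 0" by (simp only: G_ops) simp
  qed
  also have "\<dots> \<longleftrightarrow> restrict s (\<Union>V) \<in> sections N V"
    unfolding coord_def using kernel_homD(2)[OF \<Phi> V restrict_in_K[OF V(1) s]] .
  also have "\<dots> \<longleftrightarrow> in_im V s" using V(1) by (simp add: N_carrier_iff)
  finally show ?thesis .
qed

lemma coord_restrict:
  assumes V: "zopen V" "V \<subseteq> U" and W: "zopen W" "W \<subseteq> V" and s: "in_ker V s"
    and k: "k < n" and v: "v \<in> \<Union>W"
  shows "coord \<Phi> W s k v = coord \<Phi> V s k v"
proof -
  have "restrict (restrict s (\<Union>V)) (\<Union>W) = restrict s (\<Union>W)"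
    unfolding restrict_eq_restrict_iff using W(2) by auto
  then have "coord \<Phi> W s = rstr (G n) V W (coord \<Phi> V s)"
    unfolding coord_def
    using kernel_homD(3)[OF \<Phi> V(1) W(1,2) V(2) restrict_in_K[OF V(1) s]] by (simp add: KN_ops)
  then show ?thesis using k v by (simp only: G_ops) simp
qed

lemma coord_zero:
  assumes V: "zopen V" "V \<subseteq> U" and k: "k < n" and v: "v \<in> \<Union>V"
  shows "coord \<Phi> V (\<lambda>_. 0) k v = 0"
  using coord_eq_0_iff[OF V in_ker_zero[OF V(1)]] in_im_zero[OF V(1)] k v by blast

lemma in_ker_sum:
  assumes V: "zopen V" and "\<And>i. i \<in> I \<Longrightarrow> reg 0 V (f i)" "\<And>i. i \<in> I \<Longrightarrow> in_ker V (s i)"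
  shows "in_ker V (\<lambda>v. \<Sum>i\<in>I. sM (f i v) (s i v))"
  using assms(2,3)
  by (induction I rule: infinite_finite_induct) (simp_all add: in_ker_zero[OF V] in_ker_add
    in_ker_smult)

lemma coord_sum:
  assumes V: "zopen V" "V \<subseteq> U" and "finite I"
    and "\<And>i. i \<in> I \<Longrightarrow> reg 0 V (f i)" "\<And>i. i \<in> I \<Longrightarrow> in_ker V (s i)" and k: "k < n" and v: "v \<in> \<Union>V"
  shows "coord \<Phi> V (\<lambda>v. \<Sum>i\<in>I. sM (f i v) (s i v)) k v = (\<Sum>i\<in>I. f i v * coord \<Phi> V (s i) k v)"
  using assms(3-5)
proof (induction I rule: finite_induct)
  case empty
  then show ?case by (simp add: coord_zero[OF V k v])
next
  case (insert i I)
  have "coord \<Phi> V (\<lambda>v. sM (f i v) (s i v) + (\<Sum>i\<in>I. sM (f i v) (s i v))) k v =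
     coord \<Phi> V (\<lambda>v. sM (f i v) (s i v)) k v + coord \<Phi> V (\<lambda>v. \<Sum>i\<in>I. sM (f i v) (s i v)) k v"
    using insert.prems by (intro coord_add[OF V _ _ k v] in_ker_smult in_ker_sum V) simp_all
  also have "coord \<Phi> V (\<lambda>v. sM (f i v) (s i v)) k v = f i v * coord \<Phi> V (s i) k v"
    using insert.prems by (intro coord_smult[OF V _ _ k v]) simp_all
  also have "coord \<Phi> V (\<lambda>v. \<Sum>i\<in>I. sM (f i v) (s i v)) k v = (\<Sum>i\<in>I. f i v * coord \<Phi> V (s i) k v)"
    using insert by simp
  finally show ?case using insert.hyps by simp
qed

end

text \<open>Shrinks to one neighbourhood after finitely many local choices. Including
  \<open>U\<close> in the intersection also settles the empty family, as happens in rank 0.\<close>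

lemma finite_Int_nbhd:
  assumes "zopen U" "P \<in> U" "finite I" "\<And>i. i \<in> I \<Longrightarrow> zopen (W i)" "\<And>i. i \<in> I \<Longrightarrow> P \<in> W i"
  obtains V where "zopen V" "P \<in> V" "V \<subseteq> U" "\<forall>i\<in>I. V \<subseteq> W i"
proof -
  have "zopen (\<Inter>(insert U (W ` I)))" using assms by (intro openin_Inter) auto
  then show thesis using that[of "\<Inter>(insert U (W ` I))"] assms by auto
qed

text \<open>Let \<open>\<kappa> j\<close> generate \<open>ker \<beta>\<close> near \<open>P\<close>
  and let \<open>sf k\<close> lift the standard basis of \<open>O^n\<close>. Subtracting from
  \<open>\<kappa> j\<close> the combination of the \<open>sf k\<close> with its own coordinates
  \<open>F j k\<close> leaves some \<open>\<alpha> (t j)\<close>. If the section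
  \<open>\<alpha> a\<close> is the sum of \<open>g j \<kappa> j\<close>, its zero class forces the
  sums of \<open>g j F j k\<close> to vanish, so it equals \<alpha> of the sum of
  \<open>g j t j\<close>.\<close>

theorem inj_alpha_if_locally_free:
  assumes st: "C_stable sV sW D" and lf: "locally_free zariski structure_sheaf E"
    and p: "p \<noteq> 0" and a: "\<alpha> p a = 0"
  shows "a = 0"
proof -
  define P where "P = proj_point p"
  have pP: "p \<in> P" by (simp add: P_def mem_proj_point)
  have P: "P \<in> proj_space" using p by (auto simp: P_def proj_space_def)
  obtain U0 n where U0: "zopen U0" "P \<in> U0"
    and iso: "iso_on zariski structure_sheaf U0 E (G n)"
    using lf P unfolding locally_free_def topspace_zariski by blast
  obtain \<Phi> where \<Phi>: "kernel_hom zariski structure_sheaf K N (G n) U0 \<Phi>"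
    and lift: "\<And>V g P. \<lbrakk>zopen V; V \<subseteq> U0; g \<in> carrier (sects (G n) V); P \<in> V\<rbrakk>
      \<Longrightarrow> \<exists>W s. zopen W \<and> P \<in> W \<and> W \<subseteq> V \<and> s \<in> sections K W \<and> \<Phi> W s = rstr (G n) V W g"
    using iso_on_imp_kernel_hom[OF module_sheaf_free U0(1) iso] by metis
  obtain k0 where k0: "vec_nth p k0 \<noteq> 0" using p by (auto simp: Finite_Cartesian_Product.vec_eq_iff)
  obtain U where U: "zopen U" "P \<in> U" "U \<subseteq> U0" and nz: "\<forall>v\<in>\<Union>U. vec_nth v k0 \<noteq> 0"
    by (rule reg_nonzero_nbhd[OF U0(1) reg_coord[OF U0(1)] U0(2) pP k0])
  obtain U1 Pr where U1: "zopen U1" "P \<in> U1" "U1 \<subseteq> U" and Pr: "oreg sM sM 0 U1 Pr"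
    and Prk: "\<forall>v\<in>\<Union>U1. \<forall>m. \<beta> v (Pr v m) = 0 \<and> (\<beta> v m = 0 \<longrightarrow> Pr v m = m)"
    by (rule ker_beta_projection[OF st U(1,2) pP nz])
  have U1': "U1 \<subseteq> U0" using U U1 by auto
  \<comment> \<open>Over the constant basis \<open>bM\<close> these images under the projection
    generate \<open>ker \<beta>\<close> near \<open>P\<close>.\<close>
  define \<kappa> where "\<kappa> j v = Pr v j" for j v
  have \<kappa>: "in_ker U1 (\<kappa> j)" for j using Pr Prk unfolding in_ker_def \<kappa>_def oreg_def by blast
  have "\<exists>W s. zopen W \<and> P \<in> W \<and> W \<subseteq> U1 \<and> in_ker W s \<and>
     (\<forall>l<n. \<forall>v\<in>\<Union>W. coord \<Phi> W s l v = (if l = k then 1 else 0))" for k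
  proof -
    \<comment> \<open>The \<open>k\<close>-th standard section of \<open>O^n\<close>. For
      \<open>k \<ge> n\<close> it is zero, which lets a lift be chosen for every
      \<open>k\<close>.\<close>
    define g where "g = (\<lambda>l\<in>{..<n}. \<lambda>v\<in>\<Union>U1. if l = k then 1 else 0 :: complex)"
    have "g \<in> carrier (sects (G n) U1)"
      unfolding G_carrier_iff g_def using U1(1) by (auto intro: reg_const reg_zero)
    from lift[OF U1(1) U1' this U1(2)] obtain W s where W: "zopen W" "P \<in> W" "W \<subseteq> U1"
      "s \<in> sections K W" "\<Phi> W s = rstr (G n) U1 W g" by blast
    have s: "s \<in> extensional (\<Union>W)" "in_ker W s" using W by (simp_all add: K_carrier_iff)
    have "coord \<Phi> W s = rstr (G n) U1 W g" using W(5) s(1)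
      by (simp add: coord_def extensional_restrict)
    moreover have "\<Union>W \<subseteq> \<Union>U1" using W(3) by blast
    ultimately have "\<forall>l<n. \<forall>v\<in>\<Union>W. coord \<Phi> W s l v = (if l = k then 1 else 0)"
      by (simp only: G_ops) (auto simp: g_def)
    with W s show ?thesis by blast
  qed
  then obtain Wf sf where Wf: "\<And>k. zopen (Wf k)" "\<And>k. P \<in> Wf k" "\<And>k. Wf k \<subseteq> U1" "\<And>k. in_ker (Wf k)
    (sf k)"
    and sf: "\<And>k l v. l < n \<Longrightarrow> v \<in> \<Union>(Wf k) \<Longrightarrow> coord \<Phi> (Wf k) (sf k) l v = (if l = k then 1 else 0)"
      by metis
  obtain U2 where U2: "zopen U2" "P \<in> U2" "U2 \<subseteq> U1" "\<forall>k\<in>{..<n}. U2 \<subseteq> Wf k"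
    by (rule finite_Int_nbhd[OF U1(1,2), of "{..<n}" Wf]) (use Wf in auto)
  have U2': "U2 \<subseteq> U0" using U2 U1' by auto
  have \<kappa>2: "in_ker U2 (\<kappa> j)" for j using in_ker_mono[OF \<kappa> U2(1,3)] .
  have sf2: "in_ker U2 (sf k)" if "k < n" for k using in_ker_mono[OF Wf(4) U2(1)] U2(4) that
    by blast
  have csf: "coord \<Phi> U2 (sf k) l v = (if l = k then 1 else 0)" if "k < n" "l < n" "v \<in> \<Union>U2"
    for k l v
  proof -
    have "U2 \<subseteq> Wf k" using U2(4) that by auto
    then have "v \<in> \<Union>(Wf k)" using that by blast
    then show ?thesis
      using coord_restrict[OF \<Phi> Wf(1) _ U2(1) \<open>U2 \<subseteq> Wf k\<close> Wf(4) that(2,3)] sf[OF that(2)] Wf(3)[of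
        k] U1' by auto
  qed
  define F where "F j k = coord \<Phi> U2 (\<kappa> j) k" for j k
  have F: "reg 0 U2 (F j k)" if "k < n" for j k
    unfolding F_def by (rule coord_reg[OF \<Phi> U2(1) U2' \<kappa>2 that])
  \<comment> \<open>The generator minus its expansion in the lifts has zero coordinates, so it lies
    in the image of \<alpha>.\<close>
  define \<nu> where "\<nu> j v = \<kappa> j v + (\<Sum>k<n. sM (- F j k v) (sf k v))" for j v
  have "in_im U2 (\<nu> j)" for j
  proof -
    have r: "reg 0 U2 (\<lambda>v. - F j k v)" if "k < n" for k by (rule reg_uminus[OF U2(1) F[OF that]])
    have S: "in_ker U2 (\<lambda>v. \<Sum>k<n. sM (- F j k v) (sf k v))"
      using in_ker_sum[OF \<Phi> U2(1), of "{..<n}" "\<lambda>k v. - F j k v" sf] r sf2 by simp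
    have \<nu>K: "in_ker U2 (\<nu> j)" unfolding \<nu>_def by (rule in_ker_add[OF \<kappa>2 S])
    have "coord \<Phi> U2 (\<nu> j) l v = 0" if l: "l < n" and v: "v \<in> \<Union>U2" for l v
    proof -
      have "coord \<Phi> U2 (\<nu> j) l v = F j l v + coord \<Phi> U2 (\<lambda>v. \<Sum>k<n. sM (- F j k v) (sf k v)) l v"
        unfolding \<nu>_def F_def by (rule coord_add[OF \<Phi> U2(1) U2' \<kappa>2 S[unfolded F_def] l v])
      also have "coord \<Phi> U2 (\<lambda>v. \<Sum>k<n. sM (- F j k v) (sf k v)) l v = (\<Sum>k<n. - F j k v * coord \<Phi> U2
        (sf k) l v)"
        by (rule coord_sum[OF \<Phi> U2(1) U2' finite_lessThan _ _ l v]) (use r sf2 in auto)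
      also have "\<dots> = (\<Sum>k<n. if k = l then - F j k v else 0)" by (rule sum.cong[OF refl]) (subst
        csf[OF _ l v], auto)
      also have "\<dots> = - F j l v" using l by simp
      finally show ?thesis by simp
    qed
    then show ?thesis using coord_eq_0_iff[OF \<Phi> U2(1) U2' \<nu>K] by blast
  qed
  then have "\<exists>W t. zopen W \<and> P \<in> W \<and> W \<subseteq> U2 \<and> vreg sV (- 1) W t \<and> (\<forall>v\<in>\<Union>W. \<nu> j v = \<alpha> v (t v))" for j
    using U2(2) by (simp add: in_im_def image_at_def)
  then obtain Wt t where Wt: "\<And>j. zopen (Wt j)" "\<And>j. P \<in> Wt j" "\<And>j. Wt j \<subseteq> U2"
    and t: "\<And>j. vreg sV (- 1) (Wt j) (t j)" "\<And>j v. v \<in> \<Union>(Wt j) \<Longrightarrow> \<nu> j v = \<alpha> v (t j v)" by metis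
  obtain U3 where U3: "zopen U3" "P \<in> U3" "U3 \<subseteq> U2" "\<forall>j\<in>bM. U3 \<subseteq> Wt j"
    by (rule finite_Int_nbhd[OF U2(1,2) M.finite_Basis, of Wt]) (use Wt in auto)
  have U3': "U3 \<subseteq> U0" "U3 \<subseteq> U1" "U3 \<subseteq> U" using U3 U2' U2 U1 by auto
  have t3: "vreg sV (- 1) U3 (t j)" if "j \<in> bM" for j
    using vreg_mono[OF t(1) U3(1)] U3(4) that by blast
  define l where "l v = inverse (vec_nth v k0)" for v :: "complex ^ 4"
  have l: "reg (- 1) U3 l" unfolding l_def
    using reg_inverse[OF reg_coord[OF U3(1), of k0]] nz U3'(3) by blast
  have la: "vreg sV (- 1) U3 (\<lambda>v. sV (l v) a)" by (rule vreg_scale_const[OF l U3(1)])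
  \<comment> \<open>Dividing by the coordinate \<open>k0\<close> gives the vector \<open>a\<close>
    degree -1, the twist of the source of \<alpha>. The resulting section of \<open>N\<close>
    vanishes at \<open>p\<close>.\<close>
  define \<tau> where "\<tau> v = \<alpha> v (sV (l v) a)" for v
  have \<tau>r: "vreg sM 0 U3 \<tau>" unfolding \<tau>_def using V.oreg_apply[OF U3(1) oreg_alpha[OF U3(1)] la]
    by simp
  have "image_at U3 \<tau> Q" if "Q \<in> U3" for Q
    by (rule image_atI[OF U3(1) that order_refl la]) (simp add: \<tau>_def)
  then have \<tau>N: "in_im U3 \<tau>" using \<tau>r by (simp add: in_im_def)
  \<comment> \<open>As coordinates of \<open>\<tau>\<close> in a constant basis these vanish at
    \<open>p\<close>. Since \<open>Pr\<close> fixes \<open>\<tau>\<close>, they are also its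
    coefficients with respect to the \<open>\<kappa> j\<close>.\<close>
  define g where "g j v = M.representation bM (\<tau> v) j" for j v
  have g: "reg 0 U3 (g j)" for j unfolding g_def by (rule vregD[OF \<tau>r M.linear_representation])
  have \<tau>_sum: "\<tau> v = (\<Sum>j\<in>bM. sM (g j v) (\<kappa> j v))" if v: "v \<in> \<Union>U3" for v
  proof -
    have lPr: "Vector_Spaces.linear sM sM (Pr v)" using Pr by (simp add: oreg_def)
    have v1: "v \<in> \<Union>U1" using v U3'(2) by blast
    have "\<beta> v (\<tau> v) = 0" by (simp add: \<tau>_def beta_alpha)
    then have "Pr v (\<tau> v) = \<tau> v" using Prk v1 by blast
    moreover have "(\<Sum>j\<in>bM. sM (g j v) j) = \<tau> v" unfolding g_def by (rule M.sum_Basis)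
    moreover have "Pr v (\<Sum>j\<in>bM. sM (g j v) j) = (\<Sum>j\<in>bM. sM (g j v) (\<kappa> j v))"
      by (simp add: linear_simps[OF lPr] \<kappa>_def)
    ultimately show ?thesis by simp
  qed
  \<comment> \<open>\<open>\<tau>\<close> lies in the image of \<alpha>, so its class is zero;
    linearity turns this into relations between the \<open>g j\<close> and
    \<open>F j k\<close>.\<close>
  have gF: "(\<Sum>j\<in>bM. g j v * F j k v) = 0" if k: "k < n" and v: "v \<in> \<Union>U3" for k v
  proof -
    have \<kappa>3: "in_ker U3 (\<kappa> j)" for j by (rule in_ker_mono[OF \<kappa>2 U3(1,3)])
    have "coord \<Phi> U3 \<tau> k v = 0"
      using coord_eq_0_iff[OF \<Phi> U3(1) U3'(1) in_im_imp_Ksec[OF \<tau>N], THEN iffD2, OF \<tau>N] k v by blast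
    then have "0 = coord \<Phi> U3 \<tau> k v" by simp
    also have "coord \<Phi> U3 \<tau> = coord \<Phi> U3 (\<lambda>v. \<Sum>j\<in>bM. sM (g j v) (\<kappa> j v))"
      by (rule coord_cong[OF \<tau>_sum])
    also have "\<dots> k v = (\<Sum>j\<in>bM. g j v * coord \<Phi> U3 (\<kappa> j) k v)"
      by (rule coord_sum[OF \<Phi> U3(1) U3'(1) M.finite_Basis g \<kappa>3 k v])
    also have "\<dots> = (\<Sum>j\<in>bM. g j v * F j k v)"
      unfolding F_def using coord_restrict[OF \<Phi> U2(1) U2' U3(1,3) \<kappa>2 k v] by simp
    finally show ?thesis by simp
  qed
  \<comment> \<open>A second preimage of \<open>\<tau>\<close> under \<alpha>: the parts involving
    \<open>sf k\<close> cancel by \<open>gF\<close>. It vanishes at \<open>p\<close> because the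
    \<open>g j\<close> do.\<close>
  define q where "q v = (\<Sum>j\<in>bM. sV (g j v) (t j v))" for v
  have q: "vreg sV (- 1) U3 q" unfolding q_def by (intro vreg_sum[OF U3(1)] vreg_scale0[OF g t3])
  have "\<alpha> v (sV (l v) a - q v) = 0" if v: "v \<in> \<Union>U3" for v
  proof -
    have "\<kappa> j v = \<alpha> v (t j v) + (\<Sum>k<n. sM (F j k v) (sf k v))" if j: "j \<in> bM" for j
    proof -
      have "v \<in> \<Union>(Wt j)" using v U3(4) j by blast
      then have "\<kappa> j v + (\<Sum>k<n. sM (- F j k v) (sf k v)) = \<alpha> v (t j v)" using t(2)
        by (simp add: \<nu>_def)
      then show ?thesis by (simp add: M.scale_minus_left sum_negf diff_eq_eq)
    qed
    then have "\<tau> v = (\<Sum>j\<in>bM. sM (g j v) (\<alpha> v (t j v) + (\<Sum>k<n. sM (F j k v) (sf k v))))"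
      using \<tau>_sum[OF v] by simp
    also have "\<dots> = \<alpha> v (q v) + (\<Sum>j\<in>bM. \<Sum>k<n. sM (g j v * F j k v) (sf k v))"
      by (simp add: q_def linear_simps[OF linear_alpha] M.scale_right_distrib sum.distrib
        M.scale_sum_right)
    also have "(\<Sum>j\<in>bM. \<Sum>k<n. sM (g j v * F j k v) (sf k v)) = (\<Sum>k<n. sM (\<Sum>j\<in>bM. g j v * F j k v) (sf
      k v))"
      by (subst sum.swap) (simp add: M.scale_sum_left)
    also have "\<dots> = 0" by (simp add: gF[OF _ v])
    finally show ?thesis by (simp add: \<tau>_def linear_simps[OF linear_alpha])
  qed
  \<comment> \<open>Injectivity at \<open>p\<close> itself is what is being proved; the two
    preimages agree there because their difference is regular and lies in the kernel of \<alpha>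
    throughout a neighbourhood.\<close>
  then have "sV (l p) a - q p = 0"
    using alpha_kernel_zero[OF U3(1) vreg_diff[OF U3(1) la q] _ U3(2) pP] by blast
  moreover have "\<tau> p = 0" by (simp add: \<tau>_def linear_simps[OF linear_alpha] a M.scale_zero_right)
  then have "q p = 0" by (simp add: q_def g_def M.representation_zero)
  ultimately show "a = 0" using k0 by (simp add: l_def V.scale_eq_0_iff)
qed

end

section \<open>Local freeness from fibrewise injectivity\<close>

context adhm_monad
begin

text \<open>The dual of \<open>ker_beta_projection\<close>: a constant left inverse \<open>R\<close>
  of \<open>\<alpha> p\<close> makes \<open>R l \<alpha>\<close> invertible near \<open>p\<close>,
  and with its inverse \<open>S\<close> the map \<open>H = l S R\<close> is a regular left inverse
  of \<alpha>. The projection onto the image is \<open>\<alpha> H\<close>.\<close>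

lemma im_alpha_projection:
  assumes inj: "\<And>a. \<alpha> p a = 0 \<Longrightarrow> a = 0" and U: "zopen U" and P: "P \<in> U" "p \<in> P"
    and k: "\<forall>v\<in>\<Union>U. vec_nth v k \<noteq> 0"
  obtains W H where "zopen W" "P \<in> W" "W \<subseteq> U" "oreg sM sV (- 1) W H"
    "\<forall>v\<in>\<Union>W. \<forall>a. H v (\<alpha> v a) = a"
proof -
  interpret VM: vector_space_pair sV sM by unfold_locales
  let ?l = "\<lambda>v. inverse (vec_nth v k)"
  have "Fun.inj (\<alpha> p)"
  proof (rule injI)
    fix a b assume "\<alpha> p a = \<alpha> p b"
    then have "\<alpha> p (a - b) = 0" by (simp add: linear_simps[OF linear_alpha])
    then show "a = b" using inj[of "a - b"] by simp
  qed
  then obtain R where R: "Vector_Spaces.linear sM sV R" "R \<circ> \<alpha> p = id"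
    using VM.linear_injective_left_inverse[OF linear_alpha] by blast
  have l: "reg (- 1) U ?l" using reg_inverse[OF reg_coord[OF U, of k]] k by blast
  have la: "oreg sV sM 0 U (\<lambda>v e. sM (?l v) (\<alpha> v e))"
    using oreg_scale[OF l oreg_alpha[OF U]] by simp
  have T: "oreg sV sV 0 U (\<lambda>v e. R (sM (?l v) (\<alpha> v e)))"
    using M.oreg_compose[OF U oreg_const[OF U R(1)] la] by simp
  have "e = 0" if "R (sM (?l p) (\<alpha> p e)) = 0" for e
  proof -
    have "?l p \<noteq> 0" using k P by auto
    moreover have "R (\<alpha> p e) = e" using R(2) by (metis comp_apply id_apply)
    ultimately show ?thesis using that by (auto simp: linear_simps[OF R(1)] V.scale_eq_0_iff)
  qed
  then obtain W S where W: "zopen W" "P \<in> W" "W \<subseteq> U" and S: "oreg sV sV 0 W S"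
    and inv: "\<forall>v\<in>\<Union>W. \<forall>e. R (sM (?l v) (\<alpha> v (S v e))) = e \<and> S v (R (sM (?l v) (\<alpha> v e))) = e"
    by (rule V.oreg_inverse[OF U T P])
  define H where "H v m = sV (?l v) (S v (R m))" for v m
  have "oreg sM sV (- 1) W H" unfolding H_def
    using oreg_scale[OF reg_mono[OF l W(1,3)] V.oreg_compose[OF W(1) S oreg_const[OF W(1) R(1)]]]
      by simp
  moreover have "H v (\<alpha> v a) = a" if v: "v \<in> \<Union>W" for v a
  proof -
    have lS: "Vector_Spaces.linear sV sV (S v)" using S by (simp add: oreg_def)
    have "S v (R (sM (?l v) (\<alpha> v a))) = a" using inv v by blast
    then show ?thesis by (simp add: H_def linear_simps[OF lS] linear_simps[OF R(1)])
  qed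
  ultimately show thesis using that[OF W] by blast
qed

text \<open>The \<open>b k\<close> form a basis of the range, and \<open>c k\<close> reads the
  coordinate of \<open>T m\<close>, so that it is a functional on the whole space; on the range,
  where \<open>T\<close> is the identity, these are dual to the \<open>b k\<close>.\<close>

lemma constant_frame:
  assumes lin: "Vector_Spaces.linear sM sM T" and idem: "\<And>m. T (T m) = T m"
  obtains n :: nat and b c where "\<forall>k<n. T (b k) = b k" "\<forall>k. functional sM (c k)"
    "\<forall>k<n. \<forall>l<n. c k (b l) = (if k = l then 1 else 0)"
    "\<forall>m. T m = (\<Sum>k<n. sM (c k m) (b k))"
proof -
  have sub: "M.subspace (range T)" unfolding M.subspace_def
    using linear_simps(1,2,3)[OF lin, symmetric] by blast
  obtain B where B: "B \<subseteq> range T" "M.independent B" "range T \<subseteq> M.span B"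
    by (rule M.maximal_independent_subset)
  have fB: "finite B" using M.independent_bound_general[OF B(2)] by blast
  obtain b where b: "bij_betw b {0..<card B} B" using ex_bij_betw_nat_finite[OF fB] by blast
  define n where "n = card B"
  define c where "c k m = M.representation B (T m) (b k)" for k m
  have Tspan: "T m \<in> M.span B" for m using B(3) by blast
  have bB: "b k \<in> B" if "k < n" for k using bij_betwE[OF b] that by (simp add: n_def)
  have Tb: "T (b k) = b k" if "k < n" for k using bB[OF that] B(1) idem by auto
  have "vector_space ((*) :: complex \<Rightarrow> complex \<Rightarrow> complex)" by unfold_locales (auto simp:
    algebra_simps)
  then have cl: "functional sM (c k)" for k
    by (intro linearI_vs M.vector_space_axioms)
      (simp_all add: c_def linear_simps[OF lin] M.representation_add[OF B(2) Tspan Tspan]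
        M.representation_scale[OF B(2) Tspan])
  have cb: "c k (b l) = (if k = l then 1 else 0)" if "k < n" "l < n" for k l
  proof -
    have "b k = b l \<longleftrightarrow> k = l" using bij_betw_imp_inj_on[OF b] that
      by (auto simp: n_def dest: inj_onD)
    then show ?thesis using bB[OF that(2)] by (auto simp: c_def Tb that M.representation_basis[OF
      B(2)])
  qed
  have "T m = (\<Sum>k<n. sM (c k m) (b k))" for m
  proof -
    have "(\<Sum>k = 0..<n. sM (M.representation B (T m) (b k)) (b k)) = (\<Sum>x\<in>B. sM (M.representation B (T
      m) x) x)"
      using sum.reindex_bij_betw[OF b, of "\<lambda>x. sM (M.representation B (T m) x) x"]
        by (simp add: n_def)
    also have "\<dots> = T m" by (rule M.sum_representation_eq[OF B(2) Tspan fB order_refl])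
    finally show ?thesis by (simp add: c_def atLeast0LessThan)
  qed
  then show thesis using that[of n b c] Tb cl cb by simp
qed

text \<open>A basis of the range of \<open>\<pi> p\<close>, moved to nearby fibres by
  \<open>T v\<close>, is a frame for the ranges of \<open>\<pi> v\<close>. Coordinates in it define
  \<open>\<Phi>\<close>; its kernel is \<open>im \<alpha>\<close> because \<open>\<pi> v\<close> on
  \<open>ker \<beta>\<close> kills exactly \<open>im \<alpha>\<close>.\<close>

theorem locally_free_if_inj_alpha:
  assumes st: "C_stable sV sW D" and inj: "\<And>p a. p \<noteq> 0 \<Longrightarrow> \<alpha> p a = 0 \<Longrightarrow> a = 0"
  shows "locally_free zariski structure_sheaf E"
  unfolding locally_free_def topspace_zariski
proof
  fix P :: "(complex ^ 4) set" assume P: "P \<in> proj_space"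
  then obtain p where p: "p \<noteq> 0" "p \<in> P" using mem_proj_point by (auto simp: proj_space_def)
  obtain U0 k0 where U0: "zopen U0" "P \<in> U0" "\<forall>v\<in>\<Union>U0. vec_nth v k0 \<noteq> 0"
    by (rule coord_nbhd[OF P])
  obtain U1 Pr where U1: "zopen U1" "P \<in> U1" "U1 \<subseteq> U0" and Pr: "oreg sM sM 0 U1 Pr"
    and Prk: "\<forall>v\<in>\<Union>U1. \<forall>m. \<beta> v (Pr v m) = 0 \<and> (\<beta> v m = 0 \<longrightarrow> Pr v m = m)"
    by (rule ker_beta_projection[OF st U0(1,2) p(2) U0(3)])
  have nz1: "\<forall>v\<in>\<Union>U1. vec_nth v k0 \<noteq> 0" using U0(3) U1(3) by blast
  obtain U2 H where U2: "zopen U2" "P \<in> U2" "U2 \<subseteq> U1" and H: "oreg sM sV (- 1) U2 H"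
    and Hk: "\<forall>v\<in>\<Union>U2. \<forall>a. H v (\<alpha> v a) = a"
    by (rule im_alpha_projection[OF inj[OF p(1)] U1(1,2) p(2) nz1])
  \<comment> \<open>This is \<open>(1 - \<alpha> H) Pr\<close>, the projection onto the complement
    \<open>ker \<beta> \<inter> ker H\<close> of \<open>im \<alpha>\<close> in
    \<open>ker \<beta>\<close>.\<close>
  define \<pi> where "\<pi> v m = Pr v m - \<alpha> v (H v (Pr v m))" for v m
  have Pr2: "oreg sM sM 0 U2 Pr" by (rule oreg_mono[OF Pr U2(1,3)])
  have "oreg sM sV (- 1) U2 (\<lambda>v m. H v (Pr v m))" using M.oreg_compose[OF U2(1) H Pr2] by simp
  then have "oreg sM sM 0 U2 (\<lambda>v m. \<alpha> v (H v (Pr v m)))"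
    using V.oreg_compose[OF U2(1) oreg_alpha[OF U2(1)]] by fastforce
  then have \<pi>: "oreg sM sM 0 U2 \<pi>" unfolding \<pi>_def by (rule oreg_diff[OF U2(1) Pr2])
  have l\<pi>: "Vector_Spaces.linear sM sM (\<pi> v)" for v using \<pi> by (simp add: oreg_def)
  have lH: "Vector_Spaces.linear sM sV (H v)" for v using H by (simp add: oreg_def)
  have Prk2: "\<beta> v (Pr v m) = 0" "\<beta> v m = 0 \<Longrightarrow> Pr v m = m" if "v \<in> \<Union>U2" for v m
    using Prk U2(3) that by blast+
  have \<beta>\<pi>: "\<beta> v (\<pi> v m) = 0" if "v \<in> \<Union>U2" for v m
    using Prk2(1)[OF that] by (simp add: \<pi>_def linear_simps[OF linear_beta] beta_alpha)
  have \<pi>_ker: "\<pi> v m = m - \<alpha> v (H v m)" if "v \<in> \<Union>U2" "\<beta> v m = 0" for v m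
    using Prk2(2)[OF that] by (simp add: \<pi>_def)
  have Hk2: "H v (\<alpha> v a) = a" if "v \<in> \<Union>U2" for v a using Hk that by blast
  have H\<pi>: "H v (\<pi> v m) = 0" if "v \<in> \<Union>U2" for v m
    using Hk2[OF that] by (simp add: \<pi>_def linear_simps[OF lH])
  have idem: "\<pi> v (\<pi> v m) = \<pi> v m" if "v \<in> \<Union>U2" for v m
    using \<pi>_ker[OF that \<beta>\<pi>[OF that]] H\<pi>[OF that] by (simp add: linear_simps[OF linear_alpha])
  have pU2: "p \<in> \<Union>U2" using U2(2) p(2) by blast
  obtain n :: nat and b c where b: "\<forall>k<n. \<pi> p (b k) = b k" and c': "\<forall>k. functional sM (c k)"
    and cb: "\<forall>k<n. \<forall>l<n. c k (b l) = (if k = l then 1 else 0)"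
    and \<pi>p: "\<forall>m. \<pi> p m = (\<Sum>k<n. sM (c k m) (b k))"
    by (rule constant_frame[OF l\<pi>[of p] idem[OF pU2]])
  have c: "functional sM (c k)" for k using c' by blast
  \<comment> \<open>\<open>T v\<close> intertwines the projections \<open>\<pi> p\<close> and \<open>\<pi> v\<close>, and \<open>T p\<close> is the identity.\<close>
  define T where "T v m = \<pi> v (\<pi> p m) + ((m - \<pi> p m) - \<pi> v (m - \<pi> p m))" for v m
  have c0: "oreg sM sM 0 U2 (\<lambda>v m. \<pi> p m)" by (rule oreg_const[OF U2(1) l\<pi>])
  have id0: "oreg sM sM 0 U2 (\<lambda>v m. m)" using oreg_const[OF U2(1) M.linear_id] by (simp add: id_def)
  have c1: "oreg sM sM 0 U2 (\<lambda>v m. m - \<pi> p m)" by (rule oreg_diff[OF U2(1) id0 c0])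
  have "oreg sM sM 0 U2 (\<lambda>v m. \<pi> v (\<pi> p m))" "oreg sM sM 0 U2 (\<lambda>v m. \<pi> v (m - \<pi> p m))"
    using M.oreg_compose[OF U2(1) \<pi> c0] M.oreg_compose[OF U2(1) \<pi> c1] by simp_all
  then have T: "oreg sM sM 0 U2 T"
    unfolding T_def by (intro oreg_add oreg_diff[OF U2(1)] id0 c0)
  have Tp: "T p m = m" for m by (simp add: T_def linear_simps[OF l\<pi>] idem[OF pU2])
  then have Tinj: "e = 0" if "T p e = 0" for e using that by simp
  obtain U S where U: "zopen U" "P \<in> U" "U \<subseteq> U2" and S: "oreg sM sM 0 U S"
    and inv': "\<forall>v\<in>\<Union>U. \<forall>m. T v (S v m) = m \<and> S v (T v m) = m"
    by (rule M.oreg_inverse[OF U2(1) T U2(2) p(2) Tinj])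
  have inv: "T v (S v m) = m" "S v (T v m) = m" if "v \<in> \<Union>U" for v m using inv' that by blast+
  have lS: "Vector_Spaces.linear sM sM (S v)" for v using S by (simp add: oreg_def)
  have in2: "v \<in> \<Union>U2" if "v \<in> \<Union>U" for v using that U(3) by blast
  \<comment> \<open>By idempotence both sides reduce to \<open>\<pi> v (\<pi> p m)\<close>.\<close>
  have T\<pi>: "T v (\<pi> p m) = \<pi> v (T v m)" if v: "v \<in> \<Union>U" for v m
    by (simp add: T_def linear_simps[OF l\<pi>] idem[OF pU2] idem[OF in2[OF v]])
  have S\<pi>: "S v (\<pi> v m) = \<pi> p (S v m)" if v: "v \<in> \<Union>U" for v m
  proof -
    have "\<pi> v m = T v (\<pi> p (S v m))" using T\<pi>[OF v, of "S v m"] inv[OF v] by simp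
    then show ?thesis using inv[OF v] by simp
  qed
  \<comment> \<open>\<open>S v\<close> carries the range of \<open>\<pi> v\<close> back to the fixed
    range of \<open>\<pi> p\<close>, where the constant functionals read off coordinates.\<close>
  define C where "C k v m = c k (S v (\<pi> v m))" for k v m
  have C_sum: "S v (\<pi> v m) = (\<Sum>k<n. sM (C k v m) (b k))" if v: "v \<in> \<Union>U" for v m
  proof -
    have "S v (\<pi> v m) = \<pi> p (S v (\<pi> v m))" using S\<pi>[OF v, of "\<pi> v m"] idem[OF in2[OF v]] by simp
    then show ?thesis using \<pi>p[rule_format, of "S v (\<pi> v m)"] by (simp add: C_def)
  qed
  have lC: "C k v (x + y) = C k v x + C k v y" "C k v (sM z x) = z * C k v x" for k v x y z
    by (simp_all add: C_def linear_simps[OF l\<pi>] linear_simps[OF lS] linear_simps[OF c])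
  have regC: "reg 0 V (\<lambda>v. C k v (s v))" if V: "zopen V" "V \<subseteq> U" and s: "vreg sM 0 V s" for V s k
  proof -
    have "vreg sM (0 + (0 + 0)) V (\<lambda>v. S v (\<pi> v (s v)))"
      using V U(3) by (intro M.oreg_apply[OF V(1) oreg_mono[OF S V]] M.oreg_apply[OF V(1) _ s]
        oreg_mono[OF \<pi> V(1)]) auto
    from vregD[OF this c] show ?thesis by (simp add: C_def)
  qed
  define \<Phi> where "\<Phi> V s = (\<lambda>k\<in>{..<n}. \<lambda>v\<in>\<Union>V. C k v (s v))" for V s
  have ker: "\<Phi> V s = zero (sects (G n) V) \<longleftrightarrow> s \<in> sections N V"
    if V: "zopen V" "V \<subseteq> U" and s: "s \<in> sections K V" for V s
  proof -
    have sK: "in_ker V s" "s \<in> extensional (\<Union>V)" using s V by (simp_all add: K_carrier_iff)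
    have inU: "v \<in> \<Union>U" if "v \<in> \<Union>V" for v using that V(2) by blast
    have \<beta>0: "\<beta> v (s v) = 0" if "v \<in> \<Union>V" for v using sK(1) that unfolding in_ker_def by blast
    have "\<Phi> V s = zero (sects (G n) V) \<longleftrightarrow> (\<forall>k<n. \<forall>v\<in>\<Union>V. C k v (s v) = 0)"
      unfolding \<Phi>_def G_ops restrict_eq_restrict_iff by auto
    \<comment> \<open>On \<open>ker \<beta>\<close> the projection is \<open>1 - \<alpha> H\<close>.
      Its vanishing exhibits \<open>H s\<close> as one regular preimage over all of
      \<open>V\<close>, so membership in the image becomes a pointwise equation.\<close>
    also have "\<dots> \<longleftrightarrow> (\<forall>v\<in>\<Union>V. s v = \<alpha> v (H v (s v)))"
    proof
      assume C0: "\<forall>k<n. \<forall>v\<in>\<Union>V. C k v (s v) = 0"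
      show "\<forall>v\<in>\<Union>V. s v = \<alpha> v (H v (s v))"
      proof
        fix v assume v: "v \<in> \<Union>V"
        have "\<forall>k<n. C k v (s v) = 0" using C0 v by blast
        then have "S v (\<pi> v (s v)) = 0" using C_sum[OF inU[OF v], of "s v"] by simp
        then have "T v (S v (\<pi> v (s v))) = 0" by (simp add: T_def linear_simps[OF l\<pi>])
        then have "\<pi> v (s v) = 0" using inv[OF inU[OF v]] by simp
        then show "s v = \<alpha> v (H v (s v))" using \<pi>_ker[OF in2[OF inU[OF v]] \<beta>0[OF v]] by simp
      qed
    next
      assume e: "\<forall>v\<in>\<Union>V. s v = \<alpha> v (H v (s v))"
      have "C k v (s v) = 0" if v: "v \<in> \<Union>V" for k v
      proof -
        have "\<pi> v (s v) = s v - \<alpha> v (H v (s v))" by (rule \<pi>_ker[OF in2[OF inU[OF v]] \<beta>0[OF v]])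
        also have "\<dots> = 0" unfolding right_minus_eq by (rule bspec[OF e v])
        finally show ?thesis by (simp add: C_def linear_simps[OF lS] linear_simps[OF c])
      qed
      then show "\<forall>k<n. \<forall>v\<in>\<Union>V. C k v (s v) = 0" by blast
    qed
    also have "\<dots> \<longleftrightarrow> in_im V s"
    proof
      assume e: "\<forall>v\<in>\<Union>V. s v = \<alpha> v (H v (s v))"
      have sr: "vreg sM 0 V s" using sK(1) by (simp add: in_ker_def)
      have "V \<subseteq> U2" using V(2) U(3) by blast
      then have "vreg sV (- 1 + 0) V (\<lambda>v. H v (s v))"
        by (intro M.oreg_apply[OF V(1) oreg_mono[OF H V(1)] sr])
      then have hr: "vreg sV (- 1) V (\<lambda>v. H v (s v))" by simp
      have "image_at V s Q" if "Q \<in> V" for Q by (rule image_atI[OF V(1) that order_refl hr e])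
      then show "in_im V s" using sr by (simp add: in_im_def)
    next
      assume N: "in_im V s"
      show "\<forall>v\<in>\<Union>V. s v = \<alpha> v (H v (s v))"
      proof
        fix v assume v: "v \<in> \<Union>V"
        then obtain Q where Q: "Q \<in> V" "v \<in> Q" by blast
        from N Q(1) obtain W t where "zopen W" "Q \<in> W" "W \<subseteq> V" "vreg sV (- 1) W t"
          "\<forall>v\<in>\<Union>W. s v = \<alpha> v (t v)" by (rule in_imE)
        then have "s v = \<alpha> v (t v)" using Q(2) by blast
        moreover have "H v (\<alpha> v (t v)) = t v" by (rule Hk2[OF in2[OF inU[OF v]]])
        ultimately show "s v = \<alpha> v (H v (s v))" by simp
      qed
    qed
    also have "\<dots> \<longleftrightarrow> s \<in> sections N V" using V(1) sK(2) by (simp add: N_carrier_iff)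
    finally show ?thesis .
  qed
  have "kernel_hom zariski structure_sheaf K N (G n) U \<Phi>"
    unfolding kernel_hom_def
  proof (intro conjI allI impI ballI; (elim conjE)?)
    fix V assume V: "zopen V" "V \<subseteq> U"
    show "linear_map (sects structure_sheaf V) (sects K V) (sects (G n) V) (\<Phi> V)"
      unfolding linear_map_def
    proof (intro conjI ballI funcsetI)
      fix s assume s: "s \<in> sections K V"
      then have sr: "vreg sM 0 V s" using V(1) by (simp add: K_carrier_iff in_ker_def)
      show "\<Phi> V s \<in> carrier (sects (G n) V)"
        unfolding G_carrier_iff \<Phi>_def using regC[OF V sr] by simp
      show "\<Phi> V (add (sects K V) s t) = add (sects (G n) V) (\<Phi> V s) (\<Phi> V t)" for t
        unfolding \<Phi>_def G_ops KN_ops restrict_eq_restrict_iff by (simp add: lC)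
      show "\<Phi> V (smult (sects K V) f s) = smult (sects (G n) V) f (\<Phi> V s)" for f
        unfolding \<Phi>_def G_ops KN_ops restrict_eq_restrict_iff by (simp add: lC)
    qed
    show "\<Phi> V s = zero (sects (G n) V) \<longleftrightarrow> s \<in> sections N V" if "s \<in> sections K V" for s
      by (rule ker[OF V that])
  next
    fix V W s assume V: "zopen V" "zopen W" "W \<subseteq> V" "V \<subseteq> U" "s \<in> sections K V"
    then have "v \<in> \<Union>V" if "v \<in> \<Union>W" for v using that by blast
    then show "rstr (G n) V W (\<Phi> V s) = \<Phi> W (rstr K V W s)"
      unfolding \<Phi>_def G_ops KN_ops restrict_eq_restrict_iff by simp
  qed
  moreover have "g \<in> \<Phi> V ` sections K V"
    if V: "zopen V" "V \<subseteq> U" and g: "g \<in> carrier (sects (G n) V)" for V g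
  proof
    \<comment> \<open>The preimage combines the frame at \<open>p\<close> with coefficients
      \<open>g\<close> and projects to the fibre at \<open>v\<close>. On the range of
      \<open>\<pi> p\<close> the maps \<open>T v\<close> and \<open>\<pi> v\<close> agree, so
      \<open>S v\<close> recovers the combination.\<close>
    let ?e = "\<lambda>v. \<Sum>k<n. sM (g k v) (b k)"
    let ?s = "\<lambda>v\<in>\<Union>V. \<pi> v (?e v)"
    have inU: "v \<in> \<Union>U" if "v \<in> \<Union>V" for v using that V(2) by blast
    have "V \<subseteq> U2" using V(2) U(3) by blast
    moreover have "vreg sM 0 V ?e"
      using g by (intro vreg_sum[OF V(1)] vreg_scale_const[OF _ V(1)]) (simp add: G_carrier_iff)
    ultimately have "vreg sM (0 + 0) V (\<lambda>v. \<pi> v (?e v))"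
      by (intro M.oreg_apply[OF V(1) oreg_mono[OF \<pi> V(1)]])
    then show "?s \<in> sections K V"
      using V(1) \<beta>\<pi>[OF in2[OF inU]] by (simp add: K_carrier_iff in_ker_def)
    have "C l v (\<pi> v (?e v)) = g l v" if v: "v \<in> \<Union>V" and l: "l < n" for l v
    proof -
      have "\<pi> p (?e v) = ?e v" using b by (simp add: linear_simps[OF l\<pi>])
      then have "T v (?e v) = \<pi> v (?e v)" by (simp add: T_def linear_simps[OF l\<pi>])
      then have "S v (\<pi> v (?e v)) = ?e v" using inv(2)[OF inU[OF v], of "?e v"] by simp
      then have "C l v (\<pi> v (?e v)) = c l (?e v)" using idem[OF in2[OF inU[OF v]]]
        by (simp add: C_def)
      also have "\<dots> = (\<Sum>k<n. g k v * c l (b k))" by (simp add: linear_simps[OF c])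
      also have "\<dots> = (\<Sum>k<n. if l = k then g k v else 0)" by (rule sum.cong[OF refl]) (simp add: cb
        l)
      also have "\<dots> = g l v" using l by simp
      finally show ?thesis .
    qed
    then have "restrict (\<lambda>v. C k v (?s v)) (\<Union>V) = g k" if "k < n" for k
      using g that by (intro extensionalityI[of _ "\<Union>V"]) (auto simp: G_carrier_iff)
    then show "g = \<Phi> V ?s"
      unfolding \<Phi>_def using g by (intro extensionalityI[of _ "{..<n}"]) (auto simp: G_carrier_iff)
  qed
  ultimately have "iso_on zariski structure_sheaf U E (G n)"
    by (rule kernel_hom_imp_iso_on[OF module_sheaf_free U(1)])
  then show "\<exists>U n. zopen U \<and> P \<in> U \<and>
      iso_on zariski structure_sheaf U E (G n)"
    using U(1,2) by blast
qed

end

theorem corollary18: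
  fixes sV :: "complex \<Rightarrow> 'v::ab_group_add \<Rightarrow> 'v"
    and sW :: "complex \<Rightarrow> 'w::ab_group_add \<Rightarrow> 'w"
    and basisV :: "'v set" and basisW :: "'w set"
    and c r :: nat
    and D :: "('v, 'w) complex_adhm"
  assumes "finite_dimensional_vector_space sV basisV"
    and "finite_dimensional_vector_space sW basisW"
    and "vector_space.dim sV (UNIV :: 'v set) = c" and "c \<ge> 1"
    and "vector_space.dim sW (UNIV :: 'w set) = r" and "r \<ge> 1"
    and "complex_adhm_datum sV sW D"
    and "complex_adhm_equations D"
    and "C_stable sV sW D"
  shows "locally_free zariski structure_sheaf (monad_cohomology sV sW D)
     \<longleftrightarrow> C_regular sV sW D"
proof -
  have V: "complex_vector_space sV basisV" and W: "complex_vector_space sW basisW"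
    using assms(1,2) by (simp_all add: complex_vector_space_def)
  obtain bM where "complex_vector_space (sum_scale sV sW) bM"
    by (rule complex_vector_space_sum_scale[OF V W])
  with V W have "adhm_monad sV basisV sW basisW bM D"
    using assms(7,8) by (intro adhm_monad.intro adhm_monad_axioms.intro)
  then interpret adhm_monad sV basisV sW basisW bM D .
  show ?thesis
    unfolding C_regular_iff[OF assms(9)] monad_cohomology_eq
    using inj_alpha_if_locally_free[OF assms(9)] locally_free_if_inj_alpha[OF assms(9)] by blast
qed

end
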